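(* Let $Q$ be a smooth manifold and let $\Gamma$ be a SODE on $\mathbb{R}\times TQ$. Then $\Gamma$ is variational if and only if there is (locally, i.e. on some open neighbourhood $U\subseteq\mathbb{R}\times TQ$ of each point of $\mathbb{R}\times TQ$) a local diffeomorphism $F:\mathbb{R}\times TQ\supseteq U\to\mathbb{R}\times T^*Q$ over $\mathbb{R}\times Q$ such that $\mathrm{Im}(\gamma_{\Gamma,F})$ is a Lagrangian submanifold of the Poisson manifold $(T(\mathbb{R}\times T^*Q),\{\cdot,\cdot\}^T)$, where $\gamma_{\Gamma,F}=TF\circ\Gamma$.
   Context: Everything is smooth. Use coordinates $(t,q^i,\dot q^i)$ on $\mathbb{R}\times TQ$, $(t,q^i,p_i)$ on $\mathbb{R}\times T^*Q$ and induced coordinates $(t,q^i,p_i,v_t,\dot q^i,\dot p_i)$ on $T(\mathbb{R}\times T^*Q)$. Repeated indices are summed. SODE: a vector field $\Gamma$ on $\mathbb{R}\times TQ$ with $\langle\Gamma,dq^i-\dot q^i dt\rangle=0$ and $\langle\Gamma,dt\rangle=1$, i.e. locally $\Gamma=\frac{\partial}{\partial t}+\dot q^i\frac{\partial}{\partial q^i}+\Gamma^i(t,q,\dot q)\frac{\partial}{\partial\dot q^i}$. Variational: $\Gamma$ is variational if around each point of $\mathbb{R}\times TQ$ there is a locally defined function $L(t,q,\dot q)$ that is regular (the matrix $\left(\frac{\partial^2L}{\partial\dot q^i\partial\dot q^j}\right)$ is invertible) and satisfies $\frac{\partial^2L}{\partial\dot q^i\partial\dot q^j}(\ddot q^j-\Gamma^j(t,q,\dot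 q))=\frac{d}{dt}\left(\frac{\partial L}{\partial\dot q^i}\right)-\frac{\partial L}{\partial q^i}$ for all $i$. Over $\mathbb{R}\times Q$ means that $F$ commutes with the projections to $\mathbb{R}\times Q$: $F(t,q^i,\dot q^i)=(t,q^i,F_i(t,q,\dot q))$. Then $\gamma_{\Gamma,F}(t,q^i,\dot q^i)=(t,q^i,F_i,1,\dot q^i,\Gamma(F_i))$, where $\Gamma(F_i)=\frac{\partial F_i}{\partial t}+\dot q^j\frac{\partial F_i}{\partial q^j}+\Gamma^j\frac{\partial F_i}{\partial\dot q^j}$. Poisson structures: $\mathbb{R}\times T^*Q$ carries the Poisson bracket for which the projection $T^*(\mathbb{R}\times Q)\equiv T^*\mathbb{R}\times T^*Q\to\mathbb{R}\times T^*Q$, $(\alpha_t,\beta_q)\mapsto(t,\beta_q)$, is a Poisson morphism (with the canonical bracket on $T^*(\mathbb{R}\times Q)$); its only nonzero coordinate brackets are $\{q^i,p_i\}=1$. For a Poisson manifold $(P,\{\cdot,\cdot\})$ the tangent Poisson bracket on $TP$ is determined by $\{f^c,g^c\}^T=\{f,g\}^c$, $\{f^c,g^v\}^T=\{f,g\}^v$, $\{f^v,g^v\}^T=0$, where for a function $f$ on $P$, $f^v=f\circ\tau_P$ and $f^c$ is the complete lift ($f^c(v)=\langle df,v\rangle$ for $v\in TP$). For $P=\mathbb{R}\times T^*Q$ the only nonzero brackets of coordinates are $\{q^i,\dot p_i\}^T=1$ and $\{\dot q^i,p_i\}^T=1$. Lagrangian submanifold of a Poisson manifold: let $\sharp:T^*P\to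 TP$ be the bundle morphism induced by the Poisson bivector of $P$ and $\mathcal C=\mathrm{Im}(\sharp)$ its characteristic distribution. A submanifold $N\subset P$ is Lagrangian if $\sharp(TN^\circ)=TN\cap\mathcal C$ at all points of $N$, where $TN^\circ\subset T^*P|_N$ is the annihilator of $TN$. *)

theory Defs
  imports "HOL-Analysis.Analysis"
begin

section \<open>Smooth functions between Euclidean spaces\<close>

text \<open>Only applied to open sets S, where it is the usual notion of a map of class \<open>C\<^sup>k\<close>.\<close>

primrec Ck_on :: "nat \<Rightarrow> 'a::real_normed_vector set \<Rightarrow> ('a \<Rightarrow> 'b::real_normed_vector) \<Rightarrow> bool" where
  "Ck_on 0 S f \<longleftrightarrow> continuous_on S f"
| "Ck_on (Suc k) S f \<longleftrightarrow>
     (\<forall>x\<in>S. f differentiable (at x)) \<and> (\<forall>v. Ck_on k S (\<lambda>x. frechet_derivative f (at x) v))"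

definition smooth_on :: "'a::real_normed_vector set \<Rightarrow> ('a \<Rightarrow> 'b::real_normed_vector) \<Rightarrow> bool" where
  "smooth_on S f \<longleftrightarrow> (\<forall>k. Ck_on k S f)"


section \<open>Smooth manifolds\<close>

text \<open>
  A manifold is given by a smooth atlas: a set of charts, each a pair of a domain and a map into a
  Euclidean model space.  The underlying set of the manifold is the union of the chart domains, and
  its topology is the one induced by the charts.  Chart maps are total functions whose values
  outside the domain are irrelevant.
\<close>

type_synonym ('m, 'e) chart = "'m set \<times> ('m \<Rightarrow> 'e)"

abbreviation cdom :: "('m, 'e) chart \<Rightarrow> 'm set" where "cdom \<equiv> fst"
abbreviation cmap :: "('m, 'e) chart \<Rightarrow> 'm \<Rightarrow> 'e" where "cmap \<equiv> snd"

definition cinv :: "('m, 'e) chart \<Rightarrow> 'e \<Rightarrow> 'm" where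
  "cinv c = inv_into (cdom c) (cmap c)"

definition points :: "('m, 'e) chart set \<Rightarrow> 'm set" where
  "points A = (\<Union>c\<in>A. cdom c)"

definition charts_at :: "('m, 'e) chart set \<Rightarrow> 'm \<Rightarrow> ('m, 'e) chart set" where
  "charts_at A x = {c \<in> A. x \<in> cdom c}"

definition chart_at :: "('m, 'e) chart set \<Rightarrow> 'm \<Rightarrow> ('m, 'e) chart" where
  "chart_at A x = (SOME c. c \<in> charts_at A x)"

definition transition :: "('m, 'e) chart \<Rightarrow> ('m, 'e) chart \<Rightarrow> 'e \<Rightarrow> 'e" where
  "transition c d = cmap d \<circ> cinv c"

definition smooth_atlas :: "('m, 'e::euclidean_space) chart set \<Rightarrow> bool" where
  "smooth_atlas A \<longleftrightarrow>
     (\<forall>c\<in>A. inj_on (cmap c) (cdom c)) \<and>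
     (\<forall>c\<in>A. \<forall>d\<in>A. open (cmap c ` (cdom c \<inter> cdom d)) \<and>
                    smooth_on (cmap c ` (cdom c \<inter> cdom d)) (transition c d))"

definition open_subset :: "('m, 'e::euclidean_space) chart set \<Rightarrow> 'm set \<Rightarrow> bool" where
  "open_subset A U \<longleftrightarrow> U \<subseteq> points A \<and> (\<forall>c\<in>A. open (cmap c ` (U \<inter> cdom c)))"

definition atlas_topology :: "('m, 'e::euclidean_space) chart set \<Rightarrow> 'm topology" where
  "atlas_topology A = topology (open_subset A)"

lemma openin_atlas_topology:
  assumes "smooth_atlas A"
  shows "openin (atlas_topology A) U \<longleftrightarrow> open_subset A U"
proof -
  have "istopology (open_subset A)"
    unfolding istopology_def
  proof (intro conjI allI impI)
    fix S T assume S: "open_subset A S" and T: "open_subset A T"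
    have "cmap c ` (S \<inter> T \<inter> cdom c) = cmap c ` (S \<inter> cdom c) \<inter> cmap c ` (T \<inter> cdom c)"
      if "c \<in> A" for c
      using assms that unfolding smooth_atlas_def inj_on_def by blast
    then show "open_subset A (S \<inter> T)"
      using S T unfolding open_subset_def by auto
  next
    fix K :: "'a set set" assume K: "\<forall>S\<in>K. open_subset A S"
    have "cmap c ` (\<Union>K \<inter> cdom c) = (\<Union>S\<in>K. cmap c ` (S \<inter> cdom c))" for c :: "('a, 'b) chart"
      by blast
    then show "open_subset A (\<Union>K)"
      using K unfolding open_subset_def by (auto intro!: open_UN simp del: image_UN)
  qed
  then show ?thesis
    unfolding atlas_topology_def by (simp add: topology_inverse')
qed

definition smooth_manifold :: "('m, 'e::euclidean_space) chart set \<Rightarrow> bool" where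
  "smooth_manifold A \<longleftrightarrow>
     smooth_atlas A \<and> Hausdorff_space (atlas_topology A) \<and> second_countable (atlas_topology A)"

definition real_chart :: "(real, real) chart" where
  "real_chart = (UNIV, id)"

definition real_atlas :: "(real, real) chart set" where
  "real_atlas = {real_chart}"

definition prod_chart :: "('m, 'e) chart \<Rightarrow> ('n, 'f) chart \<Rightarrow> ('m \<times> 'n, 'e \<times> 'f) chart" where
  "prod_chart c d = (cdom c \<times> cdom d, map_prod (cmap c) (cmap d))"

definition prod_atlas ::
  "('m, 'e) chart set \<Rightarrow> ('n, 'f) chart set \<Rightarrow> ('m \<times> 'n, 'e \<times> 'f) chart set" where
  "prod_atlas A B = {prod_chart c d |c d. c \<in> A \<and> d \<in> B}"

text \<open>
  Smooth maps defined on an open subset U.  Openness of the set of points of U in the domain of c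
  that are sent into the domain of d (for all c, d) expresses continuity.
\<close>

definition smooth_map ::
  "('m, 'e::euclidean_space) chart set \<Rightarrow> 'm set \<Rightarrow> ('n, 'f::euclidean_space) chart set
     \<Rightarrow> ('m \<Rightarrow> 'n) \<Rightarrow> bool" where
  "smooth_map A U B F \<longleftrightarrow> open_subset A U \<and> F ` U \<subseteq> points B \<and>
     (\<forall>c\<in>A. \<forall>d\<in>B. let W = cmap c ` {x \<in> U \<inter> cdom c. F x \<in> cdom d}
                    in open W \<and> smooth_on W (cmap d \<circ> F \<circ> cinv c))"

abbreviation smooth_function ::
  "('m, 'e::euclidean_space) chart set \<Rightarrow> 'm set \<Rightarrow> ('m \<Rightarrow> real) \<Rightarrow> bool" where
  "smooth_function A U f \<equiv> smooth_map A U real_atlas f"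

definition local_diffeomorphism ::
  "('m, 'e::euclidean_space) chart set \<Rightarrow> 'm set \<Rightarrow> ('n, 'f::euclidean_space) chart set
     \<Rightarrow> ('m \<Rightarrow> 'n) \<Rightarrow> bool" where
  "local_diffeomorphism A U B F \<longleftrightarrow> open_subset A U \<and>
     (\<forall>x\<in>U. \<exists>V. x \<in> V \<and> V \<subseteq> U \<and> inj_on F V \<and>
        smooth_map A V B F \<and> smooth_map B (F ` V) A (inv_into V F))"


section \<open>Tangent and cotangent bundles\<close>

text \<open>
  A tangent or cotangent vector at x is represented by the family of its components with respect
  to all charts around x, subject to the transformation law; the family is 0 at all other
  arguments.  The components of a covector are its coefficients: the component w of a covector in a
  chart stands for the functional \<open>u \<mapsto> w \<bullet> u\<close>.
\<close>

type_synonym ('m, 'e) comps = "('m, 'e) chart \<Rightarrow> 'e"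

definition tangent_space :: "('m, 'e::euclidean_space) chart set \<Rightarrow> 'm \<Rightarrow> ('m, 'e) comps set" where
  "tangent_space A x = {v. (\<forall>c. c \<notin> charts_at A x \<longrightarrow> v c = 0) \<and>
     (\<forall>c\<in>charts_at A x. \<forall>d\<in>charts_at A x.
        v d = frechet_derivative (transition c d) (at (cmap c x)) (v c))}"

definition cotangent_space :: "('m, 'e::euclidean_space) chart set \<Rightarrow> 'm \<Rightarrow> ('m, 'e) comps set" where
  "cotangent_space A x = {a. (\<forall>c. c \<notin> charts_at A x \<longrightarrow> a c = 0) \<and>
     (\<forall>c\<in>charts_at A x. \<forall>d\<in>charts_at A x. \<forall>u.
        a c \<bullet> u = a d \<bullet> frechet_derivative (transition c d) (at (cmap c x)) u)}"

text \<open>By the transformation laws the pairing does not depend on the chart chosen around x.\<close>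

definition pairing ::
  "('m, 'e::euclidean_space) chart set \<Rightarrow> 'm \<Rightarrow> ('m, 'e) comps \<Rightarrow> ('m, 'e) comps \<Rightarrow> real" where
  "pairing A x a v = a (chart_at A x) \<bullet> v (chart_at A x)"

definition tangent_chart ::
  "('m, 'e::euclidean_space) chart set \<Rightarrow> ('m, 'e) chart
     \<Rightarrow> ('m \<times> ('m, 'e) comps, 'e \<times> 'e) chart" where
  "tangent_chart A c = ({(x, v). x \<in> cdom c \<and> v \<in> tangent_space A x}, \<lambda>(x, v). (cmap c x, v c))"

definition tangent_atlas ::
  "('m, 'e::euclidean_space) chart set \<Rightarrow> ('m \<times> ('m, 'e) comps, 'e \<times> 'e) chart set" where
  "tangent_atlas A = tangent_chart A ` A"

definition cotangent_chart ::
  "('m, 'e::euclidean_space) chart set \<Rightarrow> ('m, 'e) chart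
     \<Rightarrow> ('m \<times> ('m, 'e) comps, 'e \<times> 'e) chart" where
  "cotangent_chart A c =
     ({(x, a). x \<in> cdom c \<and> a \<in> cotangent_space A x}, \<lambda>(x, a). (cmap c x, a c))"

definition cotangent_atlas ::
  "('m, 'e::euclidean_space) chart set \<Rightarrow> ('m \<times> ('m, 'e) comps, 'e \<times> 'e) chart set" where
  "cotangent_atlas A = cotangent_chart A ` A"

text \<open>By the chain rule the tangent map does not depend on the chart chosen around x.\<close>

definition tangent_map ::
  "('m, 'e::euclidean_space) chart set \<Rightarrow> ('n, 'f::euclidean_space) chart set \<Rightarrow> ('m \<Rightarrow> 'n)
     \<Rightarrow> 'm \<times> ('m, 'e) comps \<Rightarrow> 'n \<times> ('n, 'f) comps" where
  "tangent_map A B F = (\<lambda>(x, v). (F x, \<lambda>d.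
     if d \<in> charts_at B (F x) then
       let c = chart_at A x
       in frechet_derivative (cmap d \<circ> F \<circ> cinv c) (at (cmap c x)) (v c)
     else 0))"

definition differential ::
  "('m, 'e::euclidean_space) chart set \<Rightarrow> ('m \<Rightarrow> real) \<Rightarrow> 'm \<Rightarrow> ('m, 'e) comps" where
  "differential A f x = (\<lambda>c.
     if c \<in> charts_at A x then
       (\<Sum>b\<in>Basis. frechet_derivative (f \<circ> cinv c) (at (cmap c x)) b *\<^sub>R b)
     else 0)"

definition vector_field ::
  "('m, 'e::euclidean_space) chart set \<Rightarrow> ('m \<Rightarrow> 'm \<times> ('m, 'e) comps) \<Rightarrow> bool" where
  "vector_field A X \<longleftrightarrow>
     smooth_map A (points A) (tangent_atlas A) X \<and> (\<forall>x\<in>points A. fst (X x) = x)"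


section \<open>Poisson structures\<close>

text \<open>
  Poisson structures are represented by their bivector fields, as families of bilinear maps on the
  cotangent spaces (0 outside the cotangent space).  Smoothness and the Jacobi identity are not
  demanded separately: the structures used below are determined, as bivector fields, by their
  defining bracket relations, from which both properties follow.
\<close>

type_synonym ('m, 'e) bivector = "'m \<Rightarrow> ('m, 'e) comps \<Rightarrow> ('m, 'e) comps \<Rightarrow> real"

definition bivector_field ::
  "('m, 'e::euclidean_space) chart set \<Rightarrow> ('m, 'e) bivector \<Rightarrow> bool" where
  "bivector_field A P \<longleftrightarrow>
     (\<forall>x a b. x \<notin> points A \<or> a \<notin> cotangent_space A x \<or> b \<notin> cotangent_space A x \<longrightarrow> P x a b = 0) \<and>
     (\<forall>x\<in>points A. \<forall>a\<in>cotangent_space A x. \<forall>b\<in>cotangent_space A x.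
        P x a b = - P x b a \<and>
        (\<forall>b'\<in>cotangent_space A x. P x a (\<lambda>c. b c + b' c) = P x a b + P x a b') \<and>
        (\<forall>r. P x a (\<lambda>c. r *\<^sub>R b c) = r * P x a b))"

definition bracket ::
  "('m, 'e::euclidean_space) chart set \<Rightarrow> ('m, 'e) bivector
     \<Rightarrow> ('m \<Rightarrow> real) \<Rightarrow> ('m \<Rightarrow> real) \<Rightarrow> 'm \<Rightarrow> real" where
  "bracket A P f g x = P x (differential A f x) (differential A g x)"

definition poisson_morphism ::
  "('m, 'e::euclidean_space) chart set \<Rightarrow> ('m, 'e) bivector
     \<Rightarrow> ('n, 'f::euclidean_space) chart set \<Rightarrow> ('n, 'f) bivector \<Rightarrow> ('m \<Rightarrow> 'n) \<Rightarrow> bool" where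
  "poisson_morphism A P B \<Lambda> F \<longleftrightarrow> smooth_map A (points A) B F \<and>
     (\<forall>V f g. smooth_function B V f \<and> smooth_function B V g \<longrightarrow>
        (\<forall>x\<in>points A. F x \<in> V \<longrightarrow>
           bracket A P (f \<circ> F) (g \<circ> F) x = bracket B \<Lambda> f g (F x)))"

text \<open>
  The canonical bracket on the cotangent bundle, in canonical coordinates
  \<open>{f, g} = \<Sum>\<^sub>i (\<partial>f/\<partial>q\<^sup>i \<partial>g/\<partial>p\<^sub>i - \<partial>f/\<partial>p\<^sub>i \<partial>g/\<partial>q\<^sup>i)\<close>;
  it does not depend on the chart chosen around the base point, since changes of canonical
  coordinates are symplectic.
\<close>

definition canonical_poisson ::
  "('m, 'e::euclidean_space) chart set \<Rightarrow> ('m \<times> ('m, 'e) comps, 'e \<times> 'e) bivector" where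
  "canonical_poisson A x a b =
     (let c = cotangent_chart A (chart_at A (fst x))
      in fst (a c) \<bullet> snd (b c) - snd (a c) \<bullet> fst (b c))"

definition vertical_lift :: "('m \<Rightarrow> real) \<Rightarrow> 'm \<times> ('m, 'e) comps \<Rightarrow> real" where
  "vertical_lift f = f \<circ> fst"

definition complete_lift ::
  "('m, 'e::euclidean_space) chart set \<Rightarrow> ('m \<Rightarrow> real) \<Rightarrow> 'm \<times> ('m, 'e) comps \<Rightarrow> real" where
  "complete_lift A f = (\<lambda>(x, v). pairing A x (differential A f x) v)"

text \<open>
  The tangent Poisson structure.  The bracket relations determine a bivector field uniquely, because
  the differentials of complete and vertical lifts of locally defined functions span every
  cotangent space of the tangent bundle.
\<close>

definition tangent_poisson ::
  "('m, 'e::euclidean_space) chart set \<Rightarrow> ('m, 'e) bivector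
     \<Rightarrow> ('m \<times> ('m, 'e) comps, 'e \<times> 'e) bivector" where
  "tangent_poisson A P = (THE \<Lambda>. bivector_field (tangent_atlas A) \<Lambda> \<and>
     (\<forall>V f g. smooth_function A V f \<and> smooth_function A V g \<longrightarrow>
        (\<forall>w\<in>points (tangent_atlas A). fst w \<in> V \<longrightarrow>
           bracket (tangent_atlas A) \<Lambda> (complete_lift A f) (complete_lift A g) w
             = complete_lift A (bracket A P f g) w \<and>
           bracket (tangent_atlas A) \<Lambda> (complete_lift A f) (vertical_lift g) w
             = vertical_lift (bracket A P f g) w \<and>
           bracket (tangent_atlas A) \<Lambda> (vertical_lift f) (vertical_lift g) w = 0)))"


section \<open>Lagrangian submanifolds of Poisson manifolds\<close>

text \<open>The vector \<open>\<sharp>a\<close> is characterised by \<open>\<langle>b, \<sharp>a\<rangle> = P(a, b)\<close>; the opposite sign convention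
  gives the same images of subspaces.\<close>

definition sharp ::
  "('m, 'e::euclidean_space) chart set \<Rightarrow> ('m, 'e) bivector \<Rightarrow> 'm
     \<Rightarrow> ('m, 'e) comps \<Rightarrow> ('m, 'e) comps" where
  "sharp A P x a =
     (THE v. v \<in> tangent_space A x \<and> (\<forall>b\<in>cotangent_space A x. pairing A x b v = P x a b))"

definition characteristic_distribution ::
  "('m, 'e::euclidean_space) chart set \<Rightarrow> ('m, 'e) bivector \<Rightarrow> 'm \<Rightarrow> ('m, 'e) comps set" where
  "characteristic_distribution A P x = sharp A P x ` cotangent_space A x"

text \<open>Embedded submanifolds, by adapted (slice) charts of the smooth structure of A.\<close>

definition submanifold :: "('m, 'e::euclidean_space) chart set \<Rightarrow> 'm set \<Rightarrow> bool" where
  "submanifold A N \<longleftrightarrow> N \<subseteq> points A \<and>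
     (\<exists>k. \<forall>x\<in>N. \<exists>c S. x \<in> cdom c \<and> cdom c \<subseteq> points A \<and> smooth_atlas (insert c A) \<and>
        subspace S \<and> dim S = k \<and> cmap c ` (N \<inter> cdom c) = cmap c ` cdom c \<inter> S)"

definition velocity ::
  "('m, 'e::euclidean_space) chart set \<Rightarrow> (real \<Rightarrow> 'm) \<Rightarrow> real \<Rightarrow> ('m, 'e) comps" where
  "velocity A \<gamma> s = (\<lambda>c.
     if c \<in> charts_at A (\<gamma> s) then vector_derivative (cmap c \<circ> \<gamma>) (at s) else 0)"

definition submanifold_tangent_space ::
  "('m, 'e::euclidean_space) chart set \<Rightarrow> 'm set \<Rightarrow> 'm \<Rightarrow> ('m, 'e) comps set" where
  "submanifold_tangent_space A N x =
     {velocity A \<gamma> 0 |\<gamma>. \<gamma> 0 = x \<and>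
        (\<exists>\<epsilon>>0. smooth_map real_atlas {-\<epsilon><..<\<epsilon>} A \<gamma> \<and> \<gamma> ` {-\<epsilon><..<\<epsilon>} \<subseteq> N)}"

definition annihilator ::
  "('m, 'e::euclidean_space) chart set \<Rightarrow> 'm \<Rightarrow> ('m, 'e) comps set \<Rightarrow> ('m, 'e) comps set" where
  "annihilator A x S = {a \<in> cotangent_space A x. \<forall>v\<in>S. pairing A x a v = 0}"

definition lagrangian_submanifold ::
  "('m, 'e::euclidean_space) chart set \<Rightarrow> ('m, 'e) bivector \<Rightarrow> 'm set \<Rightarrow> bool" where
  "lagrangian_submanifold A P N \<longleftrightarrow> submanifold A N \<and>
     (\<forall>x\<in>N. sharp A P x ` annihilator A x (submanifold_tangent_space A N x)
            = submanifold_tangent_space A N x \<inter> characteristic_distribution A P x)"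


section \<open>The manifolds $\mathbb{R}\times TQ$ and $\mathbb{R}\times T^*Q$\<close>

type_synonym ('q, 'e) phase = "real \<times> ('q \<times> ('q, 'e) comps)"

definition R_TQ ::
  "('q, 'e::euclidean_space) chart set \<Rightarrow> (('q, 'e) phase, real \<times> ('e \<times> 'e)) chart set" where
  "R_TQ A = prod_atlas real_atlas (tangent_atlas A)"

definition R_TstarQ ::
  "('q, 'e::euclidean_space) chart set \<Rightarrow> (('q, 'e) phase, real \<times> ('e \<times> 'e)) chart set" where
  "R_TstarQ A = prod_atlas real_atlas (cotangent_atlas A)"

text \<open>
  The projection from the cotangent bundle of \<open>\<real> \<times> Q\<close> onto \<open>\<real> \<times> T\<^sup>*Q\<close>
  that drops the component in the direction of dt.
\<close>

definition cotangent_proj ::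
  "(real \<times> 'q) \<times> (real \<times> 'q, real \<times> 'e) comps \<Rightarrow> ('q, 'e) phase" where
  "cotangent_proj = (\<lambda>((t, q), \<alpha>). (t, (q, \<lambda>c. snd (\<alpha> (prod_chart real_chart c)))))"

definition R_TstarQ_poisson ::
  "('q, 'e::euclidean_space) chart set \<Rightarrow> (('q, 'e) phase, real \<times> ('e \<times> 'e)) bivector" where
  "R_TstarQ_poisson A = (THE \<Lambda>. bivector_field (R_TstarQ A) \<Lambda> \<and>
     poisson_morphism
       (cotangent_atlas (prod_atlas real_atlas A)) (canonical_poisson (prod_atlas real_atlas A))
       (R_TstarQ A) \<Lambda> cotangent_proj)"

definition over_RQ :: "('q, 'e) phase set \<Rightarrow> (('q, 'e) phase \<Rightarrow> ('q, 'e) phase) \<Rightarrow> bool" where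
  "over_RQ U F \<longleftrightarrow> (\<forall>x\<in>U. fst (F x) = fst x \<and> fst (snd (F x)) = fst (snd x))"


section \<open>Variational SODEs\<close>

definition natural_chart ::
  "('q, 'e::euclidean_space) chart set \<Rightarrow> ('q, 'e) chart
     \<Rightarrow> (('q, 'e) phase, real \<times> ('e \<times> 'e)) chart" where
  "natural_chart A c = prod_chart real_chart (tangent_chart A c)"

text \<open>
  In natural coordinates a tangent vector of \<open>\<real> \<times> TQ\<close> has components
  \<open>(dt, (dq, dqdot))\<close>.
\<close>

definition sode ::
  "('q, 'e::euclidean_space) chart set
     \<Rightarrow> (('q, 'e) phase \<Rightarrow> ('q, 'e) phase \<times> (('q, 'e) phase, real \<times> ('e \<times> 'e)) comps) \<Rightarrow> bool" where
  "sode A \<Gamma> \<longleftrightarrow> vector_field (R_TQ A) \<Gamma> \<and>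
     (\<forall>c\<in>A. \<forall>x\<in>cdom (natural_chart A c).
        let (t, (q, qdot)) = cmap (natural_chart A c) x;
            (dt, (dq, dqdot)) = snd (\<Gamma> x) (natural_chart A c)
        in dq - dt *\<^sub>R qdot = 0 \<and> dt = 1)"

text \<open>Functions of the coordinates \<open>(t, (q, qdot))\<close>.\<close>

definition d_dq ::
  "'n::finite \<Rightarrow> (real \<times> ((real^'n) \<times> (real^'n)) \<Rightarrow> real) \<Rightarrow> real \<times> ((real^'n) \<times> (real^'n)) \<Rightarrow> real"
  where "d_dq i f y = frechet_derivative f (at y) (0, (axis i 1, 0))"

definition d_dqdot ::
  "'n::finite \<Rightarrow> (real \<times> ((real^'n) \<times> (real^'n)) \<Rightarrow> real) \<Rightarrow> real \<times> ((real^'n) \<times> (real^'n)) \<Rightarrow> real"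
  where "d_dqdot i f y = frechet_derivative f (at y) (0, (0, axis i 1))"

text \<open>
  The total time derivative
  \<open>\<partial>f/\<partial>t + qdot\<^sup>j \<partial>f/\<partial>q\<^sup>j + qddot\<^sup>j \<partial>f/\<partial>qdot\<^sup>j\<close>,
  where the acceleration qddot is an independent variable.
\<close>

definition total_derivative ::
  "(real \<times> ((real^'n::finite) \<times> (real^'n)) \<Rightarrow> real) \<Rightarrow> real \<times> ((real^'n) \<times> (real^'n))
     \<Rightarrow> real^'n \<Rightarrow> real" where
  "total_derivative f y qddot = frechet_derivative f (at y) (1, (snd (snd y), qddot))"

definition velocity_hessian ::
  "(real \<times> ((real^'n::finite) \<times> (real^'n)) \<Rightarrow> real) \<Rightarrow> real \<times> ((real^'n) \<times> (real^'n))
     \<Rightarrow> real^'n^'n" where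
  "velocity_hessian f y = (\<chi> i j. d_dqdot i (d_dqdot j f) y)"

text \<open>
  The Lagrangian L is a smooth function on the open set U; regularity and the multiplier equations
  are required in all natural coordinates.
\<close>

definition variational ::
  "('q, real^'n::finite) chart set
     \<Rightarrow> (('q, real^'n) phase
          \<Rightarrow> ('q, real^'n) phase \<times> (('q, real^'n) phase, real \<times> ((real^'n) \<times> (real^'n))) comps)
     \<Rightarrow> bool" where
  "variational A \<Gamma> \<longleftrightarrow>
     (\<forall>x0\<in>points (R_TQ A). \<exists>U L. x0 \<in> U \<and> smooth_function (R_TQ A) U L \<and>
        (\<forall>c\<in>A. \<forall>x\<in>U \<inter> cdom (natural_chart A c).
           let Lc = L \<circ> cinv (natural_chart A c);
               y = cmap (natural_chart A c) x;
               G = snd (snd (snd (\<Gamma> x) (natural_chart A c)));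
               H = velocity_hessian Lc y
           in invertible H \<and>
              (\<forall>qddot i. (\<Sum>j\<in>UNIV. H $ i $ j * (qddot $ j - G $ j))
                 = total_derivative (d_dqdot i Lc) y qddot - d_dq i Lc y)))"

end

theory Submission
  imports Defs
begin

text \<open>
  In natural coordinates the image of \<open>\<gamma>\<close> is the graph
  \<open>p = F\<close>, \<open>v\<^sub>t = 1\<close>, \<open>pdot = \<Gamma>(F)\<close> over \<open>(t, q, qdot)\<close>.
  The symplectic leaves of the tangent Poisson structure are the level sets of \<open>(t, v\<^sub>t)\<close>, with the
  form \<open>dq \<and> dpdot + dqdot \<and> dp\<close>, so the graph is Lagrangian if and only if, at fixed
  time, the one-form \<open>\<theta> = \<Gamma>(F\<^sub>i) dq\<^sup>i + F\<^sub>i dqdot\<^sup>i\<close> is closed in the variables \<open>(q, qdot)\<close>.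

  If L is a Lagrangian for \<open>\<Gamma>\<close>, then its Legendre map \<open>F = \<partial>L/\<partial>qdot\<close> is a local
  diffeomorphism and the Euler--Lagrange equations say that \<open>\<Gamma>(F) = \<partial>L/\<partial>q\<close>, so that
  \<open>\<theta>\<close> is the differential of L at fixed time.  Conversely, a primitive L of a closed
  \<open>\<theta>\<close>, given by the Poincare lemma with t as a parameter, satisfies the Euler--Lagrange equations
  in every natural chart, because \<open>\<theta>\<close> does not depend on the chart.
\<close>

section \<open>Calculus of smooth maps\<close>

text \<open>Both Poisson structures are definite descriptions, so nothing can be computed before
  existence and uniqueness are known. Each turns out to be one constant bilinear form in all charts
  of its bundle (\<open>represented_by\<close>); the obstacle is the second derivatives of the
  transition maps, which cancel by symmetry. The Lagrangian condition then becomes linear algebra in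
  a single chart at each point. There time drops out: vectors in the characteristic distribution
  have no t and v_t components, and the dt component of a covector, which \<open>sharp\<close>
  ignores, can always be adjusted so that the covector annihilates the time direction of the graph.
  A primitive of \<theta> is fixed only up to a function of t, which changes neither the Hessian nor
  the Euler-Lagrange equations. The form \<theta> is chart independent because it is the Lie
  derivative of \<open>F_i dq^i\<close> along \<Gamma>. Regularity of L comes from F: over R x Q its
  derivative is injective only if its derivative along the fibres is, and closedness of \<theta>
  makes the latter symmetric, hence equal to the velocity Hessian.\<close>

abbreviation fderiv :: "('a::real_normed_vector \<Rightarrow> 'b::real_normed_vector) \<Rightarrow> 'a \<Rightarrow> 'a \<Rightarrow> 'b"
  where "fderiv f x \<equiv> frechet_derivative f (at x)"

section \<open>Derivatives and the classes C^k\<close>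

lemma fderiv_eqI: "(f has_derivative f') (at x) \<Longrightarrow> fderiv f x = f'"
  by (metis frechet_derivative_at)

text \<open>A derivative at a point depends only on the germ of the function. Formulas that are
  valid only inside a chart domain are differentiated through this equivalence.\<close>

lemma has_derivative_cong_open:
  assumes "open S" "x \<in> S" "\<And>y. y \<in> S \<Longrightarrow> f y = g y"
  shows "(f has_derivative h) (at x) \<longleftrightarrow> (g has_derivative h) (at x)"
  using assms has_derivative_transform_within_open[of f h x UNIV S g]
    has_derivative_transform_within_open[of g h x UNIV S f] by auto

lemma fderiv_cong:
  assumes "open S" "x \<in> S" "\<And>y. y \<in> S \<Longrightarrow> f y = g y"
  shows "fderiv f x = fderiv g x"
  using has_derivative_cong_open[OF assms] unfolding frechet_derivative_def by presburger

lemma differentiable_cong_open: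
  assumes "open S" "x \<in> S" "\<And>y. y \<in> S \<Longrightarrow> f y = g y"
  shows "f differentiable (at x) \<longleftrightarrow> g differentiable (at x)"
  using has_derivative_cong_open[OF assms] unfolding differentiable_def by presburger

lemma Ck_on_cong:
  assumes "open S" "\<And>y. y \<in> S \<Longrightarrow> f y = g y"
  shows "Ck_on k S f \<longleftrightarrow> Ck_on k S g"
  using assms
proof (induction k arbitrary: f g)
  case 0 then show ?case by (auto cong: continuous_on_cong)
next
  case (Suc k)
  have "Ck_on k S (\<lambda>x. fderiv f x v) \<longleftrightarrow> Ck_on k S (\<lambda>x. fderiv g x v)" for v
    using Suc.prems by (intro Suc.IH) (auto simp: fderiv_cong[of S _ f g])
  then show ?case using Suc.prems differentiable_cong_open[of S _ f g] by auto
qed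

lemma Ck_on_subset: "Ck_on k S f \<Longrightarrow> T \<subseteq> S \<Longrightarrow> Ck_on k T f"
  by (induction k arbitrary: f) (auto intro: continuous_on_subset)

text \<open>Continuity and differentiability at a point only see a neighbourhood, and the
  neighbourhoods \<open>T\<close> are open, so continuity on \<open>T\<close> is continuity at each
  of its points.\<close>

lemma Ck_on_local:
  assumes "\<And>x. x \<in> S \<Longrightarrow> \<exists>T. open T \<and> x \<in> T \<and> Ck_on k T f"
  shows "Ck_on k S f"
  using assms
proof (induction k arbitrary: f)
  case 0
  then show ?case unfolding Ck_on.simps
    by (meson continuous_at_imp_continuous_on continuous_on_eq_continuous_at)
next
  case (Suc k)
  have "Ck_on k S (\<lambda>x. fderiv f x v)" for v
    using Suc.prems by (intro Suc.IH) (auto, blast)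
  then show ?case using Suc.prems by auto
qed

text \<open>Needed for the product and chain rules: at order \<open>Suc k\<close> their derivatives
  contain the undifferentiated maps, which then have to be of order \<open>k\<close>.\<close>

lemma Ck_on_Suc_imp: "open S \<Longrightarrow> Ck_on (Suc k) S f \<Longrightarrow> Ck_on k S f"
proof (induction k arbitrary: f)
  case 0
  then show ?case
    by (auto intro!: differentiable_imp_continuous_on differentiable_at_imp_differentiable_on)
next
  case (Suc k)
  have "Ck_on k S (\<lambda>x. fderiv f x v)" for v
    using Suc.prems by (intro Suc.IH) auto
  then show ?case using Suc.prems by auto
qed

lemma Ck_on_const [simp]: "Ck_on k S (\<lambda>x. c)"
  by (induction k arbitrary: c) auto

text \<open>Lets an explicit formula \<open>f'\<close> stand in for
  \<open>frechet_derivative\<close>, with which it agrees only on \<open>S\<close>. The inductions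
  on \<open>k\<close> below go through this rule.\<close>

lemma Ck_on_SucI:
  assumes "open S" "\<And>x. x \<in> S \<Longrightarrow> (f has_derivative f' x) (at x)"
    "\<And>v. Ck_on k S (\<lambda>x. f' x v)"
  shows "Ck_on (Suc k) S f"
proof -
  have "Ck_on k S (\<lambda>x. fderiv f x v)" for v
    by (subst Ck_on_cong[OF assms(1), of _ "\<lambda>x. f' x v"]) (use assms in \<open>auto simp: fderiv_eqI[OF assms(2)]\<close>)
  then show ?thesis using assms by (auto simp: differentiable_def)
qed

lemma has_derivative_fderiv:
  "f differentiable (at x) \<Longrightarrow> (f has_derivative fderiv f x) (at x)"
  by (rule iffD1[OF frechet_derivative_works])

lemma Ck_on_linear:
  assumes "open S" "bounded_linear h" "Ck_on k S f"
  shows "Ck_on k S (\<lambda>x. h (f x))"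
  using assms(3)
proof (induction k arbitrary: f)
  case 0 then show ?case using assms by (auto intro: bounded_linear.continuous_on)
next
  case (Suc k)
  show ?case
  proof (rule Ck_on_SucI)
    fix x assume "x \<in> S"
    then show "((\<lambda>x. h (f x)) has_derivative (\<lambda>v. h (fderiv f x v))) (at x)"
      using Suc.prems by (auto intro!: bounded_linear.has_derivative[OF assms(2)] has_derivative_fderiv)
  qed (use Suc assms in auto)
qed

lemma Ck_on_add:
  assumes "open S" "Ck_on k S f" "Ck_on k S g"
  shows "Ck_on k S (\<lambda>x. f x + g x)"
  using assms(2,3)
proof (induction k arbitrary: f g)
  case 0 then show ?case using assms by (auto intro: continuous_intros)
next
  case (Suc k)
  show ?case
  proof (rule Ck_on_SucI)
    fix x assume "x \<in> S"
    then show "((\<lambda>x. f x + g x) has_derivative (\<lambda>v. fderiv f x v + fderiv g x v)) (at x)"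
      using Suc.prems by (auto intro!: has_derivative_add has_derivative_fderiv)
  qed (use Suc assms in auto)
qed

lemma Ck_on_bilinear:
  assumes "open S" "bounded_bilinear B" "Ck_on k S f" "Ck_on k S g"
  shows "Ck_on k S (\<lambda>x. B (f x) (g x))"
  using assms(3,4)
proof (induction k arbitrary: f g)
  case 0 then show ?case using assms by (auto intro: bounded_bilinear.continuous_on)
next
  case (Suc k)
  show ?case
  proof (rule Ck_on_SucI)
    fix x assume "x \<in> S"
    then show "((\<lambda>x. B (f x) (g x)) has_derivative (\<lambda>v. B (f x) (fderiv g x v) + B (fderiv f x v) (g x))) (at x)"
      using Suc.prems by (auto intro!: bounded_bilinear.FDERIV[OF assms(2)] has_derivative_fderiv)
  next
    show "Ck_on k S (\<lambda>x. B (f x) (fderiv g x v) + B (fderiv f x v) (g x))" for v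
      using Suc.prems Ck_on_Suc_imp[OF assms(1), of k f] Ck_on_Suc_imp[OF assms(1), of k g]
      by (intro Ck_on_add Suc.IH assms) (auto simp del: )
  qed (use assms in auto)
qed

lemma Ck_on_sum:
  assumes "open S" "\<And>i. i \<in> I \<Longrightarrow> Ck_on k S (f i)"
  shows "Ck_on k S (\<lambda>x. \<Sum>i\<in>I. f i x)"
  using assms(2)
  by (induction I rule: infinite_finite_induct) (auto intro!: Ck_on_add assms(1))

lemma linear_fderiv: "f differentiable (at x) \<Longrightarrow> linear (fderiv f x)"
  using bounded_linear.linear has_derivative_bounded_linear has_derivative_fderiv by blast

lemma linear_sum_Basis: 
  fixes f :: "'a::euclidean_space \<Rightarrow> 'b::real_vector"
  assumes "linear f" shows "f x = (\<Sum>b\<in>Basis. (x \<bullet> b) *\<^sub>R f b)"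
proof -
  have "f x = f (\<Sum>b\<in>Basis. (x \<bullet> b) *\<^sub>R b)" by (simp add: euclidean_representation)
  then show ?thesis using assms by (simp add: linear_sum linear_scale)
qed

text \<open>By the chain rule the derivative of \<open>g\<close> is evaluated in the direction
  \<open>fderiv f x v\<close>, which moves with \<open>x\<close>, whereas \<open>Ck_on\<close>
  speaks of fixed directions only. Expanding the direction in a basis of the middle space reduces to
  fixed ones; this is why that space is Euclidean.\<close>

lemma Ck_on_compose:
  fixes f :: "'a::real_normed_vector \<Rightarrow> 'b::euclidean_space" and g :: "'b \<Rightarrow> 'c::real_normed_vector"
  assumes "open S" "open T" "f ` S \<subseteq> T" "Ck_on k S f" "Ck_on k T g"
  shows "Ck_on k S (\<lambda>x. g (f x))"
  using assms(4,5)
proof (induction k arbitrary: g)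
  case 0 then show ?case using assms by (auto intro: continuous_on_compose2)
next
  case (Suc k)
  have f: "Ck_on k S f" using Suc.prems Ck_on_Suc_imp[OF assms(1)] by blast
  show ?case
  proof (rule Ck_on_SucI)
    fix x assume x: "x \<in> S"
    have "((\<lambda>x. g (f x)) has_derivative (\<lambda>v. fderiv g (f x) (fderiv f x v))) (at x)"
      using x Suc.prems assms(3) has_derivative_compose[of f "fderiv f x" x UNIV g "fderiv g (f x)"]
      by (auto intro!: has_derivative_fderiv)
    moreover have "fderiv g (f x) (fderiv f x v) = (\<Sum>b\<in>Basis. (fderiv f x v \<bullet> b) *\<^sub>R fderiv g (f x) b)" for v
      using x Suc.prems assms(3) by (intro linear_sum_Basis linear_fderiv) auto
    ultimately show "((\<lambda>x. g (f x)) has_derivative (\<lambda>v. \<Sum>b\<in>Basis. (fderiv f x v \<bullet> b) *\<^sub>R fderiv g (f x) b)) (at x)"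
      by simp
  next
    fix v
    have "Ck_on k S (\<lambda>x. fderiv f x v \<bullet> b)" for b
      using Suc.prems by (intro Ck_on_linear[OF assms(1), of "\<lambda>x. x \<bullet> b"] bounded_linear_inner_left) auto
    moreover have "Ck_on k S (\<lambda>x. fderiv g (f x) b)" for b
      using Suc.prems f by (intro Suc.IH) auto
    ultimately show "Ck_on k S (\<lambda>x. \<Sum>b\<in>Basis. (fderiv f x v \<bullet> b) *\<^sub>R fderiv g (f x) b)"
      by (intro Ck_on_sum assms Ck_on_bilinear[OF _ bounded_bilinear_scaleR]) auto
  qed (use assms in auto)
qed

text \<open>The derivative of 1/f is a polynomial in 1/f and the derivative of f, so the order rises
  by one at each step of the induction.\<close>

lemma Ck_on_inverse:
  fixes f :: "'a::real_normed_vector \<Rightarrow> real"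
  assumes "open S" "\<And>x. x \<in> S \<Longrightarrow> f x \<noteq> 0" "Ck_on k S f"
  shows "Ck_on k S (\<lambda>x. inverse (f x))"
  using assms(3)
proof (induction k)
  case 0 then show ?case using assms by (auto intro: continuous_on_inverse)
next
  case (Suc k)
  have i: "Ck_on k S (\<lambda>x. inverse (f x))" using Suc Ck_on_Suc_imp[OF assms(1)] by blast
  show ?case
  proof (rule Ck_on_SucI)
    fix x assume "x \<in> S"
    then show "((\<lambda>x. inverse (f x)) has_derivative (\<lambda>v. - (inverse (f x) * fderiv f x v * inverse (f x)))) (at x)"
      using Suc.prems assms by (auto intro!: derivative_intros has_derivative_fderiv)
  next
    show "Ck_on k S (\<lambda>x. - (inverse (f x) * fderiv f x v * inverse (f x)))" for v
      using Suc.prems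
      by (intro Ck_on_linear[OF assms(1) bounded_linear_minus[OF bounded_linear_ident]]
          Ck_on_bilinear[OF assms(1) bounded_bilinear_mult] i) auto
  qed (use assms in auto)
qed

section \<open>Closure properties of smooth maps\<close>

lemma smooth_on_cong:
  assumes "open S" "\<And>y. y \<in> S \<Longrightarrow> f y = g y"
  shows "smooth_on S f \<longleftrightarrow> smooth_on S g"
  using Ck_on_cong[OF assms] unfolding smooth_on_def by auto

lemma smooth_on_subset: "smooth_on S f \<Longrightarrow> T \<subseteq> S \<Longrightarrow> smooth_on T f"
  using Ck_on_subset unfolding smooth_on_def by blast

lemma smooth_on_local:
  assumes "\<And>x. x \<in> S \<Longrightarrow> \<exists>T. open T \<and> x \<in> T \<and> smooth_on T f"
  shows "smooth_on S f"
  using assms unfolding smooth_on_def by (meson Ck_on_local)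

lemma smooth_on_Suc: "smooth_on S f \<Longrightarrow> Ck_on (Suc k) S f"
  unfolding smooth_on_def by (rule spec)

lemma smooth_on_differentiable: "smooth_on S f \<Longrightarrow> x \<in> S \<Longrightarrow> f differentiable (at x)"
  by (drule smooth_on_Suc[of S f 0]) simp

lemma smooth_on_has_derivative:
  "smooth_on S f \<Longrightarrow> x \<in> S \<Longrightarrow> (f has_derivative fderiv f x) (at x)"
  by (rule has_derivative_fderiv[OF smooth_on_differentiable])

lemma smooth_on_linear_fderiv: "smooth_on S f \<Longrightarrow> x \<in> S \<Longrightarrow> linear (fderiv f x)"
  by (rule linear_fderiv[OF smooth_on_differentiable])

lemma smooth_on_fderiv: "smooth_on S f \<Longrightarrow> smooth_on S (\<lambda>x. fderiv f x v)"
  using smooth_on_Suc[of S f] by (simp add: smooth_on_def[of S "\<lambda>x. fderiv f x v"])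

lemma smooth_on_continuous_on: "smooth_on S f \<Longrightarrow> continuous_on S f"
  unfolding smooth_on_def by (metis Ck_on.simps(1))

lemma smooth_on_const [simp, intro]: "smooth_on S (\<lambda>x. c)"
  unfolding smooth_on_def by simp

lemma smooth_on_linear:
  assumes "open S" "bounded_linear h" "smooth_on S f"
  shows "smooth_on S (\<lambda>x. h (f x))"
  using Ck_on_linear[OF assms(1,2)] assms(3) unfolding smooth_on_def by metis

lemma smooth_on_inverse:
  fixes f :: "'a::real_normed_vector \<Rightarrow> real"
  assumes "open S" "\<And>x. x \<in> S \<Longrightarrow> f x \<noteq> 0" "smooth_on S f"
  shows "smooth_on S (\<lambda>x. inverse (f x))"
  unfolding smooth_on_def
proof
  fix k show "Ck_on k S (\<lambda>x. inverse (f x))"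
    by (rule Ck_on_inverse[OF assms(1,2)]) (use assms(3) in \<open>auto simp: smooth_on_def\<close>)
qed

lemma smooth_on_bounded_linear: "bounded_linear f \<Longrightarrow> smooth_on S f"
proof -
  assume f: "bounded_linear f"
  have "Ck_on k UNIV f" for k
  proof (cases k)
    case 0 then show ?thesis using f by (simp add: linear_continuous_on)
  next
    case (Suc n)
    show ?thesis unfolding Suc using f
      by (intro Ck_on_SucI[of UNIV f "\<lambda>_. f"]) (auto simp: bounded_linear_imp_has_derivative)
  qed
  then show ?thesis unfolding smooth_on_def using Ck_on_subset by blast
qed

lemma smooth_on_ident [simp, intro]: "smooth_on S (\<lambda>x. x)" "smooth_on S id"
  by (auto intro!: smooth_on_bounded_linear bounded_linear_ident simp: id_def)

lemma smooth_on_add: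
  assumes "open S" "smooth_on S f" "smooth_on S g"
  shows "smooth_on S (\<lambda>x. f x + g x)"
  using Ck_on_add[OF assms(1)] assms(2,3) unfolding smooth_on_def by metis

lemma smooth_on_bilinear:
  assumes "open S" "bounded_bilinear B" "smooth_on S f" "smooth_on S g"
  shows "smooth_on S (\<lambda>x. B (f x) (g x))"
  using Ck_on_bilinear[OF assms(1,2)] assms(3,4) unfolding smooth_on_def by metis

lemma smooth_on_sum:
  assumes "open S" "\<And>i. i \<in> I \<Longrightarrow> smooth_on S (f i)"
  shows "smooth_on S (\<lambda>x. \<Sum>i\<in>I. f i x)"
  using Ck_on_sum[OF assms(1), of I _ f] assms(2) unfolding smooth_on_def by blast

lemma smooth_on_compose:
  fixes f :: "'a::real_normed_vector \<Rightarrow> 'b::euclidean_space" and g :: "'b \<Rightarrow> 'c::real_normed_vector"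
  shows "open S \<Longrightarrow> open T \<Longrightarrow> f ` S \<subseteq> T \<Longrightarrow> smooth_on S f \<Longrightarrow> smooth_on T g \<Longrightarrow> smooth_on S (\<lambda>x. g (f x))"
  unfolding smooth_on_def by (blast intro: Ck_on_compose)

lemmas smooth_on_scaleR = smooth_on_bilinear[OF _ bounded_bilinear_scaleR]
lemmas smooth_on_mult = smooth_on_bilinear[OF _ bounded_bilinear_mult]
lemmas smooth_on_inner = smooth_on_bilinear[OF _ bounded_bilinear_inner]
lemmas smooth_on_snd = smooth_on_linear[OF _ bounded_linear_snd]
lemmas smooth_on_minus = smooth_on_linear[OF _ bounded_linear_minus[OF bounded_linear_ident]]

lemma smooth_on_diff:
  assumes "open S" "smooth_on S f" "smooth_on S g"
  shows "smooth_on S (\<lambda>x. f x - g x)"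
  using smooth_on_add[OF assms(1,2) smooth_on_minus[OF assms(1,3)]] by simp

lemma smooth_on_Pair:
  assumes "open S" "smooth_on S f" "smooth_on S g"
  shows "smooth_on S (\<lambda>x. (f x, g x))"
proof -
  have "smooth_on S (\<lambda>x. (f x, 0) + (0, g x))"
    using assms by (intro smooth_on_add smooth_on_linear[of S "\<lambda>x. (x, 0)"] smooth_on_linear[of S "\<lambda>x. (0, x)"]
        bounded_linear_Pair bounded_linear_ident bounded_linear_zero)
  then show ?thesis by simp
qed

lemma smooth_on_prod:
  fixes f :: "'i \<Rightarrow> 'a::real_normed_vector \<Rightarrow> real"
  assumes "open S" "\<And>i. i \<in> I \<Longrightarrow> smooth_on S (f i)"
  shows "smooth_on S (\<lambda>x. \<Prod>i\<in>I. f i x)"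
  using assms(2)
  by (induction I rule: infinite_finite_induct) (auto intro!: smooth_on_mult assms(1))

lemma smooth_on_vec:
  fixes f :: "'a::real_normed_vector \<Rightarrow> real^'n"
  assumes "open S" "\<And>i. smooth_on S (\<lambda>x. f x $ i)"
  shows "smooth_on S f"
proof -
  have "smooth_on S (\<lambda>x. \<Sum>i\<in>UNIV. (f x $ i) *\<^sub>R axis i 1)"
    using assms by (intro smooth_on_sum smooth_on_scaleR smooth_on_const)
  moreover have "(\<lambda>x. \<Sum>i\<in>UNIV. (f x $ i) *\<^sub>R axis i 1) = f"
    using basis_expansion by (force simp: scalar_mult_eq_scaleR[symmetric])
  ultimately show ?thesis by (rule back_subst[of "smooth_on S"])
qed

lemmas smooth_on_vec_nth = smooth_on_linear[OF _ bounded_linear_vec_nth]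

text \<open>For Cramer's rule in \<open>fibrewise_inverse\<close>: a determinant is a polynomial in
  the entries.\<close>

lemma smooth_on_det:
  fixes M :: "'a::real_normed_vector \<Rightarrow> real^'n^'n"
  assumes "open S" "\<And>i j. smooth_on S (\<lambda>x. M x $ i $ j)"
  shows "smooth_on S (\<lambda>x. det (M x))"
  unfolding det_def using assms
  by (intro smooth_on_sum smooth_on_mult smooth_on_prod smooth_on_const) auto

text \<open>Base point and direction both move; a basis expansion of the direction separates the
  two. Transition maps of tangent bundles have this shape, the direction being the fibre
  variable.\<close>

lemma smooth_on_fderiv_apply:
  fixes f :: "'a::euclidean_space \<Rightarrow> 'b::real_normed_vector" and g :: "'c::euclidean_space \<Rightarrow> 'a"
  assumes "open S" "open T" "smooth_on T f" "smooth_on S g" "g ` S \<subseteq> T" "smooth_on S h"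
  shows "smooth_on S (\<lambda>x. fderiv f (g x) (h x))"
proof -
  have "smooth_on S (\<lambda>x. \<Sum>b\<in>Basis. (h x \<bullet> b) *\<^sub>R fderiv f (g x) b)"
    using assms by (intro smooth_on_sum smooth_on_scaleR smooth_on_inner smooth_on_const
        smooth_on_compose[of S T g "\<lambda>x. fderiv f x _"] smooth_on_fderiv)
  moreover have "fderiv f (g x) (h x) = (\<Sum>b\<in>Basis. (h x \<bullet> b) *\<^sub>R fderiv f (g x) b)" if "x \<in> S" for x
    using assms that by (intro linear_sum_Basis smooth_on_linear_fderiv) auto
  ultimately show ?thesis by (rule iffD2[OF smooth_on_cong[OF assms(1)], rotated])
qed

section \<open>Symmetry of second derivatives\<close>

lemma fderiv_line:
  assumes "f differentiable (at (x + s *\<^sub>R a))"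
  shows "((\<lambda>s. f (x + s *\<^sub>R a)) has_vector_derivative fderiv f (x + s *\<^sub>R a) a) (at s)"
proof -
  have "((\<lambda>s. f (x + s *\<^sub>R a)) has_derivative (\<lambda>h. fderiv f (x + s *\<^sub>R a) (h *\<^sub>R a))) (at s)"
    by (rule has_derivative_compose[of "\<lambda>s. x + s *\<^sub>R a" "\<lambda>h. h *\<^sub>R a" s UNIV f])
      (auto intro!: derivative_eq_intros has_derivative_fderiv assms)
  then show ?thesis using linear_fderiv[OF assms] by (simp add: has_vector_derivative_def linear_scale)
qed

text \<open>The mean value theorem is applied twice: along \<open>a\<close> to the difference of
  \<open>f\<close> and its translate by \<open>h *\<^sub>R b\<close>, then along \<open>b\<close> to
  the derivative in direction \<open>a\<close>.\<close>

lemma second_difference: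
  fixes f :: "'a::real_normed_vector \<Rightarrow> real"
  assumes f: "Ck_on 2 S f" and h: "h > 0"
    and S: "\<And>s t. s \<in> {0..h} \<Longrightarrow> t \<in> {0..h} \<Longrightarrow> x + s *\<^sub>R a + t *\<^sub>R b \<in> S"
  shows "\<exists>s\<in>{0..h}. \<exists>t\<in>{0..h}. f (x + h *\<^sub>R a + h *\<^sub>R b) - f (x + h *\<^sub>R a) - f (x + h *\<^sub>R b) + f x
     = h * h * fderiv (\<lambda>y. fderiv f y a) (x + s *\<^sub>R a + t *\<^sub>R b) b"
proof -
  have d1: "f differentiable (at y)" if "y \<in> S" for y using f that by (auto simp: numeral_2_eq_2)
  have d2: "(\<lambda>y. fderiv f y a) differentiable (at y)" if "y \<in> S" for y using f that by (auto simp: numeral_2_eq_2)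
  define g where "g = (\<lambda>s. f ((x + h *\<^sub>R b) + s *\<^sub>R a) - f (x + s *\<^sub>R a))"
  have "\<exists>s>0. s < h \<and> g h - g 0 = (h - 0) * (fderiv f ((x + h *\<^sub>R b) + s *\<^sub>R a) a - fderiv f (x + s *\<^sub>R a) a)"
  proof (rule MVT2[OF h])
    fix s assume s: "0 \<le> s" "s \<le> h"
    have "f differentiable (at ((x + h *\<^sub>R b) + s *\<^sub>R a))" "f differentiable (at (x + s *\<^sub>R a))"
      using S[of s h] S[of s 0] s h by (auto intro!: d1 simp: algebra_simps)
    then show "DERIV g s :> fderiv f ((x + h *\<^sub>R b) + s *\<^sub>R a) a - fderiv f (x + s *\<^sub>R a) a"
      unfolding g_def by (intro DERIV_diff) (auto dest: fderiv_line simp: has_real_derivative_iff_has_vector_derivative)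
  qed
  then obtain s where s: "0 < s" "s < h" "g h - g 0 = h * (fderiv f ((x + h *\<^sub>R b) + s *\<^sub>R a) a - fderiv f (x + s *\<^sub>R a) a)"
    by auto
  have "\<exists>t>0. t < h \<and> fderiv f ((x + s *\<^sub>R a) + h *\<^sub>R b) a - fderiv f ((x + s *\<^sub>R a) + 0 *\<^sub>R b) a
     = (h - 0) * fderiv (\<lambda>y. fderiv f y a) ((x + s *\<^sub>R a) + t *\<^sub>R b) b"
  proof (rule MVT2[OF h])
    fix t assume t: "0 \<le> t" "t \<le> h"
    show "DERIV (\<lambda>t. fderiv f ((x + s *\<^sub>R a) + t *\<^sub>R b) a) t :> fderiv (\<lambda>y. fderiv f y a) ((x + s *\<^sub>R a) + t *\<^sub>R b) b"
      using fderiv_line[OF d2[OF S[of s t]]] s t by (simp add: has_real_derivative_iff_has_vector_derivative)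
  qed
  then obtain t where t: "0 < t" "t < h" "fderiv f ((x + s *\<^sub>R a) + h *\<^sub>R b) a - fderiv f (x + s *\<^sub>R a) a
     = h * fderiv (\<lambda>y. fderiv f y a) ((x + s *\<^sub>R a) + t *\<^sub>R b) b" by auto
  have "f (x + h *\<^sub>R a + h *\<^sub>R b) - f (x + h *\<^sub>R a) - f (x + h *\<^sub>R b) + f x = g h - g 0"
    unfolding g_def by (simp add: algebra_simps)
  also have "\<dots> = h * (h * fderiv (\<lambda>y. fderiv f y a) ((x + s *\<^sub>R a) + t *\<^sub>R b) b)"
    unfolding s(3) t(3)[symmetric] by (simp add: algebra_simps)
  finally show ?thesis using s t by (intro bexI[of _ s] bexI[of _ t]) auto
qed

text \<open>The second difference over a parallelogram does not change when \<open>a\<close> and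
  \<open>b\<close> are exchanged, and it equals \<open>h * h\<close> times either mixed derivative
  at some point of the parallelogram. Continuity of both mixed derivatives then forces equality at
  \<open>x\<close>.\<close>

lemma fderiv_symmetric_real:
  fixes f :: "'a::real_normed_vector \<Rightarrow> real"
  assumes S: "open S" "x \<in> S" and f: "Ck_on 2 S f"
  shows "fderiv (\<lambda>y. fderiv f y a) x b = fderiv (\<lambda>y. fderiv f y b) x a"
proof (rule ccontr)
  define A where "A = (\<lambda>y. fderiv (\<lambda>y. fderiv f y a) y b)"
  define B where "B = (\<lambda>y. fderiv (\<lambda>y. fderiv f y b) y a)"
  assume "\<not> ?thesis"
  then have ne: "A x \<noteq> B x" unfolding A_def B_def .
  \<comment> \<open>Half the distance: one number cannot be closer than \<open>e\<close> to both
    \<open>A x\<close> and \<open>B x\<close>.\<close>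
  define e where "e = dist (A x) (B x) / 2"
  have e: "e > 0" using ne unfolding e_def by simp
  have c: "isCont A x" "isCont B x"
    using f S unfolding A_def B_def by (auto simp: numeral_2_eq_2 continuous_on_eq_continuous_at)
  obtain d1 d2 where d1: "d1 > 0" "\<And>y. dist y x < d1 \<Longrightarrow> dist (A y) (A x) < e"
    and d2: "d2 > 0" "\<And>y. dist y x < d2 \<Longrightarrow> dist (B y) (B x) < e"
    using c e unfolding continuous_at_eps_delta by metis
  obtain d3 where d3: "d3 > 0" "\<And>y. dist y x < d3 \<Longrightarrow> y \<in> S"
    using S open_dist by metis
  define d where "d = min d1 (min d2 d3)"
  have d: "d > 0" using d1 d2 d3 by (auto simp: d_def)
  \<comment> \<open>Small enough that the whole parallelogram spanned by
    \<open>h *\<^sub>R a\<close> and \<open>h *\<^sub>R b\<close> stays within \<open>d / 2\<close>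
    of \<open>x\<close>; the summand 1 covers the case in which both vectors vanish.\<close>
  define h where "h = d / (2 * (norm a + norm b + 1))"
  have pos: "norm a + norm b + 1 > 0" by (simp add: add_nonneg_pos)
  have h: "h > 0" unfolding h_def using d pos by simp
  have near: "dist (x + s *\<^sub>R a + t *\<^sub>R b) x < d" if "s \<in> {0..h}" "t \<in> {0..h}" for s t
  proof -
    have "dist (x + s *\<^sub>R a + t *\<^sub>R b) x = norm (s *\<^sub>R a + t *\<^sub>R b)" by (simp add: dist_norm algebra_simps)
    also have "\<dots> \<le> norm (s *\<^sub>R a) + norm (t *\<^sub>R b)" by (rule norm_triangle_ineq)
    also have "\<dots> = s * norm a + t * norm b" using that by auto
    also have "\<dots> \<le> h * norm a + h * norm b" using that by (intro add_mono mult_right_mono) auto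
    also have "\<dots> < h * (norm a + norm b + 1)" using h by (simp add: algebra_simps)
    also have "\<dots> = d / 2" unfolding h_def using pos by (simp add: field_simps)
    finally show ?thesis using d by simp
  qed
  let ?Q = "f (x + h *\<^sub>R a + h *\<^sub>R b) - f (x + h *\<^sub>R a) - f (x + h *\<^sub>R b) + f x"
  obtain s t where st: "s \<in> {0..h}" "t \<in> {0..h}" "?Q = h * h * A (x + s *\<^sub>R a + t *\<^sub>R b)"
    using second_difference[OF f h, of x a b] near d3 unfolding A_def d_def by auto
  obtain s' t' where st': "s' \<in> {0..h}" "t' \<in> {0..h}" "?Q = h * h * B (x + s' *\<^sub>R b + t' *\<^sub>R a)"
  proof -
    have "x + s *\<^sub>R b + t *\<^sub>R a \<in> S" if "s \<in> {0..h}" "t \<in> {0..h}" for s t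
      using near[of t s] that d3(2)[of "x + t *\<^sub>R a + s *\<^sub>R b"] unfolding d_def by (simp add: algebra_simps)
    from second_difference[OF f h this] show ?thesis using that unfolding B_def by (auto simp: algebra_simps)
  qed
  have "A (x + s *\<^sub>R a + t *\<^sub>R b) = B (x + s' *\<^sub>R b + t' *\<^sub>R a)"
    using st(3) st'(3) h by simp
  moreover have "dist (A (x + s *\<^sub>R a + t *\<^sub>R b)) (A x) < e"
    using near[OF st(1,2)] unfolding d_def by (intro d1) auto
  moreover have "dist (B (x + s' *\<^sub>R b + t' *\<^sub>R a)) (B x) < e"
    using near[OF st'(2,1)] unfolding d_def by (intro d2) (auto simp: algebra_simps)
  ultimately show False unfolding e_def using dist_triangle_half_r
    by (metis dist_commute less_irrefl dist_triangle_half_l)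
qed

lemma fderiv_symmetric:
  fixes f :: "'a::real_normed_vector \<Rightarrow> 'b::euclidean_space"
  assumes S: "open S" "x \<in> S" and f: "smooth_on S f"
  shows "fderiv (\<lambda>y. fderiv f y a) x b = fderiv (\<lambda>y. fderiv f y b) x a"
proof (rule euclidean_eqI)
  fix c :: 'b assume "c \<in> Basis"
  have lin: "fderiv (\<lambda>x. g x \<bullet> c) y v = fderiv g y v \<bullet> c" if "smooth_on S g" "y \<in> S" for g :: "'a \<Rightarrow> 'b" and y v
    using fderiv_eqI[OF has_derivative_inner_left[OF smooth_on_has_derivative[OF that]]] by metis
  have "fderiv (\<lambda>y. fderiv f y u) x v \<bullet> c = fderiv (\<lambda>y. fderiv (\<lambda>x. f x \<bullet> c) y u) x v" for u v
    using lin[OF smooth_on_fderiv[OF f] S(2), of u v] fderiv_cong[OF S, of "\<lambda>y. fderiv (\<lambda>x. f x \<bullet> c) y u" "\<lambda>y. fderiv f y u \<bullet> c"]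
      lin[OF f] by auto
  moreover have "Ck_on 2 S (\<lambda>x. f x \<bullet> c)"
    using smooth_on_inner[OF S(1) f smooth_on_const] unfolding smooth_on_def by auto
  ultimately show "fderiv (\<lambda>y. fderiv f y a) x b \<bullet> c = fderiv (\<lambda>y. fderiv f y b) x a \<bullet> c"
    using fderiv_symmetric_real[OF S] by simp
qed

text \<open>A product rule: the moving base point contributes a second derivative with the direction
  frozen at \<open>h x\<close>, and the moving direction contributes linearly. The basis expansion
  turns this into the ordinary product rule for each coefficient.\<close>

lemma has_derivative_fderiv_apply:
  fixes f :: "'a::euclidean_space \<Rightarrow> 'b::real_normed_vector"
  assumes S: "open S" "g x \<in> S" and f: "smooth_on S f"
    and g: "(g has_derivative g') (at x)" and h: "(h has_derivative h') (at x)"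
  shows "((\<lambda>x. fderiv f (g x) (h x)) has_derivative
     (\<lambda>v. fderiv (\<lambda>z. fderiv f z (h x)) (g x) (g' v) + fderiv f (g x) (h' v))) (at x)"
proof -
  \<comment> \<open>Linearity of \<open>fderiv f (g y)\<close> is needed not only at
    \<open>x\<close> but at all nearby \<open>y\<close>, so \<open>g\<close> is confined to
    \<open>S\<close> by continuity.\<close>
  obtain W where W: "open W" "x \<in> W" "g ` W \<subseteq> S"
  proof -
    have "isCont g x" using g has_derivative_continuous by blast
    from continuous_at_open[THEN iffD1, OF this] S obtain W where "open W" "x \<in> W" "\<forall>y\<in>W. g y \<in> S" by metis
    then show ?thesis using that by blast
  qed
  have lin: "fderiv f (g y) u = (\<Sum>b\<in>Basis. (u \<bullet> b) *\<^sub>R fderiv f (g y) b)" if "y \<in> W" for y u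
    using W that f by (intro linear_sum_Basis smooth_on_linear_fderiv) auto
  have lin2: "fderiv (\<lambda>z. fderiv f z u) (g x) v = (\<Sum>b\<in>Basis. (u \<bullet> b) *\<^sub>R fderiv (\<lambda>z. fderiv f z b) (g x) v)" for u v
  proof -
    have "fderiv (\<lambda>z. fderiv f z u) (g x) = fderiv (\<lambda>z. \<Sum>b\<in>Basis. (u \<bullet> b) *\<^sub>R fderiv f z b) (g x)"
      using f by (intro fderiv_cong[OF S] linear_sum_Basis smooth_on_linear_fderiv)
    also have "\<dots> = (\<lambda>v. \<Sum>b\<in>Basis. (u \<bullet> b) *\<^sub>R fderiv (\<lambda>z. fderiv f z b) (g x) v)"
      by (intro fderiv_eqI has_derivative_sum has_derivative_scaleR_right
          smooth_on_has_derivative[OF smooth_on_fderiv[OF f] S(2)])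
    finally show ?thesis by metis
  qed
  have D: "((\<lambda>x. fderiv f (g x) b) has_derivative (\<lambda>v. fderiv (\<lambda>z. fderiv f z b) (g x) (g' v))) (at x)" for b
    using has_derivative_compose[OF g smooth_on_has_derivative[OF smooth_on_fderiv[OF f] S(2)]] .
  have "(\<Sum>b\<in>Basis. (h x \<bullet> b) *\<^sub>R fderiv (\<lambda>z. fderiv f z b) (g x) (g' v) + (h' v \<bullet> b) *\<^sub>R fderiv f (g x) b)
     = fderiv (\<lambda>z. fderiv f z (h x)) (g x) (g' v) + fderiv f (g x) (h' v)" for v
    unfolding lin2[of "h x"] lin[OF W(2), of "h' v"] sum.distrib ..
  then have "((\<lambda>x. \<Sum>b\<in>Basis. (h x \<bullet> b) *\<^sub>R fderiv f (g x) b) has_derivative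
    (\<lambda>v. fderiv (\<lambda>z. fderiv f z (h x)) (g x) (g' v) + fderiv f (g x) (h' v))) (at x)"
    using has_derivative_sum[of Basis "\<lambda>b x. (h x \<bullet> b) *\<^sub>R fderiv f (g x) b", OF has_derivative_scaleR[OF has_derivative_inner_left[OF h] D]]
    by (simp only:)
  then show ?thesis
    using has_derivative_cong_open[of W x "\<lambda>x. fderiv f (g x) (h x)", OF W(1,2) lin[of _ "h _"]] by (simp only:)
qed

section \<open>Charts and tangent vectors\<close>

declare split_paired_All [simp del] split_paired_Ex [simp del]

section \<open>Chart domains, overlaps and open subsets\<close>

lemma charts_at_iff: "c \<in> charts_at A x \<longleftrightarrow> c \<in> A \<and> x \<in> cdom c"
  unfolding charts_at_def by simp

lemma chart_at_in: "x \<in> points A \<Longrightarrow> chart_at A x \<in> charts_at A x"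
  unfolding chart_at_def by (rule someI_ex) (auto simp: points_def charts_at_def)

lemma cinv_cmap: "smooth_atlas A \<Longrightarrow> c \<in> A \<Longrightarrow> x \<in> cdom c \<Longrightarrow> cinv c (cmap c x) = x"
  unfolding smooth_atlas_def cinv_def by simp

lemma transition_cmap:
  "smooth_atlas A \<Longrightarrow> c \<in> A \<Longrightarrow> x \<in> cdom c \<Longrightarrow> transition c d (cmap c x) = cmap d x"
  by (simp add: transition_def cinv_cmap)

lemma cmap_eqD:
  "smooth_atlas A \<Longrightarrow> c \<in> A \<Longrightarrow> x \<in> cdom c \<Longrightarrow> y \<in> cdom c \<Longrightarrow> cmap c x = cmap c y \<Longrightarrow> x = y"
  unfolding smooth_atlas_def inj_on_def by blast

lemma cmap_image_Int:
  "smooth_atlas A \<Longrightarrow> c \<in> A \<Longrightarrow> S \<subseteq> cdom c \<Longrightarrow> T \<subseteq> cdom c \<Longrightarrow> cmap c ` (S \<inter> T) = cmap c ` S \<inter> cmap c ` T"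
  unfolding smooth_atlas_def by (meson inj_on_image_Int)

lemma open_overlap: "smooth_atlas A \<Longrightarrow> c \<in> A \<Longrightarrow> d \<in> A \<Longrightarrow> open (cmap c ` (cdom c \<inter> cdom d))"
  unfolding smooth_atlas_def by blast

lemma open_cdom: "smooth_atlas A \<Longrightarrow> c \<in> A \<Longrightarrow> open (cmap c ` cdom c)"
  using open_overlap[of A c c] by simp

lemma smooth_transition:
  "smooth_atlas A \<Longrightarrow> c \<in> A \<Longrightarrow> d \<in> A \<Longrightarrow> smooth_on (cmap c ` (cdom c \<inter> cdom d)) (transition c d)"
  unfolding smooth_atlas_def by blast

text \<open>Bundle and product atlases have explicit transition formulas \<open>T\<close>. This rule
  accepts such a formula on the overlap, so that \<open>cinv\<close> of a bundle chart never has to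
  be computed.\<close>

lemma smooth_atlasI:
  assumes "\<And>c. c \<in> A \<Longrightarrow> inj_on (cmap c) (cdom c)"
    and "\<And>c d. c \<in> A \<Longrightarrow> d \<in> A \<Longrightarrow> open (cmap c ` (cdom c \<inter> cdom d))"
    and "\<And>c d. c \<in> A \<Longrightarrow> d \<in> A \<Longrightarrow> \<exists>T. smooth_on (cmap c ` (cdom c \<inter> cdom d)) T \<and>
           (\<forall>x\<in>cdom c \<inter> cdom d. T (cmap c x) = cmap d x)"
  shows "smooth_atlas A"
  unfolding smooth_atlas_def
proof (intro conjI ballI)
  fix c d assume cd: "c \<in> A" "d \<in> A"
  obtain T where T: "smooth_on (cmap c ` (cdom c \<inter> cdom d)) T"
    "\<forall>x\<in>cdom c \<inter> cdom d. T (cmap c x) = cmap d x" using assms(3)[OF cd] by blast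
  have "transition c d y = T y" if "y \<in> cmap c ` (cdom c \<inter> cdom d)" for y
    using that T(2) assms(1)[OF cd(1)] by (auto simp: transition_def cinv_def)
  then show "smooth_on (cmap c ` (cdom c \<inter> cdom d)) (transition c d)"
    by (rule iffD2[OF smooth_on_cong[OF assms(2)[OF cd]] T(1)])
qed (use assms in auto)

lemma open_subset_openD: "open_subset A U \<Longrightarrow> c \<in> A \<Longrightarrow> open (cmap c ` (U \<inter> cdom c))"
  unfolding open_subset_def by blast

lemma open_subset_Int:
  assumes "smooth_atlas A" "open_subset A U" "open_subset A V"
  shows "open_subset A (U \<inter> V)"
proof -
  have "cmap c ` (U \<inter> V \<inter> cdom c) = cmap c ` (U \<inter> cdom c) \<inter> cmap c ` (V \<inter> cdom c)" if "c \<in> A" for c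
    using cmap_image_Int[OF assms(1) that, of "U \<inter> cdom c" "V \<inter> cdom c"] by (simp add: Int_assoc Int_left_commute)
  then show ?thesis using assms by (auto simp: open_subset_def)
qed

lemma open_subset_cdom: "smooth_atlas A \<Longrightarrow> c \<in> A \<Longrightarrow> open_subset A (cdom c)"
  using open_overlap[of A _ c] by (auto simp: open_subset_def points_def Int_commute)

lemma open_subset_points: "smooth_atlas A \<Longrightarrow> open_subset A (points A)"
  unfolding open_subset_def points_def
proof (intro conjI ballI)
  fix c assume "smooth_atlas A" "c \<in> A"
  moreover from this have "\<Union> (cdom ` A) \<inter> cdom c = cdom c" by auto
  ultimately show "open (cmap c ` (\<Union> (cdom ` A) \<inter> cdom c))" by (simp add: open_cdom)
qed auto

lemma open_subset_chart_preimage: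
  assumes A: "smooth_atlas A" "c \<in> A" and W: "open W"
  shows "open_subset A {x \<in> cdom c. cmap c x \<in> W}"
  unfolding open_subset_def
proof (intro conjI ballI)
  fix d assume d: "d \<in> A"
  let ?O = "cmap d ` (cdom d \<inter> cdom c)"
  have "cmap d ` ({x \<in> cdom c. cmap c x \<in> W} \<inter> cdom d) = ?O \<inter> transition d c -` W"
    by (auto simp: transition_cmap[OF A(1) d] intro!: imageI)
  also have "open \<dots>"
    using smooth_on_continuous_on[OF smooth_transition[OF A(1) d A(2)]] open_overlap[OF A(1) d A(2)] W
    by (rule continuous_open_preimage)
  finally show "open (cmap d ` ({x \<in> cdom c. cmap c x \<in> W} \<inter> cdom d))" .
qed (use A in \<open>auto simp: points_def\<close>)

lemma open_overlap3:
  assumes "smooth_atlas A" "c \<in> A" "d \<in> A" "e \<in> A"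
  shows "open (cmap c ` (cdom c \<inter> cdom d \<inter> cdom e))"
proof -
  have "cmap c ` (cdom c \<inter> cdom d \<inter> cdom e) = cmap c ` (cdom c \<inter> cdom d) \<inter> cmap c ` (cdom c \<inter> cdom e)"
    using cmap_image_Int[OF assms(1,2), of "cdom c \<inter> cdom d" "cdom c \<inter> cdom e"] by (simp add: Int_ac)
  then show ?thesis using assms by (simp add: open_overlap open_Int)
qed

section \<open>Derivatives of transition maps; tangent and cotangent vectors\<close>

lemma transition_has_derivative:
  assumes "smooth_atlas A" "c \<in> charts_at A x" "d \<in> charts_at A x"
  shows "(transition c d has_derivative fderiv (transition c d) (cmap c x)) (at (cmap c x))"
  using assms by (intro smooth_on_has_derivative[OF smooth_transition]) (auto simp: charts_at_iff)

lemma linear_fderiv_transition: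
  assumes "smooth_atlas A" "c \<in> charts_at A x" "d \<in> charts_at A x"
  shows "linear (fderiv (transition c d) (cmap c x))"
  using transition_has_derivative[OF assms] has_derivative_linear by blast

text \<open>Chain rule on the triple overlap, where the transition maps compose exactly. It makes
  the transformation laws consistent.\<close>

lemma fderiv_transition_trans:
  assumes A: "smooth_atlas A" and c: "c \<in> charts_at A x" "d \<in> charts_at A x" "e \<in> charts_at A x"
  shows "fderiv (transition d e) (cmap d x) (fderiv (transition c d) (cmap c x) u) = fderiv (transition c e) (cmap c x) u"
proof -
  let ?W = "cmap c ` (cdom c \<inter> cdom d \<inter> cdom e)"
  have W: "open ?W" "cmap c x \<in> ?W" using open_overlap3[OF A] c by (auto simp: charts_at_iff)
  have x: "transition c d (cmap c x) = cmap d x" using transition_cmap[OF A] c by (simp add: charts_at_iff)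
  have "((\<lambda>y. transition d e (transition c d y)) has_derivative
    (\<lambda>u. fderiv (transition d e) (cmap d x) (fderiv (transition c d) (cmap c x) u))) (at (cmap c x))"
    using has_derivative_compose[OF transition_has_derivative[OF A c(1,2)], of "transition d e" "fderiv (transition d e) (cmap d x)"]
      transition_has_derivative[OF A c(2,3)] x by simp
  moreover have "transition d e (transition c d y) = transition c e y" if "y \<in> ?W" for y
    using that c by (auto simp: charts_at_iff transition_cmap[OF A])
  ultimately show ?thesis
    using fderiv_eqI has_derivative_cong_open[OF W, of "\<lambda>y. transition d e (transition c d y)" "transition c e"] by metis
qed

lemma fderiv_transition_refl:
  assumes A: "smooth_atlas A" and c: "c \<in> charts_at A x"
  shows "fderiv (transition c c) (cmap c x) u = u"
proof -
  have "fderiv (transition c c) (cmap c x) = fderiv (\<lambda>y. y) (cmap c x)"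
    using c by (intro fderiv_cong[OF open_cdom[OF A]]) (auto simp: charts_at_iff transition_cmap[OF A])
  then show ?thesis by simp
qed

lemma fderiv_transition_inverse:
  assumes A: "smooth_atlas A" and c: "c \<in> charts_at A x" "d \<in> charts_at A x"
  shows "fderiv (transition d c) (cmap d x) (fderiv (transition c d) (cmap c x) u) = u"
  using fderiv_transition_trans[OF A c c(1)] fderiv_transition_refl[OF A c(1)] by simp

text \<open>Inverse of the evaluation of components at the chart \<open>c\<close>: it identifies the
  tangent space at \<open>x\<close> with the model space (\<open>tangent_vec_in\<close>,
  \<open>tangent_vec_at\<close>, \<open>tangent_space_eqI\<close>).\<close>

definition tangent_vec :: "('m, 'e::euclidean_space) chart set \<Rightarrow> 'm \<Rightarrow> ('m, 'e) chart \<Rightarrow> 'e \<Rightarrow> ('m, 'e) comps" where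
  "tangent_vec A x c u = (\<lambda>d. if d \<in> charts_at A x then fderiv (transition c d) (cmap c x) u else 0)"

lemma tangent_vec_in: "smooth_atlas A \<Longrightarrow> c \<in> charts_at A x \<Longrightarrow> tangent_vec A x c u \<in> tangent_space A x"
  unfolding tangent_space_def tangent_vec_def by (auto simp: fderiv_transition_trans)

lemma tangent_vec_at: "smooth_atlas A \<Longrightarrow> c \<in> charts_at A x \<Longrightarrow> tangent_vec A x c u c = u"
  unfolding tangent_vec_def by (simp add: fderiv_transition_refl)

lemma tangent_space_transform:
  "v \<in> tangent_space A x \<Longrightarrow> c \<in> charts_at A x \<Longrightarrow> d \<in> charts_at A x \<Longrightarrow>
   v d = fderiv (transition c d) (cmap c x) (v c)"
  unfolding tangent_space_def by blast

lemma tangent_space_zero: "v \<in> tangent_space A x \<Longrightarrow> c \<notin> charts_at A x \<Longrightarrow> v c = 0"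
  unfolding tangent_space_def by blast

lemma tangent_space_eqI:
  assumes "c \<in> charts_at A x" "v \<in> tangent_space A x" "w \<in> tangent_space A x" "v c = w c"
  shows "v = w"
proof
  fix d show "v d = w d"
  proof (cases "d \<in> charts_at A x")
    case True
    then show ?thesis
      using tangent_space_transform[OF assms(2,1)] tangent_space_transform[OF assms(3,1)] assms(4) by metis
  qed (use assms(2,3) in \<open>simp add: tangent_space_zero\<close>)
qed

text \<open>Riesz representation: the vector of coefficients of a functional reproduces it through
  the inner product.\<close>

lemma inner_sum_Basis_linear:
  fixes g :: "'a::euclidean_space \<Rightarrow> real"
  assumes "linear g" shows "(\<Sum>b\<in>Basis. g b *\<^sub>R b) \<bullet> u = g u"
  using linear_sum_Basis[OF assms, of u] by (simp add: inner_sum_left inner_commute[of u] mult.commute)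

text \<open>Counterpart of \<open>tangent_vec\<close>. Covector components are vectors that act by
  the inner product, so the pullback of \<open>w\<close> is the adjoint of the derivative, spelled
  out by its coefficients.\<close>

definition cotangent_vec :: "('m, 'e::euclidean_space) chart set \<Rightarrow> 'm \<Rightarrow> ('m, 'e) chart \<Rightarrow> 'e \<Rightarrow> ('m, 'e) comps" where
  "cotangent_vec A x c w = (\<lambda>d. if d \<in> charts_at A x
     then \<Sum>b\<in>Basis. (w \<bullet> fderiv (transition d c) (cmap d x) b) *\<^sub>R b else 0)"

lemma cotangent_vec_inner:
  assumes "smooth_atlas A" "c \<in> charts_at A x" "d \<in> charts_at A x"
  shows "cotangent_vec A x c w d \<bullet> u = w \<bullet> fderiv (transition d c) (cmap d x) u"
proof -
  have "linear (\<lambda>u. w \<bullet> fderiv (transition d c) (cmap d x) u)"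
    using linear_fderiv_transition[OF assms(1,3,2)]
    by (simp add: linear_iff inner_add_right)
  then show ?thesis using assms(3) inner_sum_Basis_linear by (simp add: cotangent_vec_def)
qed

lemma cotangent_vec_in:
  "smooth_atlas A \<Longrightarrow> c \<in> charts_at A x \<Longrightarrow> cotangent_vec A x c w \<in> cotangent_space A x"
  unfolding cotangent_space_def
  by (auto simp: cotangent_vec_inner fderiv_transition_trans) (simp add: cotangent_vec_def)

lemma cotangent_vec_at:
  "smooth_atlas A \<Longrightarrow> c \<in> charts_at A x \<Longrightarrow> cotangent_vec A x c w c = w"
  by (rule vector_eq_rdot[THEN iffD1]) (simp add: cotangent_vec_inner fderiv_transition_refl)

lemma cotangent_space_transform:
  "a \<in> cotangent_space A x \<Longrightarrow> c \<in> charts_at A x \<Longrightarrow> d \<in> charts_at A x \<Longrightarrow>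
   a c \<bullet> u = a d \<bullet> fderiv (transition c d) (cmap c x) u"
  unfolding cotangent_space_def by blast

lemma cotangent_space_zero: "a \<in> cotangent_space A x \<Longrightarrow> c \<notin> charts_at A x \<Longrightarrow> a c = 0"
  unfolding cotangent_space_def by blast

lemma cotangent_space_eqI:
  assumes "c \<in> charts_at A x" "a \<in> cotangent_space A x" "b \<in> cotangent_space A x" "a c = b c"
  shows "a = b"
proof
  fix d show "a d = b d"
  proof (cases "d \<in> charts_at A x")
    case True
    have "a d \<bullet> u = b d \<bullet> u" for u
      using cotangent_space_transform[OF assms(2) True assms(1)] cotangent_space_transform[OF assms(3) True assms(1)]
        assms(4) by metis
    then show ?thesis using vector_eq_rdot by blast
  qed (use assms(2,3) in \<open>simp add: cotangent_space_zero\<close>)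
qed

lemma cotangent_spaceI:
  assumes "\<And>c. c \<notin> charts_at A x \<Longrightarrow> a c = 0"
    and "\<And>c d u. c \<in> charts_at A x \<Longrightarrow> d \<in> charts_at A x \<Longrightarrow> a c \<bullet> u = a d \<bullet> fderiv (transition c d) (cmap c x) u"
  shows "a \<in> cotangent_space A x"
  unfolding cotangent_space_def using assms by blast

lemma cotangent_space_add:
  assumes "a \<in> cotangent_space A x" "b \<in> cotangent_space A x"
  shows "(\<lambda>c. a c + b c) \<in> cotangent_space A x"
proof (rule cotangent_spaceI)
  fix c d u assume "c \<in> charts_at A x" "d \<in> charts_at A x"
  from cotangent_space_transform[OF assms(1) this] cotangent_space_transform[OF assms(2) this]
  show "(a c + b c) \<bullet> u = (a d + b d) \<bullet> fderiv (transition c d) (cmap c x) u"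
    by (metis inner_add_left)
qed (use assms in \<open>simp add: cotangent_space_zero\<close>)

lemma cotangent_space_scale:
  assumes "a \<in> cotangent_space A x"
  shows "(\<lambda>c. r *\<^sub>R a c) \<in> cotangent_space A x"
proof (rule cotangent_spaceI)
  fix c d u assume "c \<in> charts_at A x" "d \<in> charts_at A x"
  from cotangent_space_transform[OF assms(1) this]
  show "(r *\<^sub>R a c) \<bullet> u = (r *\<^sub>R a d) \<bullet> fderiv (transition c d) (cmap c x) u"
    by (metis inner_scaleR_left)
qed (use assms in \<open>simp add: cotangent_space_zero\<close>)

lemma pairing_chart:
  assumes A: "smooth_atlas A" and c: "c \<in> charts_at A x" and a: "a \<in> cotangent_space A x" and v: "v \<in> tangent_space A x"
  shows "pairing A x a v = a c \<bullet> v c"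
proof -
  have "chart_at A x \<in> charts_at A x" using c chart_at_in by (metis charts_at_iff UN_I points_def)
  then show ?thesis
    unfolding pairing_def using tangent_space_transform[OF v c] cotangent_space_transform[OF a c] by metis
qed

section \<open>Smooth maps in charts\<close>

text \<open>The definition of \<open>smooth_map\<close> quantifies over all pairs of charts. One
  pair around each point is enough, because every other representative is locally this one between
  two smooth transition maps.\<close>

lemma smooth_mapI_local:
  assumes A: "smooth_atlas A" and B: "smooth_atlas B" and U: "open_subset A U"
    and loc: "\<And>x. x \<in> U \<Longrightarrow> \<exists>c\<in>A. \<exists>d\<in>B. \<exists>W. x \<in> cdom c \<and> open W \<and> cmap c x \<in> W \<and> W \<subseteq> cmap c ` (U \<inter> cdom c) \<and>
       (\<forall>y\<in>W. F (cinv c y) \<in> cdom d) \<and> smooth_on W (cmap d \<circ> F \<circ> cinv c)"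
  shows "smooth_map A U B F"
proof -
  have "F ` U \<subseteq> points B"
  proof
    fix z assume "z \<in> F ` U"
    then obtain x where x: "x \<in> U" "z = F x" by auto
    from loc[OF x(1)] obtain c d W where "c \<in> A" "d \<in> B" "x \<in> cdom c" "cmap c x \<in> W"
      "\<forall>y\<in>W. F (cinv c y) \<in> cdom d" by blast
    then show "z \<in> points B" using x cinv_cmap[OF A, of c x] by (force simp: points_def)
  qed
  moreover have "open W' \<and> smooth_on W' (cmap d' \<circ> F \<circ> cinv c')"
    if cd': "c' \<in> A" "d' \<in> B" and W': "W' = cmap c' ` {x \<in> U \<inter> cdom c'. F x \<in> cdom d'}" for c' d' W'
  proof -
    have ex: "\<exists>T. open T \<and> y \<in> T \<and> T \<subseteq> W' \<and> smooth_on T (cmap d' \<circ> F \<circ> cinv c')" if y: "y \<in> W'" for y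
    proof -
      obtain x where x: "x \<in> U" "x \<in> cdom c'" "F x \<in> cdom d'" "y = cmap c' x" using y W' by auto
      obtain c d W where c: "c \<in> A" "d \<in> B" "x \<in> cdom c" "open W" "cmap c x \<in> W" "W \<subseteq> cmap c ` (U \<inter> cdom c)"
        and d: "\<forall>y\<in>W. F (cinv c y) \<in> cdom d" and s: "smooth_on W (cmap d \<circ> F \<circ> cinv c)"
        using loc[OF x(1)] by blast
      \<comment> \<open>\<open>T\<close> collects the coordinates in \<open>c'\<close> of those
        points that also lie in \<open>c\<close>, have \<open>c\<close>-coordinates in
        \<open>W\<close>, and are sent by \<open>F\<close> into both \<open>d\<close> and
        \<open>d'\<close>. There the composition with the transition maps is legitimate.\<close>
      define O1 where "O1 = cmap c' ` (cdom c' \<inter> cdom c)"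
      define O2 where "O2 = cmap d ` (cdom d \<inter> cdom d')"
      define W2 where "W2 = W \<inter> (cmap d \<circ> F \<circ> cinv c) -` O2"
      define T where "T = O1 \<inter> transition c' c -` W2"
      have O: "open O1" "open O2" unfolding O1_def O2_def using A B c cd' open_overlap by blast+
      have W2: "open W2" unfolding W2_def
        using smooth_on_continuous_on[OF s] c(4) O(2) by (rule continuous_open_preimage)
      have s1: "smooth_on O1 (transition c' c)" unfolding O1_def using smooth_transition[OF A] cd' c by blast
      have T: "open T" unfolding T_def
        using smooth_on_continuous_on[OF s1] O(1) W2 by (rule continuous_open_preimage)
      have *: "z \<in> W' \<and> (cmap d' \<circ> F \<circ> cinv c') z = transition d d' ((cmap d \<circ> F \<circ> cinv c) (transition c' c z))" if z: "z \<in> T" for z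
      proof -
        obtain x' where x': "x' \<in> cdom c'" "x' \<in> cdom c" "z = cmap c' x'" using z unfolding T_def O1_def by auto
        have t: "transition c' c z = cmap c x'" using x' transition_cmap[OF A cd'(1)] by simp
        have w: "cmap c x' \<in> W2" using z t unfolding T_def by auto
        then have "cmap c x' \<in> W" unfolding W2_def by auto
        then have U': "x' \<in> U" using c(6) cmap_eqD[OF A c(1)] x' by blast
        have Fd: "F x' \<in> cdom d" using d \<open>cmap c x' \<in> W\<close> cinv_cmap[OF A c(1) x'(2)] by fastforce
        have "cmap d (F x') \<in> O2" using w cinv_cmap[OF A c(1) x'(2)] unfolding W2_def by auto
        then have Fd': "F x' \<in> cdom d'" using cmap_eqD[OF B c(2) Fd] unfolding O2_def by blast
        show ?thesis using x' U' Fd' t cinv_cmap[OF A c(1) x'(2)] cinv_cmap[OF A cd'(1) x'(1)] transition_cmap[OF B c(2) Fd]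
          unfolding W' by auto
      qed
      have "smooth_on T (\<lambda>z. transition d d' ((cmap d \<circ> F \<circ> cinv c) (transition c' c z)))"
      proof (rule smooth_on_compose[of T O2 "\<lambda>z. (cmap d \<circ> F \<circ> cinv c) (transition c' c z)" "transition d d'"])
        show "smooth_on T (\<lambda>z. (cmap d \<circ> F \<circ> cinv c) (transition c' c z))"
        proof (rule smooth_on_compose[of T W2 "transition c' c" "cmap d \<circ> F \<circ> cinv c"])
          show "smooth_on W2 (cmap d \<circ> F \<circ> cinv c)" by (rule smooth_on_subset[OF s]) (simp add: W2_def)
          show "smooth_on T (transition c' c)" by (rule smooth_on_subset[OF s1]) (simp add: T_def)
        qed (use T W2 in \<open>auto simp: T_def\<close>)
        show "smooth_on O2 (transition d d')" unfolding O2_def using smooth_transition[OF B] cd' c by blast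
      qed (use T O in \<open>auto simp: T_def W2_def\<close>)
      moreover have "y \<in> T"
      proof -
        have t: "transition c' c y = cmap c x" using x transition_cmap[OF A cd'(1)] by simp
        have "F x \<in> cdom d" using d c(5) cinv_cmap[OF A c(1,3)] by fastforce
        then show ?thesis using x c t cinv_cmap[OF A c(1,3)] unfolding T_def O1_def W2_def O2_def by auto
      qed
      moreover have "smooth_on T (cmap d' \<circ> F \<circ> cinv c') \<longleftrightarrow> smooth_on T (\<lambda>z. transition d d' ((cmap d \<circ> F \<circ> cinv c) (transition c' c z)))"
        by (rule smooth_on_cong[OF T]) (use * in blast)
      ultimately show ?thesis using T * by blast
    qed
    have "open W'" by (subst open_subopen) (use ex in blast)
    moreover have "smooth_on W' (cmap d' \<circ> F \<circ> cinv c')" by (rule smooth_on_local) (use ex in blast)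
    ultimately show ?thesis by blast
  qed
  ultimately show ?thesis using U unfolding smooth_map_def Let_def by blast
qed

lemma smooth_map_chart:
  assumes "smooth_map A U B F" "c \<in> A" "d \<in> B" "W = cmap c ` {x \<in> U \<inter> cdom c. F x \<in> cdom d}"
  shows "open W" "smooth_on W (cmap d \<circ> F \<circ> cinv c)"
  using assms unfolding smooth_map_def Let_def by blast+

lemma smooth_atlas_real: "smooth_atlas real_atlas"
  by (rule smooth_atlasI) (auto simp: real_atlas_def real_chart_def intro!: exI[of _ id])

lemma cinv_real_chart [simp]: "cinv real_chart = id"
  unfolding cinv_def real_chart_def by (auto simp: fun_eq_iff inv_into_f_f)

lemma real_chart_simps [simp]: "cdom real_chart = UNIV" "cmap real_chart = id" "points real_atlas = UNIV"
  by (auto simp: real_chart_def real_atlas_def points_def)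

text \<open>The single chart of the real line is global and is the identity, so the conditions on
  the target chart collapse.\<close>

lemma smooth_function_iff:
  "smooth_function A V f \<longleftrightarrow> open_subset A V \<and> (\<forall>c\<in>A. smooth_on (cmap c ` (V \<inter> cdom c)) (f \<circ> cinv c))"
proof -
  have e: "{x \<in> V \<inter> cdom c. f x \<in> cdom real_chart} = V \<inter> cdom c" "cmap real_chart \<circ> f \<circ> cinv c = f \<circ> cinv c"
    for c :: "('a, 'b) chart" by auto
  have "f ` V \<subseteq> points {real_chart}" by (simp add: points_def)
  then show ?thesis
    unfolding smooth_map_def Let_def real_atlas_def using e open_subset_openD[of A V] by simp blast
qed

lemma smooth_function_chart_differentiable:
  assumes "smooth_function A V f" "x \<in> V" "c \<in> charts_at A x"
  shows "((f \<circ> cinv c) has_derivative fderiv (f \<circ> cinv c) (cmap c x)) (at (cmap c x))"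
  using assms unfolding smooth_function_iff by (auto simp: charts_at_iff intro!: smooth_on_has_derivative)

lemma smooth_function_local:
  assumes A: "smooth_atlas A" and V: "open_subset A V" and V': "V \<subseteq> cdom c" "c \<in> A"
    and f: "smooth_on (cmap c ` V) (f \<circ> cinv c)"
  shows "smooth_function A V f"
proof (rule smooth_mapI_local[OF A smooth_atlas_real V])
  fix x assume x: "x \<in> V"
  have "V \<inter> cdom c = V" using V' by auto
  then have "x \<in> cdom c \<and> open (cmap c ` V) \<and> cmap c x \<in> cmap c ` V \<and> cmap c ` V \<subseteq> cmap c ` (V \<inter> cdom c) \<and>
       (\<forall>y\<in>cmap c ` V. f (cinv c y) \<in> cdom real_chart) \<and> smooth_on (cmap c ` V) (cmap real_chart \<circ> f \<circ> cinv c)"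
    using x V' f open_subset_openD[OF V V'(2)] by (auto simp: comp_assoc[symmetric])
  then show "\<exists>c\<in>A. \<exists>d\<in>real_atlas. \<exists>W. x \<in> cdom c \<and> open W \<and> cmap c x \<in> W \<and> W \<subseteq> cmap c ` (V \<inter> cdom c) \<and>
       (\<forall>y\<in>W. f (cinv c y) \<in> cdom d) \<and> smooth_on W (cmap d \<circ> f \<circ> cinv c)"
    using V'(2) by (intro bexI[of _ c] bexI[of _ real_chart] exI[of _ "cmap c ` V"]) (auto simp: real_atlas_def)
qed

text \<open>Differentiability at the single point \<open>x\<close>, in every chart around it. This
  is what \<open>differential\<close> requires, and it is easy to verify for lifts and brackets,
  which are given by pointwise formulas.\<close>

definition differentiable_near :: "('m, 'e::euclidean_space) chart set \<Rightarrow> ('m \<Rightarrow> real) \<Rightarrow> 'm \<Rightarrow> bool" where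
  "differentiable_near A f x \<longleftrightarrow> (\<forall>c\<in>charts_at A x. (f \<circ> cinv c) differentiable (at (cmap c x)))"

lemma differential_inner:
  assumes "differentiable_near A f x" "c \<in> charts_at A x"
  shows "differential A f x c \<bullet> u = fderiv (f \<circ> cinv c) (cmap c x) u"
proof -
  have "linear (fderiv (f \<circ> cinv c) (cmap c x))"
    using assms by (auto intro!: linear_fderiv simp: differentiable_near_def)
  then show ?thesis using assms inner_sum_Basis_linear by (simp add: differential_def)
qed

lemma differentiable_near_chartI:
  assumes A: "smooth_atlas A" and c: "c \<in> charts_at A x" and f: "(f \<circ> cinv c) differentiable (at (cmap c x))"
  shows "differentiable_near A f x"
    and "d \<in> charts_at A x \<Longrightarrow> fderiv (f \<circ> cinv d) (cmap d x) u = fderiv (f \<circ> cinv c) (cmap c x) (fderiv (transition d c) (cmap d x) u)"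
proof -
  have *: "((f \<circ> cinv d) has_derivative (\<lambda>u. fderiv (f \<circ> cinv c) (cmap c x) (fderiv (transition d c) (cmap d x) u))) (at (cmap d x))"
    if d: "d \<in> charts_at A x" for d
  proof -
    let ?W = "cmap d ` (cdom d \<inter> cdom c)"
    have t: "transition d c (cmap d x) = cmap c x" using d transition_cmap[OF A] by (simp add: charts_at_iff)
    have W: "open ?W" "cmap d x \<in> ?W" using open_overlap[OF A] c d by (auto simp: charts_at_iff)
    have "((\<lambda>y. (f \<circ> cinv c) (transition d c y)) has_derivative (\<lambda>u. fderiv (f \<circ> cinv c) (cmap c x) (fderiv (transition d c) (cmap d x) u))) (at (cmap d x))"
      by (rule has_derivative_compose[OF transition_has_derivative[OF A d c], of "f \<circ> cinv c", unfolded t, OF has_derivative_fderiv[OF f]])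
    moreover have "(f \<circ> cinv c) (transition d c y) = (f \<circ> cinv d) y" if "y \<in> ?W" for y
      using that c d by (auto simp: charts_at_iff transition_cmap[OF A] cinv_cmap[OF A])
    ultimately show ?thesis using has_derivative_cong_open[OF W, of "\<lambda>y. (f \<circ> cinv c) (transition d c y)" "f \<circ> cinv d"] by blast
  qed
  show "differentiable_near A f x" using * unfolding differentiable_near_def differentiable_def by blast
  show "fderiv (f \<circ> cinv d) (cmap d x) u = fderiv (f \<circ> cinv c) (cmap c x) (fderiv (transition d c) (cmap d x) u)"
    if "d \<in> charts_at A x" using fderiv_eqI[OF *[OF that]] by (rule fun_cong)
qed

lemma differential_in:
  assumes A: "smooth_atlas A" and f: "differentiable_near A f x"
  shows "differential A f x \<in> cotangent_space A x"
proof -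
  have *: "differential A f x c \<bullet> u = differential A f x d \<bullet> fderiv (transition c d) (cmap c x) u"
    if "c \<in> charts_at A x" "d \<in> charts_at A x" for c d u
    using differential_inner[OF f] that differentiable_near_chartI(2)[OF A that(2) _ that(1), of f] f
    by (simp add: differentiable_near_def)
  show ?thesis by (rule cotangent_spaceI[OF _ *]) (simp_all add: differential_def)
qed

lemma smooth_function_differentiable_near:
  "smooth_function A V f \<Longrightarrow> x \<in> V \<Longrightarrow> differentiable_near A f x"
  unfolding differentiable_near_def by (intro ballI differentiableI[OF smooth_function_chart_differentiable])

section \<open>Atlases of bundles and products\<close>

lemma tangent_chart_simps:
  "w \<in> cdom (tangent_chart A c) \<longleftrightarrow> fst w \<in> cdom c \<and> snd w \<in> tangent_space A (fst w)"
  "cmap (tangent_chart A c) w = (cmap c (fst w), snd w c)"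
  unfolding tangent_chart_def by (auto simp: split_beta)

lemma cotangent_chart_simps:
  "w \<in> cdom (cotangent_chart A c) \<longleftrightarrow> fst w \<in> cdom c \<and> snd w \<in> cotangent_space A (fst w)"
  "cmap (cotangent_chart A c) w = (cmap c (fst w), snd w c)"
  unfolding cotangent_chart_def by (auto simp: split_beta)

lemma prod_chart_simps:
  "w \<in> cdom (prod_chart c d) \<longleftrightarrow> fst w \<in> cdom c \<and> snd w \<in> cdom d"
  "cmap (prod_chart c d) w = (cmap c (fst w), cmap d (snd w))"
  unfolding prod_chart_def by (auto simp: map_prod_def split_beta mem_Times_iff)

lemma tangent_chart_image:
  assumes A: "smooth_atlas A" "c \<in> A" and S: "S \<subseteq> cdom c"
  shows "cmap (tangent_chart A c) ` {w. fst w \<in> S \<and> snd w \<in> tangent_space A (fst w)} = cmap c ` S \<times> UNIV"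
proof -
  have "(cmap c x, u) \<in> cmap (tangent_chart A c) ` {w. fst w \<in> S \<and> snd w \<in> tangent_space A (fst w)}" if "x \<in> S" for x u
  proof -
    have "c \<in> charts_at A x" using that A S by (auto simp: charts_at_iff)
    then show ?thesis using that tangent_vec_in[OF A(1)] tangent_vec_at[OF A(1)]
      by (intro image_eqI[of _ _ "(x, tangent_vec A x c u)"]) (simp_all add: tangent_chart_simps)
  qed
  then show ?thesis by (auto simp: tangent_chart_simps)
qed

lemma cotangent_chart_image:
  assumes A: "smooth_atlas A" "c \<in> A" and S: "S \<subseteq> cdom c"
  shows "cmap (cotangent_chart A c) ` {w. fst w \<in> S \<and> snd w \<in> cotangent_space A (fst w)} = cmap c ` S \<times> UNIV"
proof -
  have "(cmap c x, u) \<in> cmap (cotangent_chart A c) ` {w. fst w \<in> S \<and> snd w \<in> cotangent_space A (fst w)}" if "x \<in> S" for x u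
  proof -
    have "c \<in> charts_at A x" using that A S by (auto simp: charts_at_iff)
    then show ?thesis using that cotangent_vec_in[OF A(1)] cotangent_vec_at[OF A(1)]
      by (intro image_eqI[of _ _ "(x, cotangent_vec A x c u)"]) (simp_all add: cotangent_chart_simps)
  qed
  then show ?thesis by (auto simp: cotangent_chart_simps)
qed

lemma tangent_chart_overlap:
  assumes "smooth_atlas A" "c \<in> A" "d \<in> A"
  shows "cmap (tangent_chart A c) ` (cdom (tangent_chart A c) \<inter> cdom (tangent_chart A d)) = cmap c ` (cdom c \<inter> cdom d) \<times> UNIV"
proof -
  have "cdom (tangent_chart A c) \<inter> cdom (tangent_chart A d) = {w. fst w \<in> cdom c \<inter> cdom d \<and> snd w \<in> tangent_space A (fst w)}"
    by (auto simp: tangent_chart_simps)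
  then show ?thesis using tangent_chart_image[OF assms(1,2), of "cdom c \<inter> cdom d"] by simp
qed

lemma cotangent_chart_overlap:
  assumes "smooth_atlas A" "c \<in> A" "d \<in> A"
  shows "cmap (cotangent_chart A c) ` (cdom (cotangent_chart A c) \<inter> cdom (cotangent_chart A d)) = cmap c ` (cdom c \<inter> cdom d) \<times> UNIV"
proof -
  have "cdom (cotangent_chart A c) \<inter> cdom (cotangent_chart A d) = {w. fst w \<in> cdom c \<inter> cdom d \<and> snd w \<in> cotangent_space A (fst w)}"
    by (auto simp: cotangent_chart_simps)
  then show ?thesis using cotangent_chart_image[OF assms(1,2), of "cdom c \<inter> cdom d"] by simp
qed

definition tangent_transition :: "('m, 'e::euclidean_space) chart \<Rightarrow> ('m, 'e) chart \<Rightarrow> 'e \<times> 'e \<Rightarrow> 'e \<times> 'e" where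
  "tangent_transition c d z = (transition c d (fst z), fderiv (transition c d) (fst z) (snd z))"

text \<open>Points are pushed forward while covectors are pulled back, so the fibre part is the
  adjoint of the derivative of the reverse transition \<open>transition d c\<close>, taken at the
  image point.\<close>

definition cotangent_transition :: "('m, 'e::euclidean_space) chart \<Rightarrow> ('m, 'e) chart \<Rightarrow> 'e \<times> 'e \<Rightarrow> 'e \<times> 'e" where
  "cotangent_transition c d z = (transition c d (fst z),
     \<Sum>b\<in>Basis. (snd z \<bullet> fderiv (transition d c) (transition c d (fst z)) b) *\<^sub>R b)"

section \<open>Smoothness of the bundle and product atlases\<close>

lemma smooth_tangent_transition:
  assumes A: "smooth_atlas A" "c \<in> A" "d \<in> A"
  shows "smooth_on (cmap c ` (cdom c \<inter> cdom d) \<times> UNIV) (tangent_transition c d)"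
proof -
  let ?O = "cmap c ` (cdom c \<inter> cdom d)"
  have O: "open ?O" "open (?O \<times> (UNIV :: 'b set))" using open_overlap[OF A] by (simp_all add: open_Times)
  have 1: "smooth_on (?O \<times> (UNIV :: 'b set)) fst" "smooth_on (?O \<times> (UNIV :: 'b set)) snd"
    by (auto intro: smooth_on_bounded_linear bounded_linear_fst bounded_linear_snd)
  have "smooth_on (?O \<times> (UNIV :: 'b set)) (\<lambda>z. transition c d (fst z))"
    by (rule smooth_on_compose[where f=fst and g="transition c d", OF O(2,1) _ 1(1) smooth_transition[OF A]]) auto
  moreover have "smooth_on (?O \<times> (UNIV :: 'b set)) (\<lambda>z. fderiv (transition c d) (fst z) (snd z))"
    by (rule smooth_on_fderiv_apply[OF O(2,1) smooth_transition[OF A] 1(1) _ 1(2)]) auto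
  ultimately show ?thesis
    unfolding tangent_transition_def[abs_def] by (intro smooth_on_Pair[OF O(2)])
qed

lemma tangent_transition_cmap:
  assumes A: "smooth_atlas A" "c \<in> A" "d \<in> A"
    and w: "w \<in> cdom (tangent_chart A c) \<inter> cdom (tangent_chart A d)"
  shows "tangent_transition c d (cmap (tangent_chart A c) w) = cmap (tangent_chart A d) w"
  using w A tangent_space_transform[of "snd w" A "fst w" c d]
  by (simp add: tangent_chart_simps tangent_transition_def charts_at_iff transition_cmap)

lemma smooth_cotangent_transition:
  assumes A: "smooth_atlas A" "c \<in> A" "d \<in> A"
  shows "smooth_on (cmap c ` (cdom c \<inter> cdom d) \<times> UNIV) (cotangent_transition c d)"
proof -
  let ?O = "cmap c ` (cdom c \<inter> cdom d)" and ?O' = "cmap d ` (cdom d \<inter> cdom c)"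
  have O: "open ?O" "open ?O'" "open (?O \<times> (UNIV :: 'b set))" using open_overlap[OF A(1)] A by (simp_all add: open_Times)
  have 1: "smooth_on (?O \<times> (UNIV :: 'b set)) fst" "smooth_on (?O \<times> (UNIV :: 'b set)) snd"
    by (auto intro: smooth_on_bounded_linear bounded_linear_fst bounded_linear_snd)
  have 2: "smooth_on (?O \<times> (UNIV :: 'b set)) (\<lambda>z. transition c d (fst z))"
    by (rule smooth_on_compose[where f=fst and g="transition c d", OF O(3,1) _ 1(1) smooth_transition[OF A]]) auto
  have 3: "(\<lambda>z. transition c d (fst z)) ` (?O \<times> (UNIV :: 'b set)) \<subseteq> ?O'"
    using A by (auto simp: transition_cmap)
  have "smooth_on (?O \<times> (UNIV :: 'b set)) (\<lambda>z. \<Sum>b\<in>Basis. (snd z \<bullet> fderiv (transition d c) (transition c d (fst z)) b) *\<^sub>R b)"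
    by (intro smooth_on_sum[OF O(3)] smooth_on_scaleR[OF O(3)] smooth_on_inner[OF O(3)] smooth_on_const 1
        smooth_on_fderiv_apply[OF O(3,2) smooth_transition[OF A(1,3,2)] 2 3])
  then show ?thesis
    unfolding cotangent_transition_def[abs_def] by (intro smooth_on_Pair[OF O(3)] 2)
qed

lemma cotangent_transition_cmap:
  assumes A: "smooth_atlas A" "c \<in> A" "d \<in> A"
    and w: "w \<in> cdom (cotangent_chart A c) \<inter> cdom (cotangent_chart A d)"
  shows "cotangent_transition c d (cmap (cotangent_chart A c) w) = cmap (cotangent_chart A d) w"
proof -
  have c: "c \<in> charts_at A (fst w)" "d \<in> charts_at A (fst w)" and v: "snd w \<in> cotangent_space A (fst w)"
    using w A by (auto simp: charts_at_iff cotangent_chart_simps)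
  have "snd w d = (\<Sum>b\<in>Basis. (snd w d \<bullet> b) *\<^sub>R b)" by (simp add: euclidean_representation)
  also have "\<dots> = (\<Sum>b\<in>Basis. (snd w c \<bullet> fderiv (transition d c) (cmap d (fst w)) b) *\<^sub>R b)"
    using cotangent_space_transform[OF v c(2,1)] by simp
  finally show ?thesis
    using c A by (simp add: cotangent_chart_simps cotangent_transition_def charts_at_iff transition_cmap)
qed

lemma smooth_atlas_tangent:
  assumes A: "smooth_atlas A" shows "smooth_atlas (tangent_atlas A)"
proof (rule smooth_atlasI)
  fix C assume "C \<in> tangent_atlas A"
  then obtain c where c: "c \<in> A" "C = tangent_chart A c" by (auto simp: tangent_atlas_def)
  show "inj_on (cmap C) (cdom C)"
  proof (rule inj_onI)
    fix w w' assume w: "w \<in> cdom C" "w' \<in> cdom C" and "cmap C w = cmap C w'"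
    then have e: "cmap c (fst w) = cmap c (fst w')" "snd w c = snd w' c" using c by (auto simp: tangent_chart_simps)
    have f: "fst w = fst w'" using cmap_eqD[OF A c(1) _ _ e(1)] w c by (simp add: tangent_chart_simps)
    have "snd w = snd w'"
      using w f e(2) c by (intro tangent_space_eqI[of c A "fst w"]) (auto simp: tangent_chart_simps charts_at_iff)
    with f show "w = w'" by (rule prod_eqI)
  qed
next
  fix C D assume "C \<in> tangent_atlas A" "D \<in> tangent_atlas A"
  then obtain c d where c: "c \<in> A" "C = tangent_chart A c" "d \<in> A" "D = tangent_chart A d" by (auto simp: tangent_atlas_def)
  show "open (cmap C ` (cdom C \<inter> cdom D))"
    using tangent_chart_overlap[OF A c(1,3)] open_overlap[OF A c(1,3)] c by (simp add: open_Times)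
  show "\<exists>T. smooth_on (cmap C ` (cdom C \<inter> cdom D)) T \<and> (\<forall>x\<in>cdom C \<inter> cdom D. T (cmap C x) = cmap D x)"
    using tangent_chart_overlap[OF A c(1,3)] smooth_tangent_transition[OF A c(1,3)] tangent_transition_cmap[OF A c(1,3)] c
    by (intro exI[of _ "tangent_transition c d"]) simp
qed

lemma smooth_atlas_cotangent:
  assumes A: "smooth_atlas A" shows "smooth_atlas (cotangent_atlas A)"
proof (rule smooth_atlasI)
  fix C assume "C \<in> cotangent_atlas A"
  then obtain c where c: "c \<in> A" "C = cotangent_chart A c" by (auto simp: cotangent_atlas_def)
  show "inj_on (cmap C) (cdom C)"
  proof (rule inj_onI)
    fix w w' assume w: "w \<in> cdom C" "w' \<in> cdom C" and "cmap C w = cmap C w'"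
    then have e: "cmap c (fst w) = cmap c (fst w')" "snd w c = snd w' c" using c by (auto simp: cotangent_chart_simps)
    have f: "fst w = fst w'" using cmap_eqD[OF A c(1) _ _ e(1)] w c by (simp add: cotangent_chart_simps)
    have "snd w = snd w'"
      using w f e(2) c by (intro cotangent_space_eqI[of c A "fst w"]) (auto simp: cotangent_chart_simps charts_at_iff)
    with f show "w = w'" by (rule prod_eqI)
  qed
next
  fix C D assume "C \<in> cotangent_atlas A" "D \<in> cotangent_atlas A"
  then obtain c d where c: "c \<in> A" "C = cotangent_chart A c" "d \<in> A" "D = cotangent_chart A d" by (auto simp: cotangent_atlas_def)
  show "open (cmap C ` (cdom C \<inter> cdom D))"
    using cotangent_chart_overlap[OF A c(1,3)] open_overlap[OF A c(1,3)] c by (simp add: open_Times)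
  show "\<exists>T. smooth_on (cmap C ` (cdom C \<inter> cdom D)) T \<and> (\<forall>x\<in>cdom C \<inter> cdom D. T (cmap C x) = cmap D x)"
    using cotangent_chart_overlap[OF A c(1,3)] smooth_cotangent_transition[OF A c(1,3)] cotangent_transition_cmap[OF A c(1,3)] c
    by (intro exI[of _ "cotangent_transition c d"]) simp
qed

lemma prod_chart_image:
  "cmap (prod_chart c d) ` (S \<times> T) = cmap c ` S \<times> cmap d ` T"
  by (auto simp: prod_chart_simps image_iff)

lemma prod_chart_overlap:
  "cmap (prod_chart c d) ` (cdom (prod_chart c d) \<inter> cdom (prod_chart c' d')) = cmap c ` (cdom c \<inter> cdom c') \<times> cmap d ` (cdom d \<inter> cdom d')"
proof -
  have "cdom (prod_chart c d) \<inter> cdom (prod_chart c' d') = (cdom c \<inter> cdom c') \<times> (cdom d \<inter> cdom d')"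
    by (auto simp: prod_chart_def)
  then show ?thesis by (simp add: prod_chart_image)
qed

lemma smooth_atlas_prod:
  assumes A: "smooth_atlas A" and B: "smooth_atlas B" shows "smooth_atlas (prod_atlas A B)"
proof (rule smooth_atlasI)
  fix C assume "C \<in> prod_atlas A B"
  then obtain c d where c: "c \<in> A" "d \<in> B" "C = prod_chart c d" by (auto simp: prod_atlas_def)
  show "inj_on (cmap C) (cdom C)"
  proof (rule inj_onI)
    fix w w' assume "w \<in> cdom C" "w' \<in> cdom C" "cmap C w = cmap C w'"
    then show "w = w'" using cmap_eqD[OF A c(1)] cmap_eqD[OF B c(2)] c(3)
      by (simp add: prod_chart_simps prod_eq_iff)
  qed
next
  fix C D assume "C \<in> prod_atlas A B" "D \<in> prod_atlas A B"
  then obtain c d c' d' where c: "c \<in> A" "d \<in> B" "C = prod_chart c d" "c' \<in> A" "d' \<in> B" "D = prod_chart c' d'"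
    by (auto simp: prod_atlas_def)
  let ?S = "cmap c ` (cdom c \<inter> cdom c')" and ?T = "cmap d ` (cdom d \<inter> cdom d')"
  have O: "open ?S" "open ?T" using open_overlap A B c by blast+
  show "open (cmap C ` (cdom C \<inter> cdom D))" unfolding c prod_chart_overlap using O by (simp add: open_Times)
  have S: "open (?S \<times> ?T)" using O by (simp add: open_Times)
  have "smooth_on (?S \<times> ?T) (\<lambda>z. transition c c' (fst z))" "smooth_on (?S \<times> ?T) (\<lambda>z. transition d d' (snd z))"
    by (rule smooth_on_compose[where f=fst and g="transition c c'", OF S O(1) _ smooth_on_bounded_linear[OF bounded_linear_fst] smooth_transition[OF A c(1,4)]]
        smooth_on_compose[where f=snd and g="transition d d'", OF S O(2) _ smooth_on_bounded_linear[OF bounded_linear_snd] smooth_transition[OF B c(2,5)]]; auto)+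
  then have "smooth_on (?S \<times> ?T) (\<lambda>z. (transition c c' (fst z), transition d d' (snd z)))"
    by (rule smooth_on_Pair[OF S])
  then show "\<exists>T. smooth_on (cmap C ` (cdom C \<inter> cdom D)) T \<and> (\<forall>x\<in>cdom C \<inter> cdom D. T (cmap C x) = cmap D x)"
    unfolding c prod_chart_overlap using c A B
    by (intro exI[of _ "\<lambda>z. (transition c c' (fst z), transition d d' (snd z))"])
      (auto simp: prod_chart_simps transition_cmap)
qed

lemma charts_at_tangent:
  assumes "w \<in> points (tangent_atlas A)" "c \<in> charts_at A (fst w)"
  shows "tangent_chart A c \<in> charts_at (tangent_atlas A) w"
  using assms by (auto simp: charts_at_iff tangent_atlas_def points_def tangent_chart_simps)

lemma charts_at_tangentE:
  assumes "C \<in> charts_at (tangent_atlas A) w"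
  obtains c where "c \<in> charts_at A (fst w)" "C = tangent_chart A c" "snd w \<in> tangent_space A (fst w)"
  using assms by (auto simp: charts_at_iff tangent_atlas_def tangent_chart_simps)

lemma points_tangent_iff:
  "w \<in> points (tangent_atlas A) \<longleftrightarrow> fst w \<in> points A \<and> snd w \<in> tangent_space A (fst w)"
  by (auto simp: points_def tangent_atlas_def tangent_chart_simps)

lemma points_cotangent_iff:
  "w \<in> points (cotangent_atlas A) \<longleftrightarrow> fst w \<in> points A \<and> snd w \<in> cotangent_space A (fst w)"
  by (auto simp: points_def cotangent_atlas_def cotangent_chart_simps)

lemma cinv_tangent_chart:
  assumes A: "smooth_atlas A" and c: "c \<in> A" "y \<in> cmap c ` cdom c"
  shows "cinv (tangent_chart A c) (y, u) = (cinv c y, tangent_vec A (cinv c y) c u)"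
proof -
  obtain x where x: "x \<in> cdom c" "y = cmap c x" using c by auto
  then have cx: "c \<in> charts_at A x" using c by (simp add: charts_at_iff)
  have "cinv (tangent_chart A c) (cmap (tangent_chart A c) (x, tangent_vec A x c u)) = (x, tangent_vec A x c u)"
    using x tangent_vec_in[OF A cx]
    by (intro cinv_cmap[OF smooth_atlas_tangent[OF A]]) (simp_all add: tangent_atlas_def c tangent_chart_simps)
  then show ?thesis using x tangent_vec_at[OF A cx] cinv_cmap[OF A c(1) x(1)] by (simp add: tangent_chart_simps)
qed

section \<open>Poisson structures with constant coefficients in charts\<close>

text \<open>The same form \<open>K\<close> at every point and in every chart: constant coefficients
  throughout the atlas, as for the canonical bracket in canonical coordinates. All later
  computations use the Poisson structures through this property only.\<close>

definition represented_by :: "('m, 'e::euclidean_space) chart set \<Rightarrow> ('m, 'e) bivector \<Rightarrow> ('e \<Rightarrow> 'e \<Rightarrow> real) \<Rightarrow> bool" where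
  "represented_by A P K \<longleftrightarrow> (\<forall>x. \<forall>c\<in>charts_at A x. \<forall>a\<in>cotangent_space A x. \<forall>b\<in>cotangent_space A x. P x a b = K (a c) (b c))"

text \<open>The candidate from which the definite descriptions are shown to be inhabited. The value
  0 elsewhere is the normal form demanded by \<open>bivector_field\<close>; independence of the
  chosen chart is a property of \<open>K\<close> that has to be proved.\<close>

definition bivector_of :: "('m, 'e::euclidean_space) chart set \<Rightarrow> ('e \<Rightarrow> 'e \<Rightarrow> real) \<Rightarrow> ('m, 'e) bivector" where
  "bivector_of A K x a b = (if x \<in> points A \<and> a \<in> cotangent_space A x \<and> b \<in> cotangent_space A x
     then K (a (chart_at A x)) (b (chart_at A x)) else 0)"

lemma represented_byD:
  "represented_by A P K \<Longrightarrow> c \<in> charts_at A x \<Longrightarrow> a \<in> cotangent_space A x \<Longrightarrow> b \<in> cotangent_space A x \<Longrightarrow> P x a b = K (a c) (b c)"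
  unfolding represented_by_def by blast

lemma bivector_field_bivector_of:
  assumes "bounded_bilinear K" "\<And>a b. K a b = - K b a"
  shows "bivector_field A (bivector_of A K)"
  unfolding bivector_field_def
proof (intro conjI allI impI ballI)
  fix x a b assume "x \<in> points A" and a: "a \<in> cotangent_space A x" "b \<in> cotangent_space A x"
  then show "bivector_of A K x a b = - bivector_of A K x b a"
    unfolding bivector_of_def using assms(2)[of "a (chart_at A x)" "b (chart_at A x)"] by presburger
qed (auto simp: bivector_of_def cotangent_space_add cotangent_space_scale
    bounded_bilinear.add_right[OF assms(1)] bounded_bilinear.scaleR_right[OF assms(1)])

text \<open>Because of the value 0 outside the cotangent spaces, uniqueness on covectors is equality
  of functions, as a definite description requires.\<close>

lemma bivector_field_eqI:
  assumes "bivector_field A P" "bivector_field A P'"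
    and "\<And>x a b. x \<in> points A \<Longrightarrow> a \<in> cotangent_space A x \<Longrightarrow> b \<in> cotangent_space A x \<Longrightarrow> P x a b = P' x a b"
  shows "P = P'"
proof (intro ext)
  fix x a b show "P x a b = P' x a b"
  proof (cases "x \<in> points A \<and> a \<in> cotangent_space A x \<and> b \<in> cotangent_space A x")
    case False
    then show ?thesis using assms(1,2) unfolding bivector_field_def by metis
  qed (use assms(3) in blast)
qed

text \<open>Test functions for uniqueness: by \<open>differential_linear_coordinate\<close> every
  covector at a point of the chart is the differential of one of them.\<close>

definition linear_coordinate :: "('m, 'e::euclidean_space) chart \<Rightarrow> 'e \<Rightarrow> 'm \<Rightarrow> real" where
  "linear_coordinate c w x = w \<bullet> cmap c x"

lemma linear_coordinate_chart:
  "smooth_atlas A \<Longrightarrow> c \<in> A \<Longrightarrow> y \<in> cmap c ` cdom c \<Longrightarrow> (linear_coordinate c w \<circ> cinv c) y = w \<bullet> y"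
  by (auto simp: linear_coordinate_def cinv_cmap)

lemma smooth_linear_coordinate:
  assumes A: "smooth_atlas A" "c \<in> A"
  shows "smooth_function A (cdom c) (linear_coordinate c w)"
proof (rule smooth_function_local[OF A(1) open_subset_cdom[OF A] order.refl A(2)])
  show "smooth_on (cmap c ` cdom c) (linear_coordinate c w \<circ> cinv c)"
    by (rule iffD2[OF smooth_on_cong[OF open_cdom[OF A] linear_coordinate_chart[OF A]]
          smooth_on_bounded_linear[OF bounded_linear_inner_right]])
qed

lemma fderiv_linear_coordinate:
  assumes A: "smooth_atlas A" "c \<in> charts_at A x"
  shows "fderiv (linear_coordinate c w \<circ> cinv c) (cmap c x) u = w \<bullet> u"
proof -
  have c: "c \<in> A" "x \<in> cdom c" using A by (auto simp: charts_at_iff)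
  have "fderiv (linear_coordinate c w \<circ> cinv c) (cmap c x) = fderiv (\<lambda>y. w \<bullet> y) (cmap c x)"
    by (rule fderiv_cong[OF open_cdom[OF A(1) c(1)] imageI[OF c(2)] linear_coordinate_chart[OF A(1) c(1)]])
  also have "\<dots> = (\<lambda>y. w \<bullet> y)"
    by (rule fderiv_eqI[OF bounded_linear_imp_has_derivative[OF bounded_linear_inner_right]])
  finally show ?thesis by simp
qed

lemma differential_linear_coordinate:
  assumes A: "smooth_atlas A" "c \<in> charts_at A x" and a: "a \<in> cotangent_space A x"
  shows "differential A (linear_coordinate c (a c)) x = a"
proof (rule cotangent_space_eqI[OF A(2)])
  have c: "c \<in> A" "x \<in> cdom c" using A by (auto simp: charts_at_iff)
  have d: "differentiable_near A (linear_coordinate c (a c)) x"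
    using smooth_function_differentiable_near[OF smooth_linear_coordinate[OF A(1) c(1)] c(2)] .
  show "differential A (linear_coordinate c (a c)) x \<in> cotangent_space A x" using differential_in[OF A(1) d] .
  have "differential A (linear_coordinate c (a c)) x c \<bullet> u = a c \<bullet> u" for u
    using differential_inner[OF d A(2)] fderiv_linear_coordinate[OF A] by simp
  then show "differential A (linear_coordinate c (a c)) x c = a c" using vector_eq_rdot by blast
qed (rule a)

section \<open>The Poisson structure of the momentum phase space\<close>

definition momentum_chart :: "('q, 'e::euclidean_space) chart set \<Rightarrow> ('q, 'e) chart \<Rightarrow> (('q, 'e) phase, real \<times> ('e \<times> 'e)) chart" where
  "momentum_chart A c = prod_chart real_chart (cotangent_chart A c)"

lemma R_TstarQ_eq: "R_TstarQ A = momentum_chart A ` A"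
  unfolding R_TstarQ_def prod_atlas_def real_atlas_def cotangent_atlas_def momentum_chart_def by auto

lemma momentum_chart_simps:
  "w \<in> cdom (momentum_chart A c) \<longleftrightarrow> fst (snd w) \<in> cdom c \<and> snd (snd w) \<in> cotangent_space A (fst (snd w))"
  "cmap (momentum_chart A c) w = (fst w, (cmap c (fst (snd w)), snd (snd w) c))"
  unfolding momentum_chart_def by (auto simp: prod_chart_simps cotangent_chart_simps)

lemma momentum_chart_overlap:
  assumes "smooth_atlas A" "c \<in> A" "d \<in> A"
  shows "cmap (momentum_chart A c) ` (cdom (momentum_chart A c) \<inter> cdom (momentum_chart A d)) = UNIV \<times> (cmap c ` (cdom c \<inter> cdom d) \<times> UNIV)"
  unfolding momentum_chart_def prod_chart_overlap cotangent_chart_overlap[OF assms] by simp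

lemma smooth_atlas_R_TstarQ: "smooth_atlas A \<Longrightarrow> smooth_atlas (R_TstarQ A)"
  unfolding R_TstarQ_def by (intro smooth_atlas_prod smooth_atlas_real smooth_atlas_cotangent)

lemma charts_at_momentumE:
  assumes "C \<in> charts_at (R_TstarQ A) x"
  obtains c where "C = momentum_chart A c" "c \<in> charts_at A (fst (snd x))" "snd (snd x) \<in> cotangent_space A (fst (snd x))"
  using assms by (auto simp: charts_at_iff R_TstarQ_eq momentum_chart_simps)

text \<open>The coefficients of {q^i, p_i} = 1 on covectors with components ordered as (t, (q, p));
  t is a Casimir function.\<close>

definition canonical_form :: "real \<times> ('e::euclidean_space \<times> 'e) \<Rightarrow> real \<times> ('e \<times> 'e) \<Rightarrow> real" where
  "canonical_form a b = fst (snd a) \<bullet> snd (snd b) - snd (snd a) \<bullet> fst (snd b)"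

lemma bounded_bilinear_canonical_form: "bounded_bilinear canonical_form"
proof -
  have "bilinear canonical_form"
    unfolding bilinear_def linear_iff canonical_form_def by (auto simp: algebra_simps inner_add_left inner_add_right)
  then show ?thesis by (simp add: bilinear_conv_bounded_bilinear)
qed

lemma canonical_form_antisym: "canonical_form a b = - canonical_form b a"
  unfolding canonical_form_def by (simp add: inner_commute)

text \<open>The new momenta are linear in the old ones with coefficients depending on q. Hence the
  dp component of a covector transforms like a tangent vector of Q, while the dq component picks up
  a term with the momentum and a second derivative of the transition map.\<close>

lemma momentum_transform:
  assumes A: "smooth_atlas A" and x: "x \<in> cdom (momentum_chart A c)" "x \<in> cdom (momentum_chart A d)"
    and c: "c \<in> A" "d \<in> A" and a: "a \<in> cotangent_space (R_TstarQ A) x"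
  defines "q \<equiv> fst (snd x)" and "\<alpha> \<equiv> a (momentum_chart A c)" and "\<beta> \<equiv> a (momentum_chart A d)"
  shows "snd (snd \<alpha>) = fderiv (transition d c) (cmap d q) (snd (snd \<beta>))"
    and "fst (snd \<alpha>) \<bullet> u = fst (snd \<beta>) \<bullet> fderiv (transition c d) (cmap c q) u +
      snd (snd x) c \<bullet> fderiv (\<lambda>z. fderiv (transition d c) z (snd (snd \<beta>))) (cmap d q) (fderiv (transition c d) (cmap c q) u)"
proof -
  let ?C = "momentum_chart A c" and ?D = "momentum_chart A d" and ?P = "R_TstarQ A"
  define p where "p = snd (snd x) c"
  define y where "y = (fst x, (cmap c q, p))"
  have CD: "?C \<in> ?P" "?D \<in> ?P" using c by (auto simp: R_TstarQ_eq)
  have CDx: "?C \<in> charts_at ?P x" "?D \<in> charts_at ?P x" using CD x by (auto simp: charts_at_iff)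
  have P: "smooth_atlas ?P" using smooth_atlas_R_TstarQ[OF A] .
  have cd: "c \<in> charts_at A q" "d \<in> charts_at A q" using x c by (auto simp: charts_at_iff momentum_chart_simps q_def)
  have y: "cmap ?C x = y" unfolding y_def p_def q_def by (simp add: momentum_chart_simps)
  let ?O = "cmap c ` (cdom c \<inter> cdom d)" and ?W = "cmap ?C ` (cdom ?C \<inter> cdom ?D)"
  have W: "open ?W" "y \<in> ?W" using open_overlap[OF P CD] x y by auto
  have tq: "transition c d (cmap c q) = cmap d q" using cd transition_cmap[OF A] by (simp add: charts_at_iff)
  \<comment> \<open>\<open>k\<close> is the momentum transition paired with the fixed covector
    \<beta>. In \<open>k'\<close> the basis sum of \<open>cotangent_transition\<close> has been
    contracted with \<beta>, which leaves a single derivative in a constant direction that can be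
    differentiated.\<close>
  define k where "k = (\<lambda>z. \<beta> \<bullet> (fst z, cotangent_transition c d (snd z)))"
  define k' where "k' = (\<lambda>z. fst \<beta> * fst z + fst (snd \<beta>) \<bullet> transition c d (fst (snd z))
     + snd (snd z) \<bullet> fderiv (transition d c) (transition c d (fst (snd z))) (snd (snd \<beta>)))"
  have kk: "k z = k' z" if "z \<in> ?W" for z
  proof -
    obtain s r where r: "fst (snd z) = cmap c r" "r \<in> cdom c \<inter> cdom d"
      using \<open>z \<in> ?W\<close> unfolding momentum_chart_overlap[OF A c] by auto
    have rr: "d \<in> charts_at A r" "c \<in> charts_at A r" using r c by (auto simp: charts_at_iff)
    have t: "transition c d (fst (snd z)) = cmap d r" using r transition_cmap[OF A c(1)] by simp
    have "linear (\<lambda>b. snd (snd z) \<bullet> fderiv (transition d c) (cmap d r) b)"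
      using linear_fderiv_transition[OF A rr] by (simp add: linear_iff inner_add_right)
    from inner_sum_Basis_linear[OF this, of "snd (snd \<beta>)"]
    show ?thesis unfolding k_def k'_def cotangent_transition_def t by (simp add: inner_prod_def inner_commute)
  qed
  have d1: "((\<lambda>z. transition c d (fst (snd z))) has_derivative (\<lambda>u. fderiv (transition c d) (cmap c q) (fst (snd u)))) (at y)"
    by (rule has_derivative_compose[of "\<lambda>z. fst (snd z)" "\<lambda>z. fst (snd z)" y UNIV "transition c d" "fderiv (transition c d) (cmap c q)"])
      (auto intro!: derivative_eq_intros simp: y_def transition_has_derivative[OF A cd])
  have O': "open (cmap d ` (cdom d \<inter> cdom c))" using open_overlap[OF A c(2,1)] .
  have d2: "((\<lambda>z. fderiv (transition d c) (transition c d (fst (snd z))) (snd (snd \<beta>))) has_derivative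
     (\<lambda>u. fderiv (\<lambda>z. fderiv (transition d c) z (snd (snd \<beta>))) (cmap d q) (fderiv (transition c d) (cmap c q) (fst (snd u))))) (at y)"
    using has_derivative_fderiv_apply[OF O' _ smooth_transition[OF A c(2,1)] d1 has_derivative_const, of "snd (snd \<beta>)"]
      cd tq linear_0[OF linear_fderiv_transition[OF A cd(2,1)]] by (simp add: y_def charts_at_iff)
  have dk': "(k' has_derivative (\<lambda>u. fst \<beta> * fst u + fst (snd \<beta>) \<bullet> fderiv (transition c d) (cmap c q) (fst (snd u))
     + (p \<bullet> fderiv (\<lambda>z. fderiv (transition d c) z (snd (snd \<beta>))) (cmap d q) (fderiv (transition c d) (cmap c q) (fst (snd u)))
     + snd (snd u) \<bullet> fderiv (transition d c) (cmap d q) (snd (snd \<beta>))))) (at y)"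
    unfolding k'_def
    by (rule has_derivative_eq_rhs, rule has_derivative_add[OF has_derivative_add[OF
          has_derivative_mult_right[OF has_derivative_fst[OF has_derivative_ident]] has_derivative_inner_right[OF d1]]
          has_derivative_inner[OF has_derivative_snd[OF has_derivative_snd[OF has_derivative_ident]] d2]])
      (simp add: y_def tq)
  have "((\<lambda>z. \<beta> \<bullet> transition ?C ?D z) has_derivative (\<lambda>u. \<beta> \<bullet> fderiv (transition ?C ?D) y u)) (at y)"
    using has_derivative_inner_right[OF transition_has_derivative[OF P CDx]] y by simp
  moreover have "\<beta> \<bullet> transition ?C ?D z = k' z" if z: "z \<in> ?W" for z
  proof -
    obtain w where w: "w \<in> cdom ?C \<inter> cdom ?D" "z = cmap ?C w" using z by auto
    have s: "snd w \<in> cdom (cotangent_chart A c) \<inter> cdom (cotangent_chart A d)"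
      using w(1) by (simp add: momentum_chart_def prod_chart_simps)
    have "transition ?C ?D z = (fst z, cotangent_transition c d (snd z))"
      using w transition_cmap[OF P CD(1)] cotangent_transition_cmap[OF A c s]
      by (simp add: momentum_chart_def prod_chart_simps)
    then show ?thesis using kk[OF z] by (simp add: k_def)
  qed
  ultimately have "(k' has_derivative (\<lambda>u. \<beta> \<bullet> fderiv (transition ?C ?D) y u)) (at y)"
    using has_derivative_cong_open[OF W, of "\<lambda>z. \<beta> \<bullet> transition ?C ?D z" k'] by blast
  \<comment> \<open>The derivative through the transition map, which expresses \<alpha> by \<beta>,
    is compared with the explicit one of \<open>k'\<close>.\<close>
  from has_derivative_unique[OF this dk']
  have key: "\<alpha> \<bullet> u = fst \<beta> * fst u + fst (snd \<beta>) \<bullet> fderiv (transition c d) (cmap c q) (fst (snd u))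
     + (p \<bullet> fderiv (\<lambda>z. fderiv (transition d c) z (snd (snd \<beta>))) (cmap d q) (fderiv (transition c d) (cmap c q) (fst (snd u)))
     + snd (snd u) \<bullet> fderiv (transition d c) (cmap d q) (snd (snd \<beta>)))" for u
    using cotangent_space_transform[OF a CDx] y unfolding \<alpha>_def \<beta>_def by metis
  have z0: "fderiv (transition c d) (cmap c q) 0 = 0" using linear_0[OF linear_fderiv_transition[OF A cd]] .
  have "(\<lambda>z. fderiv (transition d c) z (snd (snd \<beta>))) differentiable (at (cmap d q))"
    by (rule smooth_on_differentiable[OF smooth_on_fderiv[OF smooth_transition[OF A c(2,1)]]])
      (use cd in \<open>auto simp: charts_at_iff\<close>)
  then have z1: "fderiv (\<lambda>z. fderiv (transition d c) z (snd (snd \<beta>))) (cmap d q) 0 = 0"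
    using linear_0[OF linear_fderiv] by blast
  have "snd (snd \<alpha>) \<bullet> v = fderiv (transition d c) (cmap d q) (snd (snd \<beta>)) \<bullet> v" for v
    using key[of "(0, (0, v))"] by (simp add: inner_prod_def z0 z1 inner_commute)
  then show "snd (snd \<alpha>) = fderiv (transition d c) (cmap d q) (snd (snd \<beta>))" using vector_eq_rdot by blast
  show "fst (snd \<alpha>) \<bullet> u = fst (snd \<beta>) \<bullet> fderiv (transition c d) (cmap c q) u +
      snd (snd x) c \<bullet> fderiv (\<lambda>z. fderiv (transition d c) z (snd (snd \<beta>))) (cmap d q) (fderiv (transition c d) (cmap c q) u)"
    using key[of "(0, (u, 0))"] by (simp add: inner_prod_def p_def)
qed

text \<open>Invariance under changes of canonical coordinates. The inhomogeneous terms of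
  \<open>momentum_transform\<close> are the momentum applied to a second derivative in the two dp
  components; they cancel in the antisymmetric form because second derivatives are
  symmetric.\<close>

lemma canonical_form_chart:
  assumes A: "smooth_atlas A" and CD: "C \<in> charts_at (R_TstarQ A) x" "D \<in> charts_at (R_TstarQ A) x"
    and a: "a \<in> cotangent_space (R_TstarQ A) x" and b: "b \<in> cotangent_space (R_TstarQ A) x"
  shows "canonical_form (a C) (b C) = canonical_form (a D) (b D)"
proof -
  define q where "q = fst (snd x)"
  obtain c where c: "C = momentum_chart A c" "c \<in> charts_at A q" using CD(1) unfolding q_def by (rule charts_at_momentumE)
  obtain d where d: "D = momentum_chart A d" "d \<in> charts_at A q" using CD(2) unfolding q_def by (rule charts_at_momentumE)
  have x: "x \<in> cdom (momentum_chart A c)" "x \<in> cdom (momentum_chart A d)" "c \<in> A" "d \<in> A"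
    using CD c d by (auto simp: charts_at_iff)
  have inv: "fderiv (transition c d) (cmap c q) (fderiv (transition d c) (cmap d q) u) = u" for u
    using fderiv_transition_inverse[OF A d(2) c(2)] .
  have sym: "fderiv (\<lambda>z. fderiv (transition d c) z u) (cmap d q) v = fderiv (\<lambda>z. fderiv (transition d c) z v) (cmap d q) u" for u v
    using fderiv_symmetric[OF open_overlap[OF A x(4,3)] _ smooth_transition[OF A x(4,3)]] c(2) d(2) by (simp add: charts_at_iff)
  note ta = momentum_transform[OF A x a, folded q_def] and tb = momentum_transform[OF A x b, folded q_def]
  show ?thesis
    unfolding canonical_form_def c(1) d(1) inner_commute[of "snd (snd (a (momentum_chart A c)))"] ta(2) tb(2)
    unfolding ta(1) tb(1) inv sym[of "snd (snd (a (momentum_chart A d)))"] by (simp add: inner_commute)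
qed

text \<open>Covectors are families indexed by charts. The family produced by
  \<open>cotangent_proj\<close> vanishes off the charts around q only because different charts of Q
  give different product charts.\<close>

lemma prod_real_chart_eq_iff: "prod_chart real_chart c = prod_chart real_chart d \<longleftrightarrow> c = d"
proof
  assume *: "prod_chart real_chart c = prod_chart real_chart d"
  have "x \<in> cdom c \<longleftrightarrow> x \<in> cdom d" "cmap c x = cmap d x" for x
    using prod_chart_simps[where w="(0, x)" and c=real_chart and d=c]
      prod_chart_simps[where w="(0, x)" and c=real_chart and d=d] * by simp_all
  then show "c = d" by (intro prod_eqI) auto
qed simp

section \<open>The projection of the cotangent bundle of R x Q that drops the dt component\<close>

lemma charts_at_prod_real:
  "C \<in> charts_at (prod_atlas real_atlas A) w \<longleftrightarrow> (\<exists>c\<in>charts_at A (snd w). C = prod_chart real_chart c)"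
  by (auto simp: charts_at_iff prod_atlas_def real_atlas_def prod_chart_simps)

lemma fderiv_transition_prod_real:
  assumes A: "smooth_atlas A" and c: "c \<in> charts_at A q" "d \<in> charts_at A q"
  shows "fderiv (transition (prod_chart real_chart c) (prod_chart real_chart d)) (t, cmap c q) u = (fst u, fderiv (transition c d) (cmap c q) (snd u))"
proof -
  let ?C = "prod_chart real_chart c" and ?D = "prod_chart real_chart d" and ?B = "prod_atlas real_atlas A"
  have B: "smooth_atlas ?B" using A by (intro smooth_atlas_prod smooth_atlas_real)
  have cd: "c \<in> A" "d \<in> A" "q \<in> cdom c" "q \<in> cdom d" using c by (auto simp: charts_at_iff)
  have CD: "?C \<in> ?B" "?D \<in> ?B" using cd by (auto simp: prod_atlas_def real_atlas_def)
  let ?W = "cmap ?C ` (cdom ?C \<inter> cdom ?D)"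
  have W: "open ?W" "(t, cmap c q) \<in> ?W" using open_overlap[OF B CD] cd by (auto simp: prod_chart_overlap)
  have "fderiv (transition ?C ?D) (t, cmap c q) = fderiv (\<lambda>z. (fst z, transition c d (snd z))) (t, cmap c q)"
  proof (rule fderiv_cong[OF W])
    fix y assume "y \<in> ?W"
    then obtain w where w: "w \<in> cdom ?C \<inter> cdom ?D" "y = cmap ?C w" by auto
    then show "transition ?C ?D y = (fst y, transition c d (snd y))"
      using transition_cmap[OF B CD(1), of w ?D] transition_cmap[OF A cd(1), of "snd w" d] by (simp add: prod_chart_simps)
  qed
  also have "\<dots> = (\<lambda>u. (fst u, fderiv (transition c d) (cmap c q) (snd u)))"
  proof (rule fderiv_eqI, rule has_derivative_Pair)
    show "((\<lambda>z. transition c d (snd z)) has_derivative (\<lambda>u. fderiv (transition c d) (cmap c q) (snd u))) (at (t, cmap c q))"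
      by (rule has_derivative_compose[of snd snd _ UNIV "transition c d"])
        (auto intro!: derivative_eq_intros simp: transition_has_derivative[OF A c])
  qed (auto intro!: derivative_eq_intros)
  finally show ?thesis by simp
qed

lemma cotangent_proj_covector:
  assumes A: "smooth_atlas A" and \<alpha>: "\<alpha> \<in> cotangent_space (prod_atlas real_atlas A) (t, q)"
  shows "(\<lambda>c. snd (\<alpha> (prod_chart real_chart c))) \<in> cotangent_space A q"
proof (rule cotangent_spaceI)
  fix c assume "c \<notin> charts_at A q"
  then have "prod_chart real_chart c \<notin> charts_at (prod_atlas real_atlas A) (t, q)"
    by (auto simp: charts_at_prod_real prod_real_chart_eq_iff)
  then show "snd (\<alpha> (prod_chart real_chart c)) = 0" using cotangent_space_zero[OF \<alpha>] by simp
next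
  fix c d u assume c: "c \<in> charts_at A q" "d \<in> charts_at A q"
  then have "prod_chart real_chart c \<in> charts_at (prod_atlas real_atlas A) (t, q)"
    "prod_chart real_chart d \<in> charts_at (prod_atlas real_atlas A) (t, q)"
    by (auto simp: charts_at_prod_real)
  from cotangent_space_transform[OF \<alpha> this, of "(0, u)"]
  show "snd (\<alpha> (prod_chart real_chart c)) \<bullet> u = snd (\<alpha> (prod_chart real_chart d)) \<bullet> fderiv (transition c d) (cmap c q) u"
    by (simp add: prod_chart_simps fderiv_transition_prod_real[OF A c] inner_prod_def)
qed

lemma cotangent_proj_chart:
  assumes A: "smooth_atlas A" and c: "c \<in> A" and \<xi>: "\<xi> \<in> cdom (cotangent_chart (prod_atlas real_atlas A) (prod_chart real_chart c))"
  defines "z \<equiv> cmap (cotangent_chart (prod_atlas real_atlas A) (prod_chart real_chart c)) \<xi>"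
  shows "cotangent_proj \<xi> \<in> cdom (momentum_chart A c)"
    and "cmap (momentum_chart A c) (cotangent_proj \<xi>) = (fst (fst z), (snd (fst z), snd (snd z)))"
proof -
  obtain t q \<alpha> where [simp]: "\<xi> = ((t, q), \<alpha>)" by (metis prod.collapse)
  show "cotangent_proj \<xi> \<in> cdom (momentum_chart A c)"
    using \<xi> cotangent_proj_covector[OF A, of \<alpha> t q]
    by (simp add: cotangent_proj_def momentum_chart_simps cotangent_chart_simps prod_chart_simps)
  show "cmap (momentum_chart A c) (cotangent_proj \<xi>) = (fst (fst z), (snd (fst z), snd (snd z)))"
    by (simp add: cotangent_proj_def momentum_chart_simps cotangent_chart_simps prod_chart_simps z_def)
qed

lemma smooth_cotangent_proj:
  assumes A: "smooth_atlas A"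
  shows "smooth_map (cotangent_atlas (prod_atlas real_atlas A)) (points (cotangent_atlas (prod_atlas real_atlas A))) (R_TstarQ A) cotangent_proj"
proof -
  let ?B = "prod_atlas real_atlas A" let ?T = "cotangent_atlas ?B"
  have B: "smooth_atlas ?B" using A by (intro smooth_atlas_prod smooth_atlas_real)
  have T: "smooth_atlas ?T" using smooth_atlas_cotangent[OF B] .
  show ?thesis
  proof (rule smooth_mapI_local[OF T smooth_atlas_R_TstarQ[OF A] open_subset_points[OF T]])
    fix \<xi> assume "\<xi> \<in> points ?T"
    then obtain c where c: "c \<in> A" "\<xi> \<in> cdom (cotangent_chart ?B (prod_chart real_chart c))"
      by (auto simp: points_def cotangent_atlas_def prod_atlas_def real_atlas_def)
    let ?K = "cotangent_chart ?B (prod_chart real_chart c)"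
    have K: "?K \<in> ?T" using c by (auto simp: cotangent_atlas_def prod_atlas_def real_atlas_def)
    have *: "(cmap (momentum_chart A c) \<circ> cotangent_proj \<circ> cinv ?K) z = (fst (fst z), (snd (fst z), snd (snd z)))"
      "cotangent_proj (cinv ?K z) \<in> cdom (momentum_chart A c)"
      if "z \<in> cmap ?K ` cdom ?K" for z
      using that cotangent_proj_chart[OF A c(1)] cinv_cmap[OF T K] by auto
    have "smooth_on (cmap ?K ` cdom ?K) (\<lambda>z. (fst (fst z), (snd (fst z), snd (snd z))))"
      by (intro smooth_on_bounded_linear bounded_linear_intros)
    moreover have "smooth_on (cmap ?K ` cdom ?K) (cmap (momentum_chart A c) \<circ> cotangent_proj \<circ> cinv ?K)
      \<longleftrightarrow> smooth_on (cmap ?K ` cdom ?K) (\<lambda>z. (fst (fst z), (snd (fst z), snd (snd z))))"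
      by (rule smooth_on_cong[OF open_cdom[OF T K]], rule *(1))
    ultimately have "smooth_on (cmap ?K ` cdom ?K) (cmap (momentum_chart A c) \<circ> cotangent_proj \<circ> cinv ?K)"
      by (rule iffD2[rotated])
    then show "\<exists>C\<in>?T. \<exists>D\<in>R_TstarQ A. \<exists>W. \<xi> \<in> cdom C \<and> open W \<and> cmap C \<xi> \<in> W \<and> W \<subseteq> cmap C ` (points ?T \<inter> cdom C) \<and>
       (\<forall>y\<in>W. cotangent_proj (cinv C y) \<in> cdom D) \<and> smooth_on W (cmap D \<circ> cotangent_proj \<circ> cinv C)"
      using c K open_cdom[OF T K] *(2)
      by (intro bexI[of _ ?K] bexI[of _ "momentum_chart A c"] exI[of _ "cmap ?K ` cdom ?K"])
        (auto simp: R_TstarQ_eq points_def)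
  qed
qed

text \<open>Pulled-back functions do not depend on the momentum p_t conjugate to t, so the pair (t,
  p_t) contributes nothing to the canonical bracket and only the (q, p) part is left.\<close>

lemma canonical_bracket_cotangent_proj:
  assumes A: "smooth_atlas A" and \<xi>: "\<xi> \<in> points (cotangent_atlas (prod_atlas real_atlas A))"
    and f: "differentiable_near (R_TstarQ A) f (cotangent_proj \<xi>)" and g: "differentiable_near (R_TstarQ A) g (cotangent_proj \<xi>)"
    and C: "C \<in> charts_at (R_TstarQ A) (cotangent_proj \<xi>)"
  shows "bracket (cotangent_atlas (prod_atlas real_atlas A)) (canonical_poisson (prod_atlas real_atlas A)) (f \<circ> cotangent_proj) (g \<circ> cotangent_proj) \<xi>
    = canonical_form (differential (R_TstarQ A) f (cotangent_proj \<xi>) C) (differential (R_TstarQ A) g (cotangent_proj \<xi>) C)"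
proof -
  let ?B = "prod_atlas real_atlas A" let ?T = "cotangent_atlas ?B" and ?P = "R_TstarQ A" and ?x = "cotangent_proj \<xi>"
  have B: "smooth_atlas ?B" using A by (intro smooth_atlas_prod smooth_atlas_real)
  have T: "smooth_atlas ?T" using smooth_atlas_cotangent[OF B] .
  have P: "smooth_atlas ?P" using smooth_atlas_R_TstarQ[OF A] .
  have "chart_at ?B (fst \<xi>) \<in> charts_at ?B (fst \<xi>)" using \<xi> by (intro chart_at_in) (simp add: points_cotangent_iff)
  then obtain c where c: "c \<in> charts_at A (snd (fst \<xi>))" "chart_at ?B (fst \<xi>) = prod_chart real_chart c"
    by (auto simp: charts_at_prod_real)
  define K where "K = cotangent_chart ?B (prod_chart real_chart c)"
  define D where "D = momentum_chart A c"
  have cA: "c \<in> A" using c by (simp add: charts_at_iff)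
  have "snd \<xi> \<in> cotangent_space ?B (fst \<xi>)" using \<xi> by (simp add: points_cotangent_iff)
  then have K: "K \<in> ?T" "\<xi> \<in> cdom K"
    using c unfolding K_def by (auto simp: cotangent_atlas_def prod_atlas_def real_atlas_def cotangent_chart_simps
        charts_at_iff prod_chart_simps)
  have Kx: "K \<in> charts_at ?T \<xi>" using K by (simp add: charts_at_iff)
  have D: "D \<in> ?P" "D \<in> charts_at ?P ?x"
    using cA cotangent_proj_chart(1)[OF A cA K(2)[unfolded K_def]] by (auto simp: D_def R_TstarQ_eq charts_at_iff)
  \<comment> \<open>The projection in coordinates ((t, q), (p_t, p)); it is linear, so derivatives
    pull back through \<open>m\<close> itself.\<close>
  define m where "m = (\<lambda>z :: (real \<times> 'b) \<times> (real \<times> 'b). (fst (fst z), (snd (fst z), snd (snd z))))"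
  have m: "bounded_linear m" unfolding m_def by (intro bounded_linear_intros)
  have mz: "m (cmap K \<zeta>) = cmap D (cotangent_proj \<zeta>)" if "\<zeta> \<in> cdom K" for \<zeta>
    using cotangent_proj_chart(2)[OF A cA] that by (simp add: m_def K_def D_def)
  have d: "differential ?T (h \<circ> cotangent_proj) \<xi> K \<bullet> u = differential ?P h ?x D \<bullet> m u"
    if h: "differentiable_near ?P h ?x" for h u
  proof -
    have hD: "((h \<circ> cinv D) has_derivative fderiv (h \<circ> cinv D) (m (cmap K \<xi>))) (at (m (cmap K \<xi>)))"
      using h D(2) mz[OF K(2)] by (auto simp: differentiable_near_def intro!: has_derivative_fderiv)
    have "((\<lambda>z. (h \<circ> cinv D) (m z)) has_derivative (\<lambda>u. fderiv (h \<circ> cinv D) (m (cmap K \<xi>)) (m u))) (at (cmap K \<xi>))"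
      by (rule has_derivative_compose[OF bounded_linear_imp_has_derivative[OF m] hD])
    moreover have "(h \<circ> cinv D) (m z) = (h \<circ> cotangent_proj \<circ> cinv K) z" if z: "z \<in> cmap K ` cdom K" for z
    proof -
      obtain \<zeta> where \<zeta>: "\<zeta> \<in> cdom K" "z = cmap K \<zeta>" using z by auto
      then have "cinv D (m z) = cotangent_proj \<zeta>"
        using mz cinv_cmap[OF P D(1)] cotangent_proj_chart(1)[OF A cA] by (simp add: D_def K_def)
      then show ?thesis using \<zeta> cinv_cmap[OF T K(1)] by simp
    qed
    ultimately have hd: "((h \<circ> cotangent_proj \<circ> cinv K) has_derivative (\<lambda>u. fderiv (h \<circ> cinv D) (m (cmap K \<xi>)) (m u))) (at (cmap K \<xi>))"
      using has_derivative_cong_open[OF open_cdom[OF T K(1)] imageI[OF K(2)], of "\<lambda>z. (h \<circ> cinv D) (m z)" "h \<circ> cotangent_proj \<circ> cinv K"] by blast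
    have "differentiable_near ?T (h \<circ> cotangent_proj) \<xi>"
      using differentiable_near_chartI(1)[OF T Kx] differentiableI[OF hd] by blast
    from differential_inner[OF this Kx] show ?thesis
      using fderiv_eqI[OF hd] differential_inner[OF h D(2)] mz[OF K(2)] by simp
  qed
  \<comment> \<open>The adjoint of \<open>m\<close>: the components are put back in place, with 0 in
    the slot of p_t.\<close>
  have dK: "differential ?T (h \<circ> cotangent_proj) \<xi> K = ((fst w, fst (snd w)), (0, snd (snd w)))"
    if h: "differentiable_near ?P h ?x" and w: "w = differential ?P h ?x D" for h w
  proof -
    have "differential ?T (h \<circ> cotangent_proj) \<xi> K \<bullet> u = ((fst w, fst (snd w)), (0, snd (snd w))) \<bullet> u" for u
      unfolding d[OF h] w[symmetric] by (simp add: inner_prod_def m_def)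
    then show ?thesis using vector_eq_rdot by blast
  qed
  have "bracket ?T (canonical_poisson ?B) (f \<circ> cotangent_proj) (g \<circ> cotangent_proj) \<xi>
    = canonical_form (differential ?P f ?x D) (differential ?P g ?x D)"
    unfolding bracket_def canonical_poisson_def Let_def c(2) K_def[symmetric] dK[OF f refl] dK[OF g refl]
    by (simp add: canonical_form_def)
  also have "\<dots> = canonical_form (differential ?P f ?x C) (differential ?P g ?x C)"
    by (rule canonical_form_chart[OF A D(2) C differential_in[OF P f] differential_in[OF P g]])
  finally show ?thesis .
qed

text \<open>Existence is the bracket formula for pulled-back functions. Uniqueness holds because the
  projection is onto and linear coordinates realise every pair of covectors, so the morphism
  property prescribes all values of the bivector.\<close>

lemma R_TstarQ_poisson_eq:
  assumes A: "smooth_atlas A"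
  shows "R_TstarQ_poisson A = bivector_of (R_TstarQ A) canonical_form"
  unfolding R_TstarQ_poisson_def
proof (rule the_equality)
  let ?B = "prod_atlas real_atlas A" let ?T = "cotangent_atlas ?B" and ?P = "R_TstarQ A"
  have B: "smooth_atlas ?B" using A by (intro smooth_atlas_prod smooth_atlas_real)
  have P: "smooth_atlas ?P" using smooth_atlas_R_TstarQ[OF A] .
  have bf: "bivector_field ?P (bivector_of ?P canonical_form)"
    by (intro bivector_field_bivector_of bounded_bilinear_canonical_form canonical_form_antisym)
  have "bracket ?T (canonical_poisson ?B) (f \<circ> cotangent_proj) (g \<circ> cotangent_proj) \<xi> = bracket ?P (bivector_of ?P canonical_form) f g (cotangent_proj \<xi>)"
    if "smooth_function ?P V f" "smooth_function ?P V g" "\<xi> \<in> points ?T" "cotangent_proj \<xi> \<in> V" for V f g \<xi>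
  proof -
    have f: "differentiable_near ?P f (cotangent_proj \<xi>)" "differentiable_near ?P g (cotangent_proj \<xi>)"
      using that by (auto intro: smooth_function_differentiable_near)
    have x: "cotangent_proj \<xi> \<in> points ?P" using that unfolding smooth_function_iff open_subset_def by blast
    show ?thesis using canonical_bracket_cotangent_proj[OF A that(3) f chart_at_in[OF x]] x differential_in[OF P] f
      by (simp add: bracket_def bivector_of_def)
  qed
  then show "bivector_field ?P (bivector_of ?P canonical_form) \<and> poisson_morphism ?T (canonical_poisson ?B) ?P (bivector_of ?P canonical_form) cotangent_proj"
    using bf smooth_cotangent_proj[OF A] unfolding poisson_morphism_def by blast
  fix \<Lambda> assume \<Lambda>: "bivector_field ?P \<Lambda> \<and> poisson_morphism ?T (canonical_poisson ?B) ?P \<Lambda> cotangent_proj"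
  show "\<Lambda> = bivector_of ?P canonical_form"
  proof (rule bivector_field_eqI[OF _ bf])
    fix x a b assume x: "x \<in> points ?P" and a: "a \<in> cotangent_space ?P x" and b: "b \<in> cotangent_space ?P x"
    define C where "C = chart_at ?P x"
    have C: "C \<in> charts_at ?P x" unfolding C_def by (rule chart_at_in[OF x])
    obtain t q \<alpha> where x_eq: "x = (t, (q, \<alpha>))" by (metis prod.collapse)
    obtain c where "c \<in> charts_at A (fst (snd x))" "snd (snd x) \<in> cotangent_space A (fst (snd x))"
      using C by (rule charts_at_momentumE)
    then have c: "c \<in> charts_at A q" "\<alpha> \<in> cotangent_space A q" by (simp_all add: x_eq)
    have Bc: "prod_chart real_chart c \<in> charts_at ?B (t, q)" using c by (auto simp: charts_at_prod_real)
    \<comment> \<open>A preimage of \<open>x\<close> under the projection; the choice 0 for the dt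
      component is arbitrary.\<close>
    define \<xi> where "\<xi> = ((t, q), cotangent_vec ?B (t, q) (prod_chart real_chart c) (0, \<alpha> c))"
    have cv: "cotangent_vec ?B (t, q) (prod_chart real_chart c) (0, \<alpha> c) \<in> cotangent_space ?B (t, q)"
      using cotangent_vec_in[OF B Bc] .
    have "(\<lambda>d. snd (cotangent_vec ?B (t, q) (prod_chart real_chart c) (0, \<alpha> c) (prod_chart real_chart d))) = \<alpha>"
      by (rule cotangent_space_eqI[OF c(1) cotangent_proj_covector[OF A cv] c(2)]) (simp add: cotangent_vec_at[OF B Bc])
    then have F: "cotangent_proj \<xi> = x" by (simp add: cotangent_proj_def \<xi>_def x_eq)
    have "(t, q) \<in> points ?B" using Bc by (auto simp: points_def charts_at_iff)
    then have \<xi>: "\<xi> \<in> points ?T" using cv by (simp add: \<xi>_def points_cotangent_iff)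
    have CP: "C \<in> ?P" "x \<in> cdom C" using C by (auto simp: charts_at_iff)
    note s = smooth_linear_coordinate[OF P CP(1)]
    have dn: "differentiable_near ?P (linear_coordinate C w) x" for w
      by (rule smooth_function_differentiable_near[OF s CP(2)])
    have "\<Lambda> x a b = bracket ?P \<Lambda> (linear_coordinate C (a C)) (linear_coordinate C (b C)) (cotangent_proj \<xi>)"
      unfolding bracket_def F using differential_linear_coordinate[OF P C] a b by simp
    also have "\<dots> = bracket ?T (canonical_poisson ?B) (linear_coordinate C (a C) \<circ> cotangent_proj) (linear_coordinate C (b C) \<circ> cotangent_proj) \<xi>"
      using \<Lambda> s[of "a C"] s[of "b C"] \<xi> CP(2) F unfolding poisson_morphism_def by metis
    also have "\<dots> = canonical_form (a C) (b C)"
      using canonical_bracket_cotangent_proj[OF A \<xi>, unfolded F, OF dn dn C, of "a C" "b C"]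
        differential_linear_coordinate[OF P C] a b by simp
    finally show "\<Lambda> x a b = bivector_of ?P canonical_form x a b" using x a b by (simp add: bivector_of_def C_def)
  qed (use \<Lambda> in blast)
qed

lemma R_TstarQ_poisson_represented:
  assumes A: "smooth_atlas A" shows "represented_by (R_TstarQ A) (R_TstarQ_poisson A) canonical_form"
  unfolding represented_by_def R_TstarQ_poisson_eq[OF A]
proof (intro allI ballI)
  fix x C a b assume C: "C \<in> charts_at (R_TstarQ A) x" and ab: "a \<in> cotangent_space (R_TstarQ A) x" "b \<in> cotangent_space (R_TstarQ A) x"
  have x: "x \<in> points (R_TstarQ A)" using C by (auto simp: charts_at_iff points_def)
  show "bivector_of (R_TstarQ A) canonical_form x a b = canonical_form (a C) (b C)"
    using x ab canonical_form_chart[OF A chart_at_in[OF x] C ab] by (simp add: bivector_of_def)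
qed

section \<open>The tangent Poisson structure\<close>

lemma complete_lift_chart:
  assumes A: "smooth_atlas A" and f: "differentiable_near A f x" and c: "c \<in> charts_at A x" and v: "v \<in> tangent_space A x"
  shows "complete_lift A f (x, v) = fderiv (f \<circ> cinv c) (cmap c x) (v c)"
  unfolding complete_lift_def using pairing_chart[OF A c differential_in[OF A f] v] differential_inner[OF f c] by simp

text \<open>In the tangent chart the complete lift reads (y, u) \<mapsto> Df(y)u and the vertical
  lift (y, u) \<mapsto> f(y). The second derivative in the first formula is the product rule
  \<open>has_derivative_fderiv_apply\<close>.\<close>

lemma
  assumes A: "smooth_atlas A" and f: "smooth_function A V f" and w: "w \<in> points (tangent_atlas A)" "fst w \<in> V"
    and c: "c \<in> charts_at A (fst w)"
  shows differentiable_complete_lift: "differentiable_near (tangent_atlas A) (complete_lift A f) w"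
    and differential_complete_lift: "differential (tangent_atlas A) (complete_lift A f) w (tangent_chart A c) \<bullet> u =
        fderiv (\<lambda>z. fderiv (f \<circ> cinv c) z (snd w c)) (cmap c (fst w)) (fst u) + fderiv (f \<circ> cinv c) (cmap c (fst w)) (snd u)"
    and differentiable_vertical_lift: "differentiable_near (tangent_atlas A) (vertical_lift f) w"
    and differential_vertical_lift: "differential (tangent_atlas A) (vertical_lift f) w (tangent_chart A c) \<bullet> u =
        fderiv (f \<circ> cinv c) (cmap c (fst w)) (fst u)"
proof -
  let ?T = "tangent_atlas A" and ?C = "tangent_chart A c" and ?f = "f \<circ> cinv c" and ?x = "cmap c (fst w)"
  have T: "smooth_atlas ?T" using smooth_atlas_tangent[OF A] .
  have cA: "c \<in> A" "fst w \<in> cdom c" using c by (auto simp: charts_at_iff)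
  have C: "?C \<in> charts_at ?T w" using charts_at_tangent[OF w(1) c] .
  define O1 where "O1 = cmap c ` (V \<inter> cdom c)"
  have O: "open O1" "?x \<in> O1" and fs: "smooth_on O1 ?f"
    using f cA w unfolding O1_def smooth_function_iff by (auto intro: open_subset_openD)
  have O2: "open (O1 \<times> (UNIV :: 'b set))" "cmap ?C w \<in> O1 \<times> UNIV" using O by (auto simp: open_Times tangent_chart_simps)
  have inv: "\<exists>x\<in>V. y = cmap c x \<and> c \<in> charts_at A x \<and> cinv ?C (y, u) = (x, tangent_vec A x c u)" if "y \<in> O1" for y u
  proof -
    obtain x where x: "x \<in> V \<inter> cdom c" "y = cmap c x" using \<open>y \<in> O1\<close> unfolding O1_def by auto
    then show ?thesis using cinv_tangent_chart[OF A cA(1), of y u] cinv_cmap[OF A cA(1)] cA by (auto simp: charts_at_iff)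
  qed
  have cl: "(complete_lift A f \<circ> cinv ?C) z = fderiv ?f (fst z) (snd z)" if "z \<in> O1 \<times> UNIV" for z
  proof -
    obtain y u where z: "z = (y, u)" by (cases z)
    then have "y \<in> O1" using that by simp
    from inv[OF this, of u] obtain x where x: "x \<in> V" "y = cmap c x" "c \<in> charts_at A x"
      "cinv ?C (y, u) = (x, tangent_vec A x c u)" by blast
    then show ?thesis using complete_lift_chart[OF A smooth_function_differentiable_near[OF f x(1)] x(3) tangent_vec_in[OF A x(3)]]
        tangent_vec_at[OF A x(3)] unfolding z by simp
  qed
  have vl: "(vertical_lift f \<circ> cinv ?C) z = ?f (fst z)" if "z \<in> O1 \<times> UNIV" for z
  proof -
    obtain y u where z: "z = (y, u)" by (cases z)
    then have "y \<in> O1" using that by simp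
    from inv[OF this, of u] obtain x where "x \<in> V" "y = cmap c x" "c \<in> charts_at A x"
      "cinv ?C (y, u) = (x, tangent_vec A x c u)" by blast
    then show ?thesis using cinv_cmap[OF A cA(1)] unfolding z by (simp add: vertical_lift_def charts_at_iff)
  qed
  have z: "fst (cmap ?C w) = ?x" "snd (cmap ?C w) = snd w c" by (simp_all add: tangent_chart_simps)
  have "((\<lambda>z. fderiv ?f (fst z) (snd z)) has_derivative
     (\<lambda>u. fderiv (\<lambda>z. fderiv ?f z (snd w c)) ?x (fst u) + fderiv ?f ?x (snd u))) (at (cmap ?C w))"
    using has_derivative_fderiv_apply[OF O(1) _ fs has_derivative_fst[OF has_derivative_ident] has_derivative_snd[OF has_derivative_ident], of "cmap ?C w"]
      O(2) unfolding z by blast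
  then have dc: "((complete_lift A f \<circ> cinv ?C) has_derivative
     (\<lambda>u. fderiv (\<lambda>z. fderiv ?f z (snd w c)) ?x (fst u) + fderiv ?f ?x (snd u))) (at (cmap ?C w))"
    using has_derivative_cong_open[OF O2 cl] by (rule iffD2[rotated])
  have "((\<lambda>z. ?f (fst z)) has_derivative (\<lambda>u. fderiv ?f ?x (fst u))) (at (cmap ?C w))"
    by (rule has_derivative_compose[OF has_derivative_fst[OF has_derivative_ident], of ?f])
      (simp only: z smooth_on_has_derivative[OF fs O(2)])
  then have dv: "((vertical_lift f \<circ> cinv ?C) has_derivative (\<lambda>u. fderiv ?f ?x (fst u))) (at (cmap ?C w))"
    using has_derivative_cong_open[OF O2 vl] by (rule iffD2[rotated])
  show 1: "differentiable_near ?T (complete_lift A f) w"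
    using differentiable_near_chartI(1)[OF T C differentiableI[OF dc]] .
  show 2: "differentiable_near ?T (vertical_lift f) w"
    using differentiable_near_chartI(1)[OF T C differentiableI[OF dv]] .
  show "differential ?T (complete_lift A f) w ?C \<bullet> u = fderiv (\<lambda>z. fderiv ?f z (snd w c)) ?x (fst u) + fderiv ?f ?x (snd u)"
    using differential_inner[OF 1 C] fderiv_eqI[OF dc] by simp
  show "differential ?T (vertical_lift f) w ?C \<bullet> u = fderiv ?f ?x (fst u)"
    using differential_inner[OF 2 C] fderiv_eqI[OF dv] by simp
qed

text \<open>The tangent lift of a constant bivector: base components are paired with fibre
  components, as in {q^i, pdot_i} = {qdot^i, p_i} = 1.\<close>

definition tangent_form :: "('e \<Rightarrow> 'e \<Rightarrow> real) \<Rightarrow> 'e \<times> 'e \<Rightarrow> 'e \<times> 'e \<Rightarrow> real" where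
  "tangent_form K a b = K (fst a) (snd b) + K (snd a) (fst b)"

lemma bounded_bilinear_tangent_form:
  fixes K :: "'e::euclidean_space \<Rightarrow> 'e \<Rightarrow> real"
  assumes "bounded_bilinear K" shows "bounded_bilinear (tangent_form K)"
proof -
  have "bilinear (tangent_form K)"
    unfolding bilinear_def linear_iff tangent_form_def
    by (simp add: bounded_bilinear.add_left[OF assms] bounded_bilinear.add_right[OF assms]
        bounded_bilinear.scaleR_left[OF assms] bounded_bilinear.scaleR_right[OF assms] algebra_simps)
  then show ?thesis by (simp add: bilinear_conv_bounded_bilinear)
qed

text \<open>The predicate under the definite description in \<open>tangent_poisson\<close>, named so
  that existence and uniqueness can be stated.\<close>

definition tangent_relations :: "('m, 'e::euclidean_space) chart set \<Rightarrow> ('m, 'e) bivector \<Rightarrow> ('m \<times> ('m, 'e) comps, 'e \<times> 'e) bivector \<Rightarrow> bool" where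
  "tangent_relations A P \<Lambda> \<longleftrightarrow> bivector_field (tangent_atlas A) \<Lambda> \<and>
     (\<forall>V f g. smooth_function A V f \<and> smooth_function A V g \<longrightarrow>
        (\<forall>w\<in>points (tangent_atlas A). fst w \<in> V \<longrightarrow>
           bracket (tangent_atlas A) \<Lambda> (complete_lift A f) (complete_lift A g) w
             = complete_lift A (bracket A P f g) w \<and>
           bracket (tangent_atlas A) \<Lambda> (complete_lift A f) (vertical_lift g) w
             = vertical_lift (bracket A P f g) w \<and>
           bracket (tangent_atlas A) \<Lambda> (vertical_lift f) (vertical_lift g) w = 0))"

lemma bracket_chart:
  assumes A: "smooth_atlas A" and P: "represented_by A P K" and c: "c \<in> A"
    and f: "smooth_function A V f" "smooth_function A V g" and y: "y \<in> cmap c ` (V \<inter> cdom c)"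
  shows "(bracket A P f g \<circ> cinv c) y =
    K (\<Sum>b\<in>Basis. fderiv (f \<circ> cinv c) y b *\<^sub>R b) (\<Sum>b\<in>Basis. fderiv (g \<circ> cinv c) y b *\<^sub>R b)"
proof -
  obtain x where x: "x \<in> V" "x \<in> cdom c" "y = cmap c x" using y by auto
  have cx: "c \<in> charts_at A x" using x c by (simp add: charts_at_iff)
  have "bracket A P f g x = K (differential A f x c) (differential A g x c)"
    unfolding bracket_def
    by (rule represented_byD[OF P cx differential_in[OF A smooth_function_differentiable_near[OF f(1) x(1)]]
          differential_in[OF A smooth_function_differentiable_near[OF f(2) x(1)]]])
  then show ?thesis using cinv_cmap[OF A c x(2)] x(3) cx by (simp add: differential_def)
qed

text \<open>Symmetry of second derivatives exchanges the direction of differentiation with the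
  gradient index. The result is the gradient of a directional derivative, the form that occurs in
  the differential of a complete lift.\<close>

lemma has_derivative_gradient:
  fixes f :: "'e::euclidean_space \<Rightarrow> real"
  assumes "open S" "x \<in> S" "smooth_on S f"
  shows "((\<lambda>y. \<Sum>b\<in>Basis. fderiv f y b *\<^sub>R b) has_derivative (\<lambda>u. \<Sum>b\<in>Basis. fderiv (\<lambda>z. fderiv f z u) x b *\<^sub>R b)) (at x)"
proof -
  have "((\<lambda>y. \<Sum>b\<in>Basis. fderiv f y b *\<^sub>R b) has_derivative (\<lambda>u. \<Sum>b\<in>Basis. fderiv (\<lambda>z. fderiv f z b) x u *\<^sub>R b)) (at x)"
    by (intro has_derivative_sum has_derivative_scaleR_left smooth_on_has_derivative[OF smooth_on_fderiv[OF assms(3)] assms(2)])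
  then show ?thesis using fderiv_symmetric[OF assms] by simp
qed

text \<open>Existence. With \<open>G\<close> the gradient and \<open>H\<close> the gradient of the
  derivative along the velocity, complete lifts have differential (H, G) and vertical lifts (G, 0).
  The relation for two complete lifts is then the product rule for \<open>K (G f) (G g)\<close>, in
  which \<open>K\<close>, being constant, is not differentiated.\<close>

lemma tangent_relations_bivector_of:
  assumes A: "smooth_atlas A" and P: "represented_by A P K" and K: "bounded_bilinear K" "\<And>a b. K a b = - K b a"
  shows "tangent_relations A P (bivector_of (tangent_atlas A) (tangent_form K))"
proof -
  let ?T = "tangent_atlas A" and ?\<Lambda> = "bivector_of (tangent_atlas A) (tangent_form K)"
  have T: "smooth_atlas ?T" using smooth_atlas_tangent[OF A] .
  have anti: "tangent_form K a b = - tangent_form K b a" for a b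
    unfolding tangent_form_def using K(2)[of "fst a" "snd b"] K(2)[of "snd a" "fst b"] by linarith
  have bf: "bivector_field ?T ?\<Lambda>"
    by (rule bivector_field_bivector_of[OF bounded_bilinear_tangent_form[OF K(1)] anti])
  have "bracket ?T ?\<Lambda> (complete_lift A f) (complete_lift A g) w = complete_lift A (bracket A P f g) w \<and>
        bracket ?T ?\<Lambda> (complete_lift A f) (vertical_lift g) w = vertical_lift (bracket A P f g) w \<and>
        bracket ?T ?\<Lambda> (vertical_lift f) (vertical_lift g) w = 0"
    if f: "smooth_function A V f" and g: "smooth_function A V g" and w: "w \<in> points ?T" "fst w \<in> V" for V f g w
  proof -
    obtain c where c: "c \<in> charts_at A (fst w)" "chart_at ?T w = tangent_chart A c" and v: "snd w \<in> tangent_space A (fst w)"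
      using chart_at_in[OF w(1)] by (rule charts_at_tangentE)
    let ?x = "cmap c (fst w)" and ?C = "tangent_chart A c"
    have cA: "c \<in> A" "fst w \<in> cdom c" using c by (auto simp: charts_at_iff)
    define S where "S = cmap c ` (V \<inter> cdom c)"
    have S: "open S" "?x \<in> S" using f cA w unfolding S_def smooth_function_iff by (auto intro: open_subset_openD)
    define G where "G h = (\<Sum>b\<in>Basis. fderiv (h \<circ> cinv c) ?x b *\<^sub>R b)" for h
    define H where "H h = (\<Sum>b\<in>Basis. fderiv (\<lambda>z. fderiv (h \<circ> cinv c) z (snd w c)) ?x b *\<^sub>R b)" for h
    have sm: "smooth_on S (h \<circ> cinv c)" if "smooth_function A V h" for h
      using that cA unfolding S_def smooth_function_iff by blast
    have lin: "linear (fderiv (h \<circ> cinv c) ?x)" "linear (fderiv (\<lambda>z. fderiv (h \<circ> cinv c) z (snd w c)) ?x)"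
      if "smooth_function A V h" for h
      using smooth_on_linear_fderiv[OF sm[OF that] S(2)] smooth_on_linear_fderiv[OF smooth_on_fderiv[OF sm[OF that]] S(2)] .
    have dc: "differential ?T (complete_lift A h) w ?C = (H h, G h)" if h: "smooth_function A V h" for h
    proof -
      have "differential ?T (complete_lift A h) w ?C \<bullet> u = (H h, G h) \<bullet> u" for u
        unfolding differential_complete_lift[OF A h w c(1)] unfolding inner_prod_def fst_conv snd_conv H_def G_def
          inner_sum_Basis_linear[OF lin(1)[OF h]] inner_sum_Basis_linear[OF lin(2)[OF h]] ..
      then show ?thesis using vector_eq_rdot by blast
    qed
    have dv: "differential ?T (vertical_lift h) w ?C = (G h, 0)" if h: "smooth_function A V h" for h
    proof -
      have "differential ?T (vertical_lift h) w ?C \<bullet> u = (G h, 0) \<bullet> u" for u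
        unfolding differential_vertical_lift[OF A h w c(1)] unfolding inner_prod_def fst_conv snd_conv G_def
          inner_sum_Basis_linear[OF lin(1)[OF h]] by simp
      then show ?thesis using vector_eq_rdot by blast
    qed
    have br: "bracket ?T ?\<Lambda> h k w = tangent_form K (differential ?T h w ?C) (differential ?T k w ?C)"
      if "differentiable_near ?T h w" "differentiable_near ?T k w" for h k
      using differential_in[OF T] that w(1) unfolding bracket_def bivector_of_def c(2) by simp
    have near: "differentiable_near ?T (complete_lift A h) w" "differentiable_near ?T (vertical_lift h) w"
      if "smooth_function A V h" for h
      using differentiable_complete_lift[OF A that w c(1)] differentiable_vertical_lift[OF A that w c(1)] .
    note bc = bracket_chart[OF A P cA(1) f g, folded S_def]
    have K0: "K a 0 = 0" "K 0 a = 0" for a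
      using bounded_bilinear.zero_right[OF K(1)] bounded_bilinear.zero_left[OF K(1)] .
    have "vertical_lift (bracket A P f g) w = K (G f) (G g)"
      using bc[OF S(2)] cinv_cmap[OF A cA] by (simp add: vertical_lift_def G_def)
    moreover have "complete_lift A (bracket A P f g) w = K (G f) (H g) + K (H f) (G g)"
    proof -
      have "((\<lambda>y. K (\<Sum>b\<in>Basis. fderiv (f \<circ> cinv c) y b *\<^sub>R b) (\<Sum>b\<in>Basis. fderiv (g \<circ> cinv c) y b *\<^sub>R b)) has_derivative
        (\<lambda>u. K (G f) (\<Sum>b\<in>Basis. fderiv (\<lambda>z. fderiv (g \<circ> cinv c) z u) ?x b *\<^sub>R b) + K (\<Sum>b\<in>Basis. fderiv (\<lambda>z. fderiv (f \<circ> cinv c) z u) ?x b *\<^sub>R b) (G g))) (at ?x)"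
        unfolding G_def
        by (rule bounded_bilinear.FDERIV[OF K(1) has_derivative_gradient[OF S sm[OF f]] has_derivative_gradient[OF S sm[OF g]]])
      then have d: "((bracket A P f g \<circ> cinv c) has_derivative
        (\<lambda>u. K (G f) (\<Sum>b\<in>Basis. fderiv (\<lambda>z. fderiv (g \<circ> cinv c) z u) ?x b *\<^sub>R b) + K (\<Sum>b\<in>Basis. fderiv (\<lambda>z. fderiv (f \<circ> cinv c) z u) ?x b *\<^sub>R b) (G g))) (at ?x)"
        using has_derivative_cong_open[OF S bc] by (rule iffD2[rotated])
      have "differentiable_near A (bracket A P f g) (fst w)"
        using differentiable_near_chartI(1)[OF A c(1) differentiableI[OF d]] .
      from complete_lift_chart[OF A this c(1) v] show ?thesis
        unfolding fderiv_eqI[OF d] H_def by simp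
    qed
    ultimately show ?thesis
      using br[OF near(1)[OF f] near(1)[OF g]] br[OF near(1)[OF f] near(2)[OF g]] br[OF near(2)[OF f] near(2)[OF g]]
      unfolding dc[OF f] dc[OF g] dv[OF f] dv[OF g] tangent_form_def by (simp add: K0)
  qed
  then show ?thesis using bf unfolding tangent_relations_def by blast
qed

lemma bivector_field_add:
  assumes B: "bivector_field A P" and x: "x \<in> points A"
    and a: "a \<in> cotangent_space A x" "a' \<in> cotangent_space A x" and b: "b \<in> cotangent_space A x"
  shows "P x b (\<lambda>c. a c + a' c) = P x b a + P x b a'" "P x (\<lambda>c. a c + a' c) b = P x a b + P x a' b"
    "P x a b = - P x b a"
proof -
  have r: "P x e (\<lambda>c. a c + a' c) = P x e a + P x e a'" and s: "P x e e' = - P x e' e"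
    if "e \<in> cotangent_space A x" "e' \<in> cotangent_space A x" for e e'
    using B x a that unfolding bivector_field_def by blast+
  show "P x b (\<lambda>c. a c + a' c) = P x b a + P x b a'" using r[OF b b] .
  show "P x a b = - P x b a" using s[OF a(1) b] .
  show "P x (\<lambda>c. a c + a' c) b = P x a b + P x a' b"
    using s[OF cotangent_space_add[OF a] b] r[OF b b] s[OF a(1) b] s[OF a(2) b] by linarith
qed

text \<open>Uniqueness. The differentials of the complete and vertical lifts of linear coordinates
  are (0, u) and (u, 0), which span, and the relations prescribe \<Lambda> on them. As
  \<open>C\<close> is any tangent chart around \<open>w\<close>, the form is at the same time seen
  to be chart independent.\<close>

lemma tangent_relations_chart:
  assumes A: "smooth_atlas A" and P: "represented_by A P K" and K: "bounded_bilinear K" "\<And>a b. K a b = - K b a"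
    and \<Lambda>: "tangent_relations A P \<Lambda>" and C: "C \<in> charts_at (tangent_atlas A) w"
    and a: "a \<in> cotangent_space (tangent_atlas A) w" and b: "b \<in> cotangent_space (tangent_atlas A) w"
  shows "\<Lambda> w a b = tangent_form K (a C) (b C)"
proof -
  let ?T = "tangent_atlas A"
  have T: "smooth_atlas ?T" using smooth_atlas_tangent[OF A] .
  have w: "w \<in> points ?T" using C by (auto simp: charts_at_iff points_def)
  obtain c where c: "c \<in> charts_at A (fst w)" "C = tangent_chart A c" and v: "snd w \<in> tangent_space A (fst w)"
    using C by (rule charts_at_tangentE)
  have cA: "c \<in> A" "fst w \<in> cdom c" using c by (auto simp: charts_at_iff)
  let ?x = "cmap c (fst w)"
  let ?c = "\<lambda>u. complete_lift A (linear_coordinate c u)" and ?v = "\<lambda>u. vertical_lift (linear_coordinate c u)"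
  note s = smooth_linear_coordinate[OF A cA(1)]
  define dc where "dc u = differential ?T (?c u) w" for u
  define dv where "dv u = differential ?T (?v u) w" for u
  have in_space: "dc u \<in> cotangent_space ?T w" "dv u \<in> cotangent_space ?T w" for u
    unfolding dc_def dv_def
    by (rule differential_in[OF T differentiable_complete_lift[OF A s w cA(2) c(1)]]
        differential_in[OF T differentiable_vertical_lift[OF A s w cA(2) c(1)]])+
  have lc: "fderiv (linear_coordinate c u \<circ> cinv c) ?x z = u \<bullet> z" for u z
    using fderiv_linear_coordinate[OF A c(1)] .
  have lc2: "fderiv (\<lambda>z. fderiv (linear_coordinate c u \<circ> cinv c) z (snd w c)) ?x z = 0" for u z
  proof -
    have "fderiv (\<lambda>z. fderiv (linear_coordinate c u \<circ> cinv c) z (snd w c)) ?x = fderiv (\<lambda>z. u \<bullet> snd w c) ?x"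
    proof (rule fderiv_cong[OF open_cdom[OF A cA(1)] imageI[OF cA(2)]])
      fix y assume "y \<in> cmap c ` cdom c"
      then obtain x where "x \<in> cdom c" "y = cmap c x" by auto
      then show "fderiv (linear_coordinate c u \<circ> cinv c) y (snd w c) = u \<bullet> snd w c"
        using fderiv_linear_coordinate[OF A, of c x] cA(1) by (simp add: charts_at_iff)
    qed
    then show ?thesis by simp
  qed
  have dcC: "dc u C = (0, u)" for u
  proof -
    have "dc u C \<bullet> z = (0, u) \<bullet> z" for z
      unfolding dc_def c(2) differential_complete_lift[OF A s w cA(2) c(1)] lc lc2 by (simp add: inner_prod_def)
    then show ?thesis using vector_eq_rdot by blast
  qed
  have dvC: "dv u C = (u, 0)" for u
  proof -
    have "dv u C \<bullet> z = (u, 0) \<bullet> z" for z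
      unfolding dv_def c(2) differential_vertical_lift[OF A s w cA(2) c(1)] lc by (simp add: inner_prod_def)
    then show ?thesis using vector_eq_rdot by blast
  qed
  have split: "e = (\<lambda>D. dc (snd (e C)) D + dv (fst (e C)) D)" if "e \<in> cotangent_space ?T w" for e
    by (rule cotangent_space_eqI[OF C that cotangent_space_add[OF in_space]]) (simp add: dcC dvC)
  have rel: "\<Lambda> w (dc u) (dc z) = complete_lift A (bracket A P (linear_coordinate c u) (linear_coordinate c z)) w \<and>
      \<Lambda> w (dc u) (dv z) = vertical_lift (bracket A P (linear_coordinate c u) (linear_coordinate c z)) w \<and>
      \<Lambda> w (dv u) (dv z) = 0" for u z
  proof -
    have "bracket ?T \<Lambda> (?c u) (?c z) w = complete_lift A (bracket A P (linear_coordinate c u) (linear_coordinate c z)) w \<and>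
        bracket ?T \<Lambda> (?c u) (?v z) w = vertical_lift (bracket A P (linear_coordinate c u) (linear_coordinate c z)) w \<and>
        bracket ?T \<Lambda> (?v u) (?v z) w = 0"
      using \<Lambda> s[of u] s[of z] w cA(2) unfolding tangent_relations_def by blast
    then show ?thesis unfolding bracket_def dc_def dv_def by simp
  qed
  have br: "bracket A P (linear_coordinate c u) (linear_coordinate c z) x = K u z" if x: "x \<in> cdom c" for u z x
  proof -
    have cx: "c \<in> charts_at A x" using x cA by (simp add: charts_at_iff)
    have g: "(\<Sum>b\<in>Basis. fderiv (linear_coordinate c u \<circ> cinv c) (cmap c x) b *\<^sub>R b) = u" for u
      using fderiv_linear_coordinate[OF A cx] by (simp add: euclidean_representation)
    have "cmap c x \<in> cmap c ` (cdom c \<inter> cdom c)" using x by simp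
    from bracket_chart[OF A P cA(1) s s this, of u z] show ?thesis
      unfolding g using cinv_cmap[OF A cA(1) x] by simp
  qed
  have 1: "\<Lambda> w (dc u) (dv z) = K u z" for u z using rel br[OF cA(2)] by (simp add: vertical_lift_def)
  \<comment> \<open>Linear coordinates have the constant bracket \<open>K u z\<close>, whose
    complete lift is zero.\<close>
  have 2: "\<Lambda> w (dc u) (dc z) = 0" for u z
  proof -
    let ?b = "bracket A P (linear_coordinate c u) (linear_coordinate c z)"
    have "((\<lambda>y. K u z) has_derivative (\<lambda>y. 0)) (at ?x)" by simp
    moreover have "(?b \<circ> cinv c) y = K u z" if "y \<in> cmap c ` cdom c" for y
      using that br cinv_cmap[OF A cA(1)] by auto
    ultimately have d: "((?b \<circ> cinv c) has_derivative (\<lambda>y. 0)) (at ?x)"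
      using has_derivative_cong_open[OF open_cdom[OF A cA(1)] imageI[OF cA(2)], of "?b \<circ> cinv c" "\<lambda>y. K u z"] by blast
    have "complete_lift A ?b w = 0"
      using complete_lift_chart[OF A differentiable_near_chartI(1)[OF A c(1) differentiableI[OF d]] c(1) v] fderiv_eqI[OF d] by simp
    then show ?thesis using rel by simp
  qed
  have 3: "\<Lambda> w (dv u) (dv z) = 0" for u z using rel by simp
  have bf: "bivector_field ?T \<Lambda>" using \<Lambda> unfolding tangent_relations_def by blast
  note add = bivector_field_add[OF bf w in_space]
  have "\<Lambda> w a b = \<Lambda> w (\<lambda>D. dc (snd (a C)) D + dv (fst (a C)) D) (\<lambda>D. dc (snd (b C)) D + dv (fst (b C)) D)"
    using split[OF a] split[OF b] by simp
  also have "\<dots> = K (snd (a C)) (fst (b C)) - K (snd (b C)) (fst (a C))"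
    unfolding add(2)[OF cotangent_space_add[OF in_space]] add(1)[OF in_space(1)] add(1)[OF in_space(2)] 1 2 3
    using bivector_field_add(3)[OF bf w in_space(2) in_space(2) in_space(1)] 1 by simp
  also have "\<dots> = tangent_form K (a C) (b C)"
    unfolding tangent_form_def using K(2)[of "snd (b C)" "fst (a C)"] by linarith
  finally show ?thesis .
qed

lemma tangent_poisson_represented:
  assumes A: "smooth_atlas A" and P: "represented_by A P K" and K: "bounded_bilinear K" "\<And>a b. K a b = - K b a"
  shows "represented_by (tangent_atlas A) (tangent_poisson A P) (tangent_form K)"
proof -
  have ch: "\<Lambda> w a b = tangent_form K (a C) (b C)" if "tangent_relations A P \<Lambda>" "C \<in> charts_at (tangent_atlas A) w"
     "a \<in> cotangent_space (tangent_atlas A) w" "b \<in> cotangent_space (tangent_atlas A) w" for \<Lambda> w a b C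
    using tangent_relations_chart[OF A P K that] .
  have "\<Lambda> = \<Lambda>'" if r: "tangent_relations A P \<Lambda>" "tangent_relations A P \<Lambda>'" for \<Lambda> \<Lambda>'
  proof (rule bivector_field_eqI)
    fix w a b assume "w \<in> points (tangent_atlas A)" "a \<in> cotangent_space (tangent_atlas A) w" "b \<in> cotangent_space (tangent_atlas A) w"
    then show "\<Lambda> w a b = \<Lambda>' w a b" using ch[OF r(1) chart_at_in] ch[OF r(2) chart_at_in] by simp
  qed (use r in \<open>auto simp: tangent_relations_def\<close>)
  then have "\<exists>!\<Lambda>. tangent_relations A P \<Lambda>" using tangent_relations_bivector_of[OF A P K] by blast
  then have "tangent_relations A P (THE \<Lambda>. tangent_relations A P \<Lambda>)" by (rule theI')
  moreover have "tangent_poisson A P = (THE \<Lambda>. tangent_relations A P \<Lambda>)"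
    unfolding tangent_poisson_def tangent_relations_def ..
  ultimately show ?thesis using ch unfolding represented_by_def by simp
qed

section \<open>Lagrangian submanifolds in charts\<close>

text \<open>The map \<open>s\<close> represents \<open>K\<close> by the inner product. Testing
  against the covectors \<open>cotangent_vec A x C w\<close> for all \<open>w\<close> determines the
  component at \<open>C\<close>, and with it the vector.\<close>

lemma sharp_chart:
  assumes A: "smooth_atlas A" and P: "represented_by A P K" and s: "\<And>a b. K a b = b \<bullet> s a"
    and C: "C \<in> charts_at A x" and a: "a \<in> cotangent_space A x"
  shows "sharp A P x a = tangent_vec A x C (s (a C))"
  unfolding sharp_def
proof (rule the_equality)
  show "tangent_vec A x C (s (a C)) \<in> tangent_space A x \<and>
    (\<forall>b\<in>cotangent_space A x. pairing A x b (tangent_vec A x C (s (a C))) = P x a b)"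
    using pairing_chart[OF A C _ tangent_vec_in[OF A C]] tangent_vec_in[OF A C] tangent_vec_at[OF A C] represented_byD[OF P C a] s
    by simp
  fix v assume v: "v \<in> tangent_space A x \<and> (\<forall>b\<in>cotangent_space A x. pairing A x b v = P x a b)"
  have "v C \<bullet> w = s (a C) \<bullet> w" for w
  proof -
    have b: "cotangent_vec A x C w \<in> cotangent_space A x" using cotangent_vec_in[OF A C] .
    have "pairing A x (cotangent_vec A x C w) v = w \<bullet> v C"
      using pairing_chart[OF A C b] v cotangent_vec_at[OF A C] by simp
    moreover have "pairing A x (cotangent_vec A x C w) v = w \<bullet> s (a C)"
      using v b represented_byD[OF P C a b] cotangent_vec_at[OF A C] s by simp
    ultimately show ?thesis by (simp add: inner_commute)
  qed
  then have "v C = s (a C)" using vector_eq_rdot by blast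
  then show "v = tangent_vec A x C (s (a C))"
    using v tangent_vec_at[OF A C] by (intro tangent_space_eqI[OF C _ tangent_vec_in[OF A C]]) auto
qed

section \<open>Tangent spaces of submanifolds\<close>

lemma curve_velocity:
  assumes \<gamma>: "smooth_map real_atlas {-\<epsilon><..<\<epsilon>} A \<gamma>" and e: "\<epsilon> > 0" and c: "c \<in> charts_at A (\<gamma> 0)"
  obtains W where "open W" "0 \<in> W" "W \<subseteq> {-\<epsilon><..<\<epsilon>}" "\<gamma> ` W \<subseteq> cdom c"
    "((cmap c \<circ> \<gamma>) has_vector_derivative velocity A \<gamma> 0 c) (at 0)"
proof -
  define W where "W = {s \<in> {-\<epsilon><..<\<epsilon>}. \<gamma> s \<in> cdom c}"
  have W': "cmap real_chart ` {s \<in> {-\<epsilon><..<\<epsilon>} \<inter> cdom real_chart. \<gamma> s \<in> cdom c} = W" by (auto simp: W_def)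
  have "open W" "smooth_on W (cmap c \<circ> \<gamma> \<circ> cinv real_chart)"
    using smooth_map_chart[OF \<gamma> _ _ W'[symmetric]] c by (auto simp: charts_at_iff real_atlas_def)
  moreover have 0: "0 \<in> W" using e c by (auto simp: W_def charts_at_iff)
  ultimately have W: "open W" "smooth_on W (cmap c \<circ> \<gamma>)" by simp_all
  have "((cmap c \<circ> \<gamma>) has_vector_derivative velocity A \<gamma> 0 c) (at 0)"
    using smooth_on_differentiable[OF W(2) 0] c by (simp add: velocity_def vector_derivative_works)
  then show ?thesis by (intro that[OF W(1) 0]) (auto simp: W_def)
qed

lemma submanifold_tangent_space_subset:
  assumes A: "smooth_atlas A" shows "submanifold_tangent_space A N x \<subseteq> tangent_space A x"
proof
  fix v assume "v \<in> submanifold_tangent_space A N x"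
  then obtain \<gamma> \<epsilon> where \<gamma>: "v = velocity A \<gamma> 0" "\<gamma> 0 = x" "\<epsilon> > 0" "smooth_map real_atlas {-\<epsilon><..<\<epsilon>} A \<gamma>"
    unfolding submanifold_tangent_space_def by blast
  show "v \<in> tangent_space A x"
    unfolding tangent_space_def
  proof (intro CollectI conjI allI impI ballI)
    show "v c = 0" if "c \<notin> charts_at A x" for c using that \<gamma> by (simp add: velocity_def)
    fix c d assume c: "c \<in> charts_at A x" and d: "d \<in> charts_at A x"
    have cd: "c \<in> charts_at A (\<gamma> 0)" "d \<in> charts_at A (\<gamma> 0)" using c d \<gamma>(2) by simp_all
    obtain W where W: "open W" "0 \<in> W" "W \<subseteq> {-\<epsilon><..<\<epsilon>}" "\<gamma> ` W \<subseteq> cdom c" "((cmap c \<circ> \<gamma>) has_vector_derivative v c) (at 0)"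
      by (rule curve_velocity[OF \<gamma>(4,3) cd(1), folded \<gamma>(1)])
    obtain W' where W': "open W'" "0 \<in> W'" "W' \<subseteq> {-\<epsilon><..<\<epsilon>}" "\<gamma> ` W' \<subseteq> cdom d" "((cmap d \<circ> \<gamma>) has_vector_derivative v d) (at 0)"
      by (rule curve_velocity[OF \<gamma>(4,3) cd(2), folded \<gamma>(1)])
    have "((\<lambda>s. transition c d ((cmap c \<circ> \<gamma>) s)) has_derivative (\<lambda>h. fderiv (transition c d) (cmap c x) (h *\<^sub>R v c))) (at 0)"
      by (rule has_derivative_compose[OF W(5)[unfolded has_vector_derivative_def]])
        (simp add: \<gamma>(2) transition_has_derivative[OF A c d])
    moreover have "transition c d ((cmap c \<circ> \<gamma>) s) = (cmap d \<circ> \<gamma>) s" if "s \<in> W" for s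
      using that W(4) c by (auto simp: charts_at_iff transition_cmap[OF A])
    ultimately have "((cmap d \<circ> \<gamma>) has_derivative (\<lambda>h. fderiv (transition c d) (cmap c x) (h *\<^sub>R v c))) (at 0)"
      using has_derivative_cong_open[OF W(1,2), of "\<lambda>s. transition c d ((cmap c \<circ> \<gamma>) s)" "cmap d \<circ> \<gamma>"] by blast
    from fun_cong[OF has_derivative_unique[OF this W'(5)[unfolded has_vector_derivative_def]], of 1]
    show "v d = fderiv (transition c d) (cmap c x) (v c)" by simp
  qed
qed

text \<open>Evaluation of components at \<open>C\<close> is injective on tangent vectors and onto
  the model space on covectors. It therefore carries annihilator, sharp map and characteristic
  distribution to their linear counterparts, and equalities of subspaces can be tested after
  applying it.\<close>

lemma lagrangian_chart_iff:
  assumes A: "smooth_atlas A" and P: "represented_by A P K" and s: "\<And>a b. K a b = b \<bullet> s a"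
    and C: "C \<in> charts_at A x" and T: "T \<subseteq> tangent_space A x"
  defines "TC \<equiv> (\<lambda>v. v C) ` T"
  shows "sharp A P x ` annihilator A x T = T \<inter> characteristic_distribution A P x
    \<longleftrightarrow> s ` {\<alpha>. \<forall>u\<in>TC. \<alpha> \<bullet> u = 0} = TC \<inter> range s"
proof -
  let ?e = "\<lambda>v :: ('a, 'b) comps. v C"
  have inj: "inj_on ?e (tangent_space A x)" using tangent_space_eqI[OF C] by (auto intro: inj_onI)
  have sh: "sharp A P x a = tangent_vec A x C (s (a C))" if "a \<in> cotangent_space A x" for a
    using sharp_chart[OF A P s C that] .
  have sub: "annihilator A x T \<subseteq> cotangent_space A x" by (auto simp: annihilator_def)
  have e1: "?e ` sharp A P x ` S = s ` ?e ` S" if "S \<subseteq> cotangent_space A x" for S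
    using that by (force simp: sh tangent_vec_at[OF A C] image_iff)
  have cot: "?e ` cotangent_space A x = UNIV"
    using cotangent_vec_in[OF A C] cotangent_vec_at[OF A C] by (metis UNIV_eq_I image_eqI)
  have ann: "?e ` annihilator A x T = {\<alpha>. \<forall>u\<in>TC. \<alpha> \<bullet> u = 0}"
  proof (intro set_eqI iffI)
    fix \<alpha> assume "\<alpha> \<in> {\<alpha>. \<forall>u\<in>TC. \<alpha> \<bullet> u = 0}"
    moreover have "pairing A x (cotangent_vec A x C \<alpha>) v = \<alpha> \<bullet> v C" if "v \<in> T" for v
      using pairing_chart[OF A C cotangent_vec_in[OF A C]] cotangent_vec_at[OF A C] T that by auto
    ultimately have "cotangent_vec A x C \<alpha> \<in> annihilator A x T"
      using cotangent_vec_in[OF A C] by (auto simp: annihilator_def TC_def)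
    then show "\<alpha> \<in> ?e ` annihilator A x T" using cotangent_vec_at[OF A C] by (metis image_eqI)
  next
    fix \<alpha> assume "\<alpha> \<in> ?e ` annihilator A x T"
    then obtain a where a: "a \<in> annihilator A x T" "\<alpha> = a C" by blast
    have "pairing A x a v = a C \<bullet> v C" if "v \<in> T" for v
      using pairing_chart[OF A C] a(1) sub T that by blast
    then show "\<alpha> \<in> {\<alpha>. \<forall>u\<in>TC. \<alpha> \<bullet> u = 0}" using a by (auto simp: annihilator_def TC_def)
  qed
  have in_t: "sharp A P x ` S \<subseteq> tangent_space A x" if "S \<subseteq> cotangent_space A x" for S
    using that sh tangent_vec_in[OF A C] by auto
  have "sharp A P x ` annihilator A x T = T \<inter> characteristic_distribution A P x
    \<longleftrightarrow> ?e ` sharp A P x ` annihilator A x T = ?e ` (T \<inter> characteristic_distribution A P x)"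
    by (rule inj_on_image_eq_iff[OF inj in_t[OF sub] order.trans[OF Int_lower1 T], symmetric])
  also have "?e ` (T \<inter> characteristic_distribution A P x) = TC \<inter> range s"
    unfolding characteristic_distribution_def TC_def inj_on_image_Int[OF inj T in_t[OF order.refl]] e1[OF order.refl] cot ..
  finally show ?thesis unfolding e1[OF sub] ann .
qed

text \<open>A curve \<gamma> in the image of \<open>g\<close> satisfies g(\<pi>(\<gamma>)) =
  \<gamma> in coordinates; differentiating this puts its velocity in the range of the derivative of
  \<open>g\<close>. Conversely, the direction \<open>u\<close> is realised by the curve s \<mapsto>
  g(y + s u).\<close>

lemma tangent_space_graph:
  fixes A :: "('m, 'e::euclidean_space) chart set" and \<pi> :: "'e \<Rightarrow> 'b::euclidean_space"
  assumes A: "smooth_atlas A" and C: "C \<in> charts_at A w" and w: "w \<in> N" and \<pi>: "bounded_linear \<pi>"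
    and W: "open W" "smooth_on W g" "\<And>z. z \<in> W \<Longrightarrow> \<pi> (g z) = z" and N: "cmap C ` (N \<inter> cdom C) = g ` W"
  shows "(\<lambda>v. v C) ` submanifold_tangent_space A N w = range (fderiv g (\<pi> (cmap C w)))"
proof -
  have CA: "C \<in> A" "w \<in> cdom C" using C by (auto simp: charts_at_iff)
  define y where "y = \<pi> (cmap C w)"
  have retract: "\<pi> \<xi> \<in> W \<and> g (\<pi> \<xi>) = \<xi>" if "\<xi> \<in> g ` W" for \<xi> using that W(3) by auto
  have "cmap C w \<in> g ` W" using N w CA(2) by blast
  then have y: "y \<in> W" "g y = cmap C w" using retract unfolding y_def by auto
  have dg: "(g has_derivative fderiv g y) (at y)" using smooth_on_has_derivative[OF W(2) y(1)] .
  show ?thesis unfolding y_def[symmetric]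
  proof (intro set_eqI iffI)
    fix u assume "u \<in> (\<lambda>v. v C) ` submanifold_tangent_space A N w"
    then obtain \<gamma> \<epsilon> where \<gamma>: "u = velocity A \<gamma> 0 C" "\<gamma> 0 = w" "\<epsilon> > 0" "smooth_map real_atlas {-\<epsilon><..<\<epsilon>} A \<gamma>"
      "\<gamma> ` {-\<epsilon><..<\<epsilon>} \<subseteq> N"
      unfolding submanifold_tangent_space_def by blast
    have C0: "C \<in> charts_at A (\<gamma> 0)" using C \<gamma>(2) by simp
    obtain V where V: "open V" "0 \<in> V" "V \<subseteq> {-\<epsilon><..<\<epsilon>}" "\<gamma> ` V \<subseteq> cdom C" "((cmap C \<circ> \<gamma>) has_vector_derivative u) (at 0)"
      by (rule curve_velocity[OF \<gamma>(4,3) C0, folded \<gamma>(1)])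
    note dV = V(5)[unfolded has_vector_derivative_def]
    have "((\<lambda>s. \<pi> ((cmap C \<circ> \<gamma>) s)) has_derivative (\<lambda>h. \<pi> (h *\<^sub>R u))) (at 0)"
      by (rule bounded_linear.has_derivative[OF \<pi> dV])
    then have "((\<lambda>s. g (\<pi> ((cmap C \<circ> \<gamma>) s))) has_derivative (\<lambda>h. fderiv g y (\<pi> (h *\<^sub>R u)))) (at 0)"
      by (rule has_derivative_compose) (use dg \<gamma>(2) in \<open>simp add: y_def\<close>)
    moreover have "g (\<pi> ((cmap C \<circ> \<gamma>) s)) = (cmap C \<circ> \<gamma>) s" if "s \<in> V" for s
    proof -
      have "(cmap C \<circ> \<gamma>) s \<in> cmap C ` (N \<inter> cdom C)" using V(3,4) \<gamma>(5) that by (auto intro!: imageI)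
      then show ?thesis using retract unfolding N by blast
    qed
    ultimately have "((cmap C \<circ> \<gamma>) has_derivative (\<lambda>h. fderiv g y (\<pi> (h *\<^sub>R u)))) (at 0)"
      using has_derivative_cong_open[OF V(1,2), of "\<lambda>s. g (\<pi> ((cmap C \<circ> \<gamma>) s))" "cmap C \<circ> \<gamma>"] by blast
    from fun_cong[OF has_derivative_unique[OF this dV], of 1] have "fderiv g y (\<pi> u) = u" by simp
    then show "u \<in> range (fderiv g y)" by (rule range_eqI[OF sym])
  next
    fix u' assume "u' \<in> range (fderiv g y)"
    then obtain u where u: "u' = fderiv g y u" by blast
    have "continuous_on UNIV (\<lambda>s :: real. y + s *\<^sub>R u)" by (intro continuous_intros)
    then have op: "open ((\<lambda>s :: real. y + s *\<^sub>R u) -` W)" using W(1) open_vimage by blast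
    moreover have "0 \<in> (\<lambda>s :: real. y + s *\<^sub>R u) -` W" using y by simp
    ultimately obtain \<epsilon> where \<epsilon>: "\<epsilon> > 0" "\<And>s. dist s 0 < \<epsilon> \<Longrightarrow> y + s *\<^sub>R u \<in> W"
      unfolding open_dist by (metis vimage_eq)
    define I where "I = {-\<epsilon><..<\<epsilon>}"
    have I: "y + s *\<^sub>R u \<in> W" if "s \<in> I" for s using \<epsilon>(2)[of s] that by (auto simp: I_def dist_real_def)
    define \<gamma> where "\<gamma> s = cinv C (g (y + s *\<^sub>R u))" for s
    have g\<gamma>: "\<gamma> s \<in> N \<inter> cdom C \<and> cmap C (\<gamma> s) = g (y + s *\<^sub>R u)" if "s \<in> I" for s
    proof -
      have "g (y + s *\<^sub>R u) \<in> cmap C ` (N \<inter> cdom C)" unfolding N using I[OF that] by (rule imageI)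
      then obtain z where "z \<in> N \<inter> cdom C" "g (y + s *\<^sub>R u) = cmap C z" by blast
      then show ?thesis using cinv_cmap[OF A CA(1)] by (simp add: \<gamma>_def)
    qed
    have opI: "open I" "0 \<in> I" using \<epsilon> by (auto simp: I_def)
    have I_sub: "open_subset real_atlas I" using opI(1) by (simp add: open_subset_def real_atlas_def points_def)
    have "smooth_on I (\<lambda>s. g (y + s *\<^sub>R u))"
      using I W(1,2) by (intro smooth_on_compose[where f="\<lambda>s. y + s *\<^sub>R u" and g=g and T=W] smooth_on_add smooth_on_scaleR opI) auto
    moreover have "smooth_on I (cmap C \<circ> \<gamma> \<circ> cinv real_chart) \<longleftrightarrow> smooth_on I (\<lambda>s. g (y + s *\<^sub>R u))"
      by (rule smooth_on_cong[OF opI(1)]) (simp add: g\<gamma>)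
    ultimately have sm: "smooth_on I (cmap C \<circ> \<gamma> \<circ> cinv real_chart)" by blast
    have "smooth_map real_atlas I A \<gamma>"
    proof (rule smooth_mapI_local[OF smooth_atlas_real A I_sub])
      fix s assume "s \<in> I"
      then show "\<exists>c\<in>real_atlas. \<exists>d\<in>A. \<exists>W. s \<in> cdom c \<and> open W \<and> cmap c s \<in> W \<and> W \<subseteq> cmap c ` (I \<inter> cdom c) \<and>
       (\<forall>y\<in>W. \<gamma> (cinv c y) \<in> cdom d) \<and> smooth_on W (cmap d \<circ> \<gamma> \<circ> cinv c)"
        using sm opI CA g\<gamma> by (intro bexI[of _ real_chart] bexI[of _ C] exI[of _ I]) (simp_all add: real_atlas_def)
    qed
    moreover have "\<gamma> 0 = w" using y cinv_cmap[OF A CA] by (simp add: \<gamma>_def)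
    moreover have "\<gamma> ` I \<subseteq> N" using g\<gamma> by blast
    ultimately have "velocity A \<gamma> 0 \<in> submanifold_tangent_space A N w"
      unfolding submanifold_tangent_space_def I_def using \<epsilon>(1) by blast
    moreover have "velocity A \<gamma> 0 C = u'"
    proof -
      have "((\<lambda>s. g (y + s *\<^sub>R u)) has_vector_derivative u') (at 0)"
        using fderiv_line[of g y 0 u] dg u by (simp add: differentiableI)
      then have "((cmap C \<circ> \<gamma>) has_vector_derivative u') (at 0)"
        unfolding has_vector_derivative_def
        using has_derivative_cong_open[OF opI, of "cmap C \<circ> \<gamma>" "\<lambda>s. g (y + s *\<^sub>R u)"] g\<gamma> by simp
      then show ?thesis using \<open>\<gamma> 0 = w\<close> C by (simp add: velocity_def vector_derivative_at)
    qed
    ultimately show "u' \<in> (\<lambda>v. v C) ` submanifold_tangent_space A N w" by blast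
  qed
qed

text \<open>Slice charts usually do not belong to the given atlas. A chart that differs from one of
  its charts by a diffeomorphism \<psi> of an open set is compatible with all of them.\<close>

lemma smooth_atlas_insert:
  assumes A: "smooth_atlas A" and C: "C \<in> A" and \<Omega>: "open \<Omega>" and s: "smooth_on \<Omega> \<psi>" "smooth_on \<Omega> \<psi>'"
    and im: "\<psi> ` \<Omega> \<subseteq> \<Omega>" "\<psi>' ` \<Omega> \<subseteq> \<Omega>" and inv: "\<And>y. y \<in> \<Omega> \<Longrightarrow> \<psi>' (\<psi> y) = y" "\<And>y. y \<in> \<Omega> \<Longrightarrow> \<psi> (\<psi>' y) = y"
  defines "D \<equiv> ({x \<in> cdom C. cmap C x \<in> \<Omega>}, \<psi> \<circ> cmap C)"
  shows "smooth_atlas (insert D A)"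
proof -
  have D: "cdom D = {x \<in> cdom C. cmap C x \<in> \<Omega>}" "cmap D x = \<psi> (cmap C x)" for x by (auto simp: D_def)
  have img: "cmap D ` (cdom D \<inter> S) = \<Omega> \<inter> \<psi>' -` (cmap C ` (cdom C \<inter> S))" for S
  proof (intro set_eqI iffI)
    fix y assume "y \<in> \<Omega> \<inter> \<psi>' -` (cmap C ` (cdom C \<inter> S))"
    then obtain x where "y \<in> \<Omega>" "x \<in> cdom C" "x \<in> S" "\<psi>' y = cmap C x" by auto
    then show "y \<in> cmap D ` (cdom D \<inter> S)" using inv(2)[of y] im(2) by (intro image_eqI[of _ _ x]) (auto simp: D)
  qed (use im inv in \<open>auto simp: D\<close>)
  have op: "open (cmap D ` (cdom D \<inter> S))" if "open (cmap C ` (cdom C \<inter> S))" for S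
    unfolding img using smooth_on_continuous_on[OF s(2)] \<Omega> that by (rule continuous_open_preimage)
  have injD: "inj_on (cmap D) (cdom D)"
  proof (rule inj_onI)
    fix x x' assume "x \<in> cdom D" "x' \<in> cdom D" "cmap D x = cmap D x'"
    then have "x \<in> cdom C" "x' \<in> cdom C" "cmap C x = cmap C x'" using inv(1) by (auto simp: D) metis
    then show "x = x'" using cmap_eqD[OF A C] by blast
  qed
  have selfD: "cmap D ` (cdom D \<inter> cdom D) = \<Omega> \<inter> \<psi>' -` (cmap C ` (cdom C \<inter> UNIV))" using img[of UNIV] by simp
  show ?thesis
  proof (rule smooth_atlasI)
    fix c assume "c \<in> insert D A"
    then show "inj_on (cmap c) (cdom c)" using injD A unfolding smooth_atlas_def by blast
  next
    fix c d assume "c \<in> insert D A" "d \<in> insert D A"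
    then consider "c = D" "d = D" | "c = D" "d \<in> A" | "c \<in> A" "d = D" | "c \<in> A" "d \<in> A" by blast
    then have "open (cmap c ` (cdom c \<inter> cdom d)) \<and> (\<exists>T. smooth_on (cmap c ` (cdom c \<inter> cdom d)) T \<and> (\<forall>x\<in>cdom c \<inter> cdom d. T (cmap c x) = cmap d x))"
    proof cases
      case 1
      then show ?thesis using op[of UNIV] open_cdom[OF A C] by (auto intro!: exI[of _ id])
    next
      case 2
      have O: "open (cmap D ` (cdom D \<inter> cdom d))" using op open_overlap[OF A C 2(2)] by blast
      have "smooth_on (cmap D ` (cdom D \<inter> cdom d)) (\<lambda>y. transition C d (\<psi>' y))"
        by (rule smooth_on_compose[where f=\<psi>' and g="transition C d", OF O open_overlap[OF A C 2(2)] _ _ smooth_transition[OF A C 2(2)]])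
          (auto simp: img intro: smooth_on_subset[OF s(2)])
      moreover have "transition C d (\<psi>' (cmap D x)) = cmap d x" if "x \<in> cdom D" for x
        using that inv(1) transition_cmap[OF A C] by (simp add: D)
      ultimately show ?thesis using O 2(1) by (intro conjI exI[of _ "\<lambda>y. transition C d (\<psi>' y)"]) simp_all
    next
      case 3
      have e: "cmap c ` (cdom c \<inter> cdom D) = cmap c ` ({x \<in> cdom C. cmap C x \<in> \<Omega>} \<inter> cdom c)" by (simp add: D Int_commute)
      have O: "open (cmap c ` (cdom c \<inter> cdom D))"
        unfolding e by (rule open_subset_openD[OF open_subset_chart_preimage[OF A C \<Omega>] 3(1)])
      have t: "transition c C (cmap c x) = cmap C x" if "x \<in> cdom c" for x using transition_cmap[OF A 3(1) that] .
      have "smooth_on (cmap c ` (cdom c \<inter> cdom D)) (\<lambda>y. \<psi> (transition c C y))"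
        by (rule smooth_on_compose[where f="transition c C" and g=\<psi>, OF O \<Omega> _ smooth_on_subset[OF smooth_transition[OF A 3(1) C]] s(1)])
          (auto simp: D t)
      moreover have "\<psi> (transition c C (cmap c x)) = cmap D x" if "x \<in> cdom c" for x
        using t[OF that] by (simp add: D)
      ultimately show ?thesis using O 3(2) by (intro conjI exI[of _ "\<lambda>y. \<psi> (transition c C y)"]) simp_all
    next
      case 4
      then show ?thesis using open_overlap[OF A 4] smooth_transition[OF A 4] transition_cmap[OF A 4(1)]
        by (intro conjI exI[of _ "transition c d"]) auto
    qed
    then show "open (cmap c ` (cdom c \<inter> cdom d))"
      "\<exists>T. smooth_on (cmap c ` (cdom c \<inter> cdom d)) T \<and> (\<forall>x\<in>cdom c \<inter> cdom d. T (cmap c x) = cmap d x)"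
      by (rule conjunct1, rule conjunct2)
  qed
qed

text \<open>The slice charts shear the graph of \<open>g\<close> onto the image of a linear section \<open>\<iota>\<close> of \<open>\<pi>\<close>.\<close>

lemma submanifold_graph:
  fixes A :: "('m, 'e::euclidean_space) chart set" and \<pi> :: "'e \<Rightarrow> 'b::euclidean_space"
  assumes A: "smooth_atlas A" and N: "N \<subseteq> points A" and \<pi>: "bounded_linear \<pi>" and \<iota>: "bounded_linear \<iota>" "\<And>y. \<pi> (\<iota> y) = y"
    and loc: "\<And>w. w \<in> N \<Longrightarrow> \<exists>C\<in>A. \<exists>W g. w \<in> cdom C \<and> open W \<and> smooth_on W g \<and> (\<forall>z\<in>W. \<pi> (g z) = z) \<and> cmap C ` (N \<inter> cdom C) = g ` W"
  shows "submanifold A N"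
  unfolding submanifold_def
\<comment> \<open>The slice dimension must be the same at all points, so one section \<iota> serves
  all the local graphs.\<close>
proof (intro conjI N exI[of _ "dim (range \<iota>)"] ballI)
  fix w assume w: "w \<in> N"
  obtain C W g where C: "C \<in> A" "w \<in> cdom C" and W: "open W" "smooth_on W g" "\<And>z. z \<in> W \<Longrightarrow> \<pi> (g z) = z"
    and NC: "cmap C ` (N \<inter> cdom C) = g ` W" using loc[OF w] by blast
  define \<Omega> where "\<Omega> = \<pi> -` W"
  define \<psi> where "\<psi> = (\<lambda>\<xi>. \<xi> - g (\<pi> \<xi>) + \<iota> (\<pi> \<xi>))"
  define \<psi>' where "\<psi>' = (\<lambda>\<xi>. \<xi> + g (\<pi> \<xi>) - \<iota> (\<pi> \<xi>))"
  define D where "D = ({x \<in> cdom C. cmap C x \<in> \<Omega>}, \<psi> \<circ> cmap C)"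
  have \<pi>_add: "\<pi> (x + y) = \<pi> x + \<pi> y" "\<pi> (x - y) = \<pi> x - \<pi> y" for x y
    using linear_add[OF bounded_linear.linear[OF \<pi>]] linear_diff[OF bounded_linear.linear[OF \<pi>]] .
  have \<Omega>: "open \<Omega>" unfolding \<Omega>_def using linear_continuous_on[OF \<pi>] W(1) open_vimage by blast
  \<comment> \<open>Both \<open>g\<close> and \<iota> are sections of \<pi>, so the two shears do
    not move \<pi>; this makes them inverse to each other.\<close>
  have \<pi>\<psi>: "\<pi> (\<psi> \<xi>) = \<pi> \<xi>" "\<pi> (\<psi>' \<xi>) = \<pi> \<xi>" if "\<xi> \<in> \<Omega>" for \<xi>
    using that W(3) unfolding \<Omega>_def \<psi>_def \<psi>'_def by (simp_all add: \<pi>_add \<iota>(2))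
  have sg: "smooth_on \<Omega> (\<lambda>\<xi>. g (\<pi> \<xi>))"
    by (rule smooth_on_compose[where f=\<pi> and g=g, OF \<Omega> W(1) _ smooth_on_bounded_linear[OF \<pi>] W(2)]) (auto simp: \<Omega>_def)
  have s\<iota>: "smooth_on \<Omega> (\<lambda>\<xi>. \<iota> (\<pi> \<xi>))" by (rule smooth_on_linear[OF \<Omega> \<iota>(1) smooth_on_bounded_linear[OF \<pi>]])
  have sm: "smooth_on \<Omega> \<psi>" "smooth_on \<Omega> \<psi>'"
    unfolding \<psi>_def \<psi>'_def by (intro smooth_on_add[OF \<Omega>] smooth_on_diff[OF \<Omega>] sg s\<iota> smooth_on_ident(1))+
  have atlas: "smooth_atlas (insert D A)"
    unfolding D_def
  proof (rule smooth_atlas_insert[OF A C(1) \<Omega> sm])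
    show "\<psi> ` \<Omega> \<subseteq> \<Omega>" "\<psi>' ` \<Omega> \<subseteq> \<Omega>" using \<pi>\<psi> by (auto simp: \<Omega>_def)
    show "\<psi>' (\<psi> y) = y" "\<psi> (\<psi>' y) = y" if "y \<in> \<Omega>" for y
      using \<pi>\<psi>[OF that] by (simp_all add: \<psi>_def \<psi>'_def)
  qed
  have D: "cdom D = {x \<in> cdom C. cmap C x \<in> \<Omega>}" "cmap D x = \<psi> (cmap C x)" for x by (auto simp: D_def)
  have gW: "\<pi> \<xi> \<in> W \<and> g (\<pi> \<xi>) = \<xi>" if "\<xi> \<in> g ` W" for \<xi> using that W(3) by auto
  have slice: "cmap D ` (N \<inter> cdom D) = cmap D ` cdom D \<inter> range \<iota>"
  proof (intro set_eqI iffI)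
    fix \<eta> assume "\<eta> \<in> cmap D ` (N \<inter> cdom D)"
    then obtain x where x: "x \<in> N" "x \<in> cdom D" "\<eta> = cmap D x" by blast
    then have "cmap C x \<in> g ` W" using NC D by auto
    then have "\<eta> = \<iota> (\<pi> (cmap C x))" using gW x D by (simp add: \<psi>_def)
    then show "\<eta> \<in> cmap D ` cdom D \<inter> range \<iota>" using x by blast
  next
    fix \<eta> assume "\<eta> \<in> cmap D ` cdom D \<inter> range \<iota>"
    then obtain x y where x: "x \<in> cdom D" "\<eta> = cmap D x" "\<eta> = \<iota> y" by blast
    let ?\<xi> = "cmap C x"
    have \<xi>: "?\<xi> \<in> \<Omega>" "x \<in> cdom C" "\<psi> ?\<xi> = \<iota> y" using x D by auto
    have "y = \<pi> ?\<xi>" using \<pi>\<psi>(1)[OF \<xi>(1)] \<xi>(3) \<iota>(2) by simp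
    then have "?\<xi> = g (\<pi> ?\<xi>)" using \<xi>(3) by (simp add: \<psi>_def)
    moreover have "\<pi> ?\<xi> \<in> W" using \<xi>(1) by (simp add: \<Omega>_def)
    ultimately have "?\<xi> \<in> cmap C ` (N \<inter> cdom C)" unfolding NC by (rule image_eqI)
    then have "x \<in> N" using cmap_eqD[OF A C(1) \<xi>(2)] by blast
    then show "\<eta> \<in> cmap D ` (N \<inter> cdom D)" using x by blast
  qed
  have wD: "w \<in> cdom D"
  proof -
    have "cmap C w \<in> g ` W" using NC w C(2) by blast
    then show ?thesis using gW C(2) D by (simp add: \<Omega>_def)
  qed
  have "cdom D \<subseteq> points A" using C D by (auto simp: points_def)
  moreover have "subspace (range \<iota>)" using linear_subspace_image[OF bounded_linear.linear[OF \<iota>(1)] subspace_UNIV] .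
  ultimately show "\<exists>c S. w \<in> cdom c \<and> cdom c \<subseteq> points A \<and> smooth_atlas (insert c A) \<and>
        subspace S \<and> dim S = dim (range \<iota>) \<and> cmap c ` (N \<inter> cdom c) = cmap c ` cdom c \<inter> S"
    using wD atlas slice by blast
qed

section \<open>The image of the lifted field in coordinates\<close>

lemma R_TQ_eq: "R_TQ A = natural_chart A ` A"
  unfolding R_TQ_def prod_atlas_def real_atlas_def tangent_atlas_def natural_chart_def by auto

lemma natural_chart_simps:
  "w \<in> cdom (natural_chart A c) \<longleftrightarrow> fst (snd w) \<in> cdom c \<and> snd (snd w) \<in> tangent_space A (fst (snd w))"
  "cmap (natural_chart A c) w = (fst w, (cmap c (fst (snd w)), snd (snd w) c))"
  unfolding natural_chart_def by (auto simp: prod_chart_simps tangent_chart_simps)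

lemma smooth_atlas_R_TQ: "smooth_atlas A \<Longrightarrow> smooth_atlas (R_TQ A)"
  unfolding R_TQ_def by (intro smooth_atlas_prod smooth_atlas_real smooth_atlas_tangent)

lemma natural_chart_overlap:
  assumes "smooth_atlas A" "c \<in> A" "d \<in> A"
  shows "cmap (natural_chart A c) ` (cdom (natural_chart A c) \<inter> cdom (natural_chart A d)) = UNIV \<times> (cmap c ` (cdom c \<inter> cdom d) \<times> UNIV)"
  unfolding natural_chart_def prod_chart_overlap tangent_chart_overlap[OF assms] by simp

lemma points_R_TQ: "w \<in> points (R_TQ A) \<longleftrightarrow> fst (snd w) \<in> points A \<and> snd (snd w) \<in> tangent_space A (fst (snd w))"
  by (auto simp: points_def R_TQ_eq natural_chart_simps)

lemma points_R_TstarQ: "w \<in> points (R_TstarQ A) \<longleftrightarrow> fst (snd w) \<in> points A \<and> snd (snd w) \<in> cotangent_space A (fst (snd w))"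
  by (auto simp: points_def R_TstarQ_eq momentum_chart_simps)

section \<open>Representatives of smooth maps and the tangent map\<close>

lemma smooth_map_representative:
  assumes F: "smooth_map A V B F" and x: "x \<in> V" and c: "c \<in> charts_at A x" and d: "d \<in> charts_at B (F x)"
  shows "((cmap d \<circ> F \<circ> cinv c) has_derivative fderiv (cmap d \<circ> F \<circ> cinv c) (cmap c x)) (at (cmap c x))"
  using smooth_map_chart(2)[OF F _ _ refl, of c d] x c d
  by (intro smooth_on_has_derivative) (auto simp: charts_at_iff)

text \<open>Chain rule for F between two pairs of charts. It gives both facts about
  \<open>tangent_map\<close>: any source chart may be used, and the components obey the
  transformation law.\<close>

lemma smooth_map_change_charts:
  assumes A: "smooth_atlas A" and B: "smooth_atlas B" and F: "smooth_map A V B F" and x: "x \<in> V"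
    and c: "c \<in> charts_at A x" "c' \<in> charts_at A x" and d: "d \<in> charts_at B (F x)" "d' \<in> charts_at B (F x)"
  shows "fderiv (cmap d' \<circ> F \<circ> cinv c') (cmap c' x) u =
    fderiv (transition d d') (cmap d (F x)) (fderiv (cmap d \<circ> F \<circ> cinv c) (cmap c x) (fderiv (transition c' c) (cmap c' x) u))"
proof -
  have cA: "c \<in> A" "x \<in> cdom c" "c' \<in> A" "x \<in> cdom c'" and dB: "d \<in> B" "F x \<in> cdom d" "d' \<in> B" "F x \<in> cdom d'"
    using c d by (auto simp: charts_at_iff)
  define W1 where "W1 = cmap c' ` {x \<in> V \<inter> cdom c'. F x \<in> cdom d}"
  define W2 where "W2 = cmap c' ` {x \<in> V \<inter> cdom c'. F x \<in> cdom d'}"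
  define W3 where "W3 = cmap c' ` (cdom c' \<inter> cdom c)"
  have op: "open W1" "open W2" "open W3"
    using smooth_map_chart(1)[OF F cA(3) dB(1) W1_def] smooth_map_chart(1)[OF F cA(3) dB(3) W2_def] open_overlap[OF A cA(3,1)]
    by (simp_all add: W3_def)
  have O: "open (W1 \<inter> W2 \<inter> W3)" using op by (intro open_Int)
  have xO: "cmap c' x \<in> W1 \<inter> W2 \<inter> W3" using x cA dB unfolding W1_def W2_def W3_def by auto
  have t: "transition c' c (cmap c' x) = cmap c x" using transition_cmap[OF A cA(3,4)] .
  have e: "(cmap d \<circ> F \<circ> cinv c) (cmap c x) = cmap d (F x)" using cinv_cmap[OF A cA(1,2)] by simp
  have "((\<lambda>y. (cmap d \<circ> F \<circ> cinv c) (transition c' c y)) has_derivative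
     (\<lambda>u. fderiv (cmap d \<circ> F \<circ> cinv c) (cmap c x) (fderiv (transition c' c) (cmap c' x) u))) (at (cmap c' x))"
    by (rule has_derivative_compose[OF transition_has_derivative[OF A c(2,1)]])
      (simp only: t smooth_map_representative[OF F x c(1) d(1)])
  then have "((\<lambda>y. transition d d' ((cmap d \<circ> F \<circ> cinv c) (transition c' c y))) has_derivative
     (\<lambda>u. fderiv (transition d d') (cmap d (F x)) (fderiv (cmap d \<circ> F \<circ> cinv c) (cmap c x) (fderiv (transition c' c) (cmap c' x) u)))) (at (cmap c' x))"
    by (rule has_derivative_compose) (simp only: t e transition_has_derivative[OF B d])
  moreover have "transition d d' ((cmap d \<circ> F \<circ> cinv c) (transition c' c y)) = (cmap d' \<circ> F \<circ> cinv c') y"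
    if "y \<in> W1 \<inter> W2 \<inter> W3" for y
  proof -
    obtain z where z: "z \<in> cdom c'" "F z \<in> cdom d" "y = cmap c' z" using \<open>y \<in> W1 \<inter> W2 \<inter> W3\<close> unfolding W1_def by auto
    obtain z' where z': "z' \<in> cdom c'" "z' \<in> cdom c" "y = cmap c' z'" using \<open>y \<in> W1 \<inter> W2 \<inter> W3\<close> unfolding W3_def by auto
    have "z' = z" using cmap_eqD[OF A cA(3)] z z' by simp
    then show ?thesis
      using z z' transition_cmap[OF A cA(3)] transition_cmap[OF B dB(1)] cinv_cmap[OF A cA(1)] cinv_cmap[OF A cA(3)] by simp
  qed
  ultimately have "((cmap d' \<circ> F \<circ> cinv c') has_derivative
     (\<lambda>u. fderiv (transition d d') (cmap d (F x)) (fderiv (cmap d \<circ> F \<circ> cinv c) (cmap c x) (fderiv (transition c' c) (cmap c' x) u)))) (at (cmap c' x))"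
    using has_derivative_cong_open[OF O xO, of "\<lambda>y. transition d d' ((cmap d \<circ> F \<circ> cinv c) (transition c' c y))" "cmap d' \<circ> F \<circ> cinv c'"] by blast
  from fderiv_eqI[OF this] show ?thesis by (rule fun_cong)
qed

lemma
  assumes A: "smooth_atlas A" and B: "smooth_atlas B" and F: "smooth_map A V B F" and x: "x \<in> V" and v: "v \<in> tangent_space A x"
    and c: "c \<in> charts_at A x"
  shows tangent_map_chart: "d \<in> charts_at B (F x) \<Longrightarrow>
      snd (tangent_map A B F (x, v)) d = fderiv (cmap d \<circ> F \<circ> cinv c) (cmap c x) (v c)"
    and tangent_map_in: "snd (tangent_map A B F (x, v)) \<in> tangent_space B (F x)"
proof -
  let ?c = "chart_at A x" and ?\<tau> = "snd (tangent_map A B F (x, v))"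
  have c': "?c \<in> charts_at A x" using c by (intro chart_at_in) (auto simp: charts_at_iff points_def)
  have \<tau>: "?\<tau> d = (if d \<in> charts_at B (F x) then fderiv (cmap d \<circ> F \<circ> cinv ?c) (cmap ?c x) (v ?c) else 0)" for d
    by (simp add: tangent_map_def Let_def)
  show "?\<tau> d = fderiv (cmap d \<circ> F \<circ> cinv c) (cmap c x) (v c)" if d: "d \<in> charts_at B (F x)"
    using \<tau>[of d] d smooth_map_change_charts[OF A B F x c c' d d, of "v ?c"] fderiv_transition_refl[OF B d]
      tangent_space_transform[OF v c' c] by simp
  show "?\<tau> \<in> tangent_space B (F x)"
    unfolding tangent_space_def
  proof (intro CollectI conjI allI impI ballI)
    show "?\<tau> d = 0" if "d \<notin> charts_at B (F x)" for d using \<tau>[of d] that by simp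
    fix d d' assume d: "d \<in> charts_at B (F x)" "d' \<in> charts_at B (F x)"
    show "?\<tau> d' = fderiv (transition d d') (cmap d (F x)) (?\<tau> d)"
      using \<tau>[of d] \<tau>[of d'] d smooth_map_change_charts[OF A B F x c' c' d, of "v ?c"] fderiv_transition_refl[OF A c'] by simp
  qed
qed

text \<open>The F_i of F(t, q, qdot) = (t, q, F_i), as functions of natural coordinates.\<close>

definition momentum_component :: "('q, 'e::euclidean_space) chart set \<Rightarrow> (('q, 'e) phase \<Rightarrow> ('q, 'e) phase) \<Rightarrow> ('q, 'e) chart
    \<Rightarrow> real \<times> ('e \<times> 'e) \<Rightarrow> 'e" where
  "momentum_component A F c y = snd (snd (F (cinv (natural_chart A c) y))) c"

text \<open>The coefficients \<Gamma>^i of d/dqdot^i, as functions of natural coordinates.\<close>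

definition acceleration :: "('q, 'e::euclidean_space) chart set
    \<Rightarrow> (('q, 'e) phase \<Rightarrow> ('q, 'e) phase \<times> (('q, 'e) phase, real \<times> ('e \<times> 'e)) comps) \<Rightarrow> ('q, 'e) chart
    \<Rightarrow> real \<times> ('e \<times> 'e) \<Rightarrow> 'e" where
  "acceleration A \<Gamma> c y = snd (snd (snd (\<Gamma> (cinv (natural_chart A c) y)) (natural_chart A c)))"

text \<open>Components of d/dt + qdot^i d/dq^i + G^i d/dqdot^i.\<close>

definition sode_vector :: "(real \<times> ('e::euclidean_space \<times> 'e) \<Rightarrow> 'e) \<Rightarrow> real \<times> ('e \<times> 'e) \<Rightarrow> real \<times> ('e \<times> 'e)" where
  "sode_vector G y = (1, (snd (snd y), G y))"

text \<open>In the notation of the paper: \<open>\<Gamma>(f)\<close>.\<close>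

definition along :: "(real \<times> ('e::euclidean_space \<times> 'e) \<Rightarrow> 'e) \<Rightarrow> (real \<times> ('e \<times> 'e) \<Rightarrow> 'e) \<Rightarrow> real \<times> ('e \<times> 'e) \<Rightarrow> 'e" where
  "along G f y = fderiv f y (sode_vector G y)"

text \<open>Closedness, at fixed time, of the form \<open>\<Gamma>(f\<^sub>i) dq\<^sup>i + f\<^sub>i dqdot\<^sup>i\<close>; here \<open>h\<close> stands for \<open>\<Gamma>(f)\<close>.\<close>

definition closed_at :: "(real \<times> ('e::euclidean_space \<times> 'e) \<Rightarrow> 'e) \<Rightarrow> (real \<times> ('e \<times> 'e) \<Rightarrow> 'e) \<Rightarrow> real \<times> ('e \<times> 'e) \<Rightarrow> bool" where
  "closed_at h f y \<longleftrightarrow> (\<forall>a b a' b'. fderiv h y (0, (a, b)) \<bullet> a' + fderiv f y (0, (a, b)) \<bullet> b'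
     = fderiv h y (0, (a', b')) \<bullet> a + fderiv f y (0, (a', b')) \<bullet> b)"

text \<open>The sharp map for components ordered as ((t, (q, p)), (v_t, (qdot, pdot))). Its image
  consists of the vectors without t and v_t components, and the t and v_t components of covectors
  lie in its kernel.\<close>

definition lifted_sharp :: "(real \<times> ('e::euclidean_space \<times> 'e)) \<times> (real \<times> ('e \<times> 'e)) \<Rightarrow> (real \<times> ('e \<times> 'e)) \<times> (real \<times> ('e \<times> 'e))" where
  "lifted_sharp \<alpha> = ((0, (- snd (snd (snd \<alpha>)), fst (snd (snd \<alpha>)))), (0, (- snd (snd (fst \<alpha>)), fst (snd (fst \<alpha>)))))"

lemma tangent_form_canonical_sharp: "tangent_form canonical_form \<alpha> \<beta> = \<beta> \<bullet> lifted_sharp \<alpha>"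
  unfolding tangent_form_def canonical_form_def lifted_sharp_def inner_prod_def by (simp add: inner_commute)

text \<open>\<open>T\<close> is the tangent space of the graph. Its vectors in the characteristic
  distribution are those with dt = 0, given by p = \<phi>(a, b) and pdot = \<eta>(a, b) over (q,
  qdot) = (a, b). A vector of \<open>sharp\<close> of the annihilator has p and pdot prescribed by
  the transposed expression, so equality of the two spaces is symmetry.\<close>

lemma lagrangian_subspace_iff:
  fixes \<phi> \<eta> :: "real \<times> ('e::euclidean_space \<times> 'e) \<Rightarrow> 'e"
  assumes lin: "linear \<phi>" "linear \<eta>"
  defines "T \<equiv> range (\<lambda>u. ((fst u, (fst (snd u), \<phi> u)), (0 :: real, (snd (snd u), \<eta> u))))"
  shows "lifted_sharp ` {\<alpha>. \<forall>u\<in>T. \<alpha> \<bullet> u = 0} = T \<inter> range lifted_sharp \<longleftrightarrow>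
    (\<forall>a b a' b'. \<eta> (0, (a, b)) \<bullet> a' + \<phi> (0, (a, b)) \<bullet> b' = \<eta> (0, (a', b')) \<bullet> a + \<phi> (0, (a', b')) \<bullet> b)"
proof -
  \<comment> \<open>\<open>V a b P R\<close> is the vector tangent to the leaf with q = a, qdot = b,
    p = P, pdot = R; \<open>k a b\<close> is the functional that the annihilation condition requires
    of \<open>P\<close> and \<open>R\<close>.\<close>
  define V where "V = (\<lambda>a b P R. ((0 :: real, (a :: 'e, P :: 'e)), (0 :: real, (b :: 'e, R :: 'e))))"
  define k where "k = (\<lambda>a b u. b \<bullet> \<phi> u + a \<bullet> \<eta> u)"
  have klin: "linear (k a b)" for a b
    using lin unfolding k_def linear_iff by (simp add: inner_add_right algebra_simps)
  have L: "\<xi> \<in> lifted_sharp ` {\<alpha>. \<forall>u\<in>T. \<alpha> \<bullet> u = 0} \<longleftrightarrow>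
    (\<exists>a b P R. \<xi> = V a b P R \<and> (\<forall>a' b'. R \<bullet> a' + P \<bullet> b' = k a b (0, (a', b'))))" (is "?l \<longleftrightarrow> ?r") for \<xi>
  proof
    assume ?l
    then obtain \<alpha> where \<alpha>: "\<forall>u\<in>T. \<alpha> \<bullet> u = 0" "\<xi> = lifted_sharp \<alpha>" by blast
    define a where "a = - snd (snd (snd \<alpha>))"
    define b where "b = - snd (snd (fst \<alpha>))"
    have "fst (snd (fst \<alpha>)) \<bullet> a' + fst (snd (snd \<alpha>)) \<bullet> b' = k a b (0, (a', b'))" for a' b'
    proof -
      have "((0, (a', \<phi> (0, (a', b')))), (0, (b', \<eta> (0, (a', b'))))) \<in> T" unfolding T_def by (rule range_eqI[of _ _ "(0, (a', b'))"]) simp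
      with \<alpha>(1) have "\<alpha> \<bullet> ((0, (a', \<phi> (0, (a', b')))), (0, (b', \<eta> (0, (a', b'))))) = 0" by blast
      then show ?thesis unfolding k_def a_def b_def inner_prod_def by simp
    qed
    moreover have "\<xi> = V a b (fst (snd (snd \<alpha>))) (fst (snd (fst \<alpha>)))"
      unfolding \<alpha>(2) V_def a_def b_def lifted_sharp_def by simp
    ultimately show ?r by blast
  next
    assume ?r
    then obtain a b P R where *: "\<xi> = V a b P R" "\<And>a' b'. R \<bullet> a' + P \<bullet> b' = k a b (0, (a', b'))" by blast
    \<comment> \<open>The dt component is chosen so that \<alpha> kills the time direction of
      \<open>T\<close>. It is free because \<open>lifted_sharp\<close> does not see it.\<close>
    define \<alpha> where "\<alpha> = ((k a b (1, 0), (R, - b)), (0 :: real, (P, - a)))"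
    have "\<alpha> \<bullet> u = 0" if "u \<in> T" for u
    proof -
      obtain z where z: "u = ((fst z, (fst (snd z), \<phi> z)), (0, (snd (snd z), \<eta> z)))" using \<open>u \<in> T\<close> unfolding T_def by blast
      have "z = fst z *\<^sub>R (1, 0) + (0, (fst (snd z), snd (snd z)))" by (simp add: prod_eq_iff)
      then have "k a b z = k a b (fst z *\<^sub>R (1, 0) + (0, (fst (snd z), snd (snd z))))" by simp
      also have "\<dots> = fst z * k a b (1, 0) + (R \<bullet> fst (snd z) + P \<bullet> snd (snd z))"
        unfolding *(2) linear_add[OF klin] linear_scale[OF klin] by simp
      finally show ?thesis unfolding z \<alpha>_def inner_prod_def k_def by (simp add: algebra_simps)
    qed
    moreover have "\<xi> = lifted_sharp \<alpha>" unfolding *(1) \<alpha>_def V_def lifted_sharp_def by simp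
    ultimately show ?l by blast
  qed
  have R: "\<xi> \<in> T \<inter> range lifted_sharp \<longleftrightarrow> (\<exists>a b. \<xi> = V a b (\<phi> (0, (a, b))) (\<eta> (0, (a, b))))" (is "?l \<longleftrightarrow> ?r") for \<xi>
  proof
    assume ?l
    then obtain z \<alpha> where z: "\<xi> = ((fst z, (fst (snd z), \<phi> z)), (0, (snd (snd z), \<eta> z)))" "\<xi> = lifted_sharp \<alpha>"
      unfolding T_def by blast
    then have "fst z = 0" unfolding lifted_sharp_def by simp
    then have "z = (0, (fst (snd z), snd (snd z)))" by (simp add: prod_eq_iff)
    with z(1) \<open>fst z = 0\<close> have "\<xi> = V (fst (snd z)) (snd (snd z)) (\<phi> (0, (fst (snd z), snd (snd z)))) (\<eta> (0, (fst (snd z), snd (snd z))))"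
      unfolding V_def by simp
    then show ?r by blast
  next
    assume ?r
    then obtain a b where ab: "\<xi> = V a b (\<phi> (0, (a, b))) (\<eta> (0, (a, b)))" by blast
    have "\<xi> \<in> T" unfolding T_def ab V_def by (rule range_eqI[of _ _ "(0, (a, b))"]) simp
    moreover have "\<xi> = lifted_sharp ((0, (\<eta> (0, (a, b)), - b)), (0, (\<phi> (0, (a, b)), - a)))"
      unfolding ab V_def lifted_sharp_def by simp
    ultimately show ?l by blast
  qed
  have Veq: "V a b P R = V a' b' P' R' \<longleftrightarrow> a = a' \<and> b = b' \<and> P = P' \<and> R = R'" for a b P R a' b' P' R'
    unfolding V_def by auto
  let ?sym = "\<forall>a b a' b'. \<eta> (0, (a, b)) \<bullet> a' + \<phi> (0, (a, b)) \<bullet> b' = k a b (0, (a', b'))"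
  have "lifted_sharp ` {\<alpha>. \<forall>u\<in>T. \<alpha> \<bullet> u = 0} = T \<inter> range lifted_sharp \<longleftrightarrow> ?sym"
  proof
    assume eq: "lifted_sharp ` {\<alpha>. \<forall>u\<in>T. \<alpha> \<bullet> u = 0} = T \<inter> range lifted_sharp"
    show ?sym
    proof (intro allI)
      fix a b a' b'
      have "V a b (\<phi> (0, (a, b))) (\<eta> (0, (a, b))) \<in> T \<inter> range lifted_sharp" unfolding R by blast
      then obtain a1 b1 P1 R1 where "V a b (\<phi> (0, (a, b))) (\<eta> (0, (a, b))) = V a1 b1 P1 R1"
        "\<forall>a' b'. R1 \<bullet> a' + P1 \<bullet> b' = k a1 b1 (0, (a', b'))" unfolding eq[symmetric] L by blast
      then show "\<eta> (0, (a, b)) \<bullet> a' + \<phi> (0, (a, b)) \<bullet> b' = k a b (0, (a', b'))" unfolding Veq by blast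
    qed
  next
    assume sym: ?sym
    show "lifted_sharp ` {\<alpha>. \<forall>u\<in>T. \<alpha> \<bullet> u = 0} = T \<inter> range lifted_sharp"
    proof (intro set_eqI iffI)
      fix \<xi> assume "\<xi> \<in> T \<inter> range lifted_sharp"
      then obtain a b where ab: "\<xi> = V a b (\<phi> (0, (a, b))) (\<eta> (0, (a, b)))" unfolding R by blast
      show "\<xi> \<in> lifted_sharp ` {\<alpha>. \<forall>u\<in>T. \<alpha> \<bullet> u = 0}" unfolding L using ab sym by blast
    next
      fix \<xi> assume "\<xi> \<in> lifted_sharp ` {\<alpha>. \<forall>u\<in>T. \<alpha> \<bullet> u = 0}"
      then obtain a b P R where *: "\<xi> = V a b P R" "\<And>a' b'. R \<bullet> a' + P \<bullet> b' = k a b (0, (a', b'))" unfolding L by blast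
      have "R \<bullet> a' = \<eta> (0, (a, b)) \<bullet> a'" for a' using *(2)[of a' 0] sym[rule_format, of a b a' 0] by simp
      then have RR: "R = \<eta> (0, (a, b))" using vector_eq_rdot by blast
      have "P \<bullet> b' = \<phi> (0, (a, b)) \<bullet> b'" for b' using *(2)[of 0 b'] sym[rule_format, of a b 0 b'] by simp
      then have "P = \<phi> (0, (a, b))" using vector_eq_rdot by blast
      with RR *(1) show "\<xi> \<in> T \<inter> range lifted_sharp" unfolding R by blast
    qed
  qed
  then show ?thesis unfolding k_def by (simp add: inner_commute add.commute)
qed

text \<open>A local diffeomorphism is smooth on small open sets by definition; this glues them to
  smoothness on all of \<open>U\<close>.\<close>

lemma smooth_map_union:
  assumes A: "smooth_atlas A" and B: "smooth_atlas B" and U: "open_subset A U"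
    and loc: "\<And>x. x \<in> U \<Longrightarrow> \<exists>V. x \<in> V \<and> V \<subseteq> U \<and> smooth_map A V B F"
  shows "smooth_map A U B F"
proof (rule smooth_mapI_local[OF A B U])
  fix x assume x: "x \<in> U"
  obtain V where V: "x \<in> V" "V \<subseteq> U" "smooth_map A V B F" using loc[OF x] by blast
  then have "x \<in> points A" "F x \<in> points B" unfolding smooth_map_def open_subset_def by auto
  then obtain c d where c: "c \<in> A" "x \<in> cdom c" and d: "d \<in> B" "F x \<in> cdom d" unfolding points_def by auto
  define W where "W = cmap c ` {x \<in> V \<inter> cdom c. F x \<in> cdom d}"
  have "open W" "smooth_on W (cmap d \<circ> F \<circ> cinv c)"
    using smooth_map_chart[OF V(3) c(1) d(1) W_def] .
  moreover have "F (cinv c y) \<in> cdom d" if "y \<in> W" for y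
    using that cinv_cmap[OF A c(1)] unfolding W_def by auto
  moreover have "cmap c x \<in> W" "W \<subseteq> cmap c ` (U \<inter> cdom c)" using V c d unfolding W_def by auto
  ultimately show "\<exists>c\<in>A. \<exists>d\<in>B. \<exists>W. x \<in> cdom c \<and> open W \<and> cmap c x \<in> W \<and> W \<subseteq> cmap c ` (U \<inter> cdom c) \<and>
       (\<forall>y\<in>W. F (cinv c y) \<in> cdom d) \<and> smooth_on W (cmap d \<circ> F \<circ> cinv c)"
    using c d by (intro bexI[of _ c] bexI[of _ d] exI[of _ W]) simp_all
qed

lemma smooth_along:
  assumes "open W" "smooth_on W f" "smooth_on W G"
  shows "smooth_on W (along G f)"
proof -
  have "smooth_on W (sode_vector G)"
    unfolding sode_vector_def[abs_def]
    by (intro smooth_on_Pair assms smooth_on_const smooth_on_bounded_linear[of "\<lambda>y. snd (snd y)"] bounded_linear_intros)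
  then have "smooth_on W (\<lambda>y. fderiv f ((\<lambda>y. y) y) (sode_vector G y))"
    by (intro smooth_on_fderiv_apply[OF assms(1,1,2), where g="\<lambda>y. y"]) auto
  then show ?thesis unfolding along_def[abs_def] .
qed

locale sode_field =
  fixes A :: "('q, 'e::euclidean_space) chart set"
    and \<Gamma> :: "('q, 'e) phase \<Rightarrow> ('q, 'e) phase \<times> (('q, 'e) phase, real \<times> ('e \<times> 'e)) comps"
  assumes atlas: "smooth_atlas A" and sode: "sode A \<Gamma>"
begin

section \<open>Coordinate expression of the SODE\<close>

lemma R_TQ: "smooth_atlas (R_TQ A)" and R_TstarQ: "smooth_atlas (R_TstarQ A)"
  and T_R_TstarQ: "smooth_atlas (tangent_atlas (R_TstarQ A))"
  using smooth_atlas_R_TQ[OF atlas] smooth_atlas_R_TstarQ[OF atlas] smooth_atlas_tangent[OF smooth_atlas_R_TstarQ[OF atlas]] .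

lemma natural_chart_in: "c \<in> A \<Longrightarrow> natural_chart A c \<in> R_TQ A"
  and momentum_chart_in: "c \<in> A \<Longrightarrow> momentum_chart A c \<in> R_TstarQ A"
  by (simp_all add: R_TQ_eq R_TstarQ_eq)

lemma \<Gamma>_at:
  assumes x: "x \<in> points (R_TQ A)"
  shows "fst (\<Gamma> x) = x" and "snd (\<Gamma> x) \<in> tangent_space (R_TQ A) x"
proof -
  have v: "smooth_map (R_TQ A) (points (R_TQ A)) (tangent_atlas (R_TQ A)) \<Gamma>" "fst (\<Gamma> x) = x"
    using sode x unfolding sode_def vector_field_def by blast+
  have "\<Gamma> x \<in> points (tangent_atlas (R_TQ A))" using v(1) x unfolding smooth_map_def by blast
  then show "snd (\<Gamma> x) \<in> tangent_space (R_TQ A) x" using v(2) by (simp add: points_tangent_iff)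
  show "fst (\<Gamma> x) = x" by (rule v(2))
qed

lemma \<Gamma>_chart:
  assumes c: "c \<in> A" and x: "x \<in> cdom (natural_chart A c)"
  shows "snd (\<Gamma> x) (natural_chart A c) = sode_vector (acceleration A \<Gamma> c) (cmap (natural_chart A c) x)"
proof -
  obtain t q qdot where y: "cmap (natural_chart A c) x = (t, (q, qdot))" by (metis prod.collapse)
  obtain dt dq dqdot where v: "snd (\<Gamma> x) (natural_chart A c) = (dt, (dq, dqdot))" by (metis prod.collapse)
  have "\<forall>x\<in>cdom (natural_chart A c).
        let (t, (q, qdot)) = cmap (natural_chart A c) x;
            (dt, (dq, dqdot)) = snd (\<Gamma> x) (natural_chart A c)
        in dq - dt *\<^sub>R qdot = 0 \<and> dt = 1" using sode c unfolding sode_def by blast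
  from bspec[OF this x] have "dq - dt *\<^sub>R qdot = 0 \<and> dt = 1" unfolding y v Let_def by simp
  then show ?thesis
    using cinv_cmap[OF R_TQ natural_chart_in[OF c] x] v unfolding sode_vector_def acceleration_def y[symmetric]
    by (simp add: y)
qed

lemma smooth_acceleration:
  assumes c: "c \<in> A"
  shows "smooth_on (cmap (natural_chart A c) ` cdom (natural_chart A c)) (acceleration A \<Gamma> c)"
proof -
  let ?N = "natural_chart A c" and ?T = "tangent_atlas (R_TQ A)"
  let ?TN = "tangent_chart (R_TQ A) ?N" and ?O = "cmap ?N ` cdom ?N"
  have O: "open ?O" using open_cdom[OF R_TQ natural_chart_in[OF c]] .
  have v: "smooth_map (R_TQ A) (points (R_TQ A)) ?T \<Gamma>" using sode unfolding sode_def vector_field_def by blast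
  have "x \<in> points (R_TQ A) \<and> \<Gamma> x \<in> cdom ?TN" if "x \<in> cdom ?N" for x
  proof -
    have x: "x \<in> points (R_TQ A)" using that natural_chart_in[OF c] by (auto simp: points_def)
    then show ?thesis using \<Gamma>_at[OF x] that by (simp add: tangent_chart_simps)
  qed
  then have e: "?O = cmap ?N ` {x \<in> points (R_TQ A) \<inter> cdom ?N. \<Gamma> x \<in> cdom ?TN}" by auto
  have TN: "?TN \<in> ?T" using natural_chart_in[OF c] by (simp add: tangent_atlas_def)
  have s: "smooth_on ?O (cmap ?TN \<circ> \<Gamma> \<circ> cinv ?N)" using smooth_map_chart(2)[OF v natural_chart_in[OF c] TN e] .
  have "smooth_on ?O (\<lambda>y. snd (snd (snd ((cmap ?TN \<circ> \<Gamma> \<circ> cinv ?N) y))))"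
    by (intro smooth_on_snd[OF O] s)
  then show ?thesis unfolding acceleration_def[abs_def] by (simp add: tangent_chart_simps)
qed

end

text \<open>The image of the lift is a graph for every smooth \<open>F\<close> over R x Q.
  Invertibility of \<open>F\<close> matters for regularity of the Lagrangian and enters in
  \<open>momentum_fibre_injective\<close>.\<close>

locale lifted_field = sode_field A \<Gamma>
  for A :: "('q, 'e::euclidean_space) chart set"
    and \<Gamma> :: "('q, 'e) phase \<Rightarrow> ('q, 'e) phase \<times> (('q, 'e) phase, real \<times> ('e \<times> 'e)) comps" +
  fixes U :: "('q, 'e) phase set" and F :: "('q, 'e) phase \<Rightarrow> ('q, 'e) phase"
  assumes U: "open_subset (R_TQ A) U" and F: "smooth_map (R_TQ A) U (R_TstarQ A) F" and over: "over_RQ U F"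
begin

definition "region c = cmap (natural_chart A c) ` (U \<inter> cdom (natural_chart A c))"

definition "momentum c = momentum_component A F c"

definition "momentum_rate c = along (acceleration A \<Gamma> c) (momentum c)"

definition "lift = tangent_map (R_TQ A) (R_TstarQ A) F \<circ> \<Gamma>"

text \<open>Coordinate expression (t, q, F_i, 1, qdot, \<Gamma>(F_i)) of
  \<open>lift\<close>.\<close>

definition "lift_chart c y = ((fst y, (fst (snd y), momentum c y)), (1 :: real, (snd (snd y), momentum_rate c y)))"

section \<open>Coordinate expressions of F and of its lift\<close>

lemma open_region: "c \<in> A \<Longrightarrow> open (region c)"
  unfolding region_def using open_subset_openD[OF U natural_chart_in] .

lemma U_points: "x \<in> U \<Longrightarrow> x \<in> points (R_TQ A)"
  using U unfolding open_subset_def by blast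

lemma F_points: "x \<in> U \<Longrightarrow> F x \<in> points (R_TstarQ A)"
  using F unfolding smooth_map_def by blast

lemma F_over: "x \<in> U \<Longrightarrow> fst (F x) = fst x \<and> fst (snd (F x)) = fst (snd x)"
  using over unfolding over_RQ_def by blast

text \<open>\<open>F\<close> covers the identity of R x Q, so one chart of Q serves both source and
  target and no shrinking of domains is needed.\<close>

lemma F_cdom_iff: "x \<in> U \<Longrightarrow> F x \<in> cdom (momentum_chart A c) \<longleftrightarrow> x \<in> cdom (natural_chart A c)"
  using F_points[of x] U_points[of x] F_over[of x] by (simp add: momentum_chart_simps natural_chart_simps points_R_TQ points_R_TstarQ)

lemma F_chart:
  assumes c: "c \<in> A" and y: "y \<in> region c"
  shows "(cmap (momentum_chart A c) \<circ> F \<circ> cinv (natural_chart A c)) y = (fst y, (fst (snd y), momentum c y))"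
proof -
  obtain x where x: "x \<in> U" "x \<in> cdom (natural_chart A c)" "y = cmap (natural_chart A c) x" using y unfolding region_def by auto
  then show ?thesis
    using F_over[OF x(1)] cinv_cmap[OF R_TQ natural_chart_in[OF c] x(2)]
    by (simp add: momentum_chart_simps natural_chart_simps momentum_def momentum_component_def)
qed

lemma smooth_F_chart:
  assumes c: "c \<in> A"
  shows "smooth_on (region c) (cmap (momentum_chart A c) \<circ> F \<circ> cinv (natural_chart A c))"
proof -
  have "U \<inter> cdom (natural_chart A c) = {x \<in> U \<inter> cdom (natural_chart A c). F x \<in> cdom (momentum_chart A c)}"
    using F_cdom_iff by blast
  then have "region c = cmap (natural_chart A c) ` {x \<in> U \<inter> cdom (natural_chart A c). F x \<in> cdom (momentum_chart A c)}"
    unfolding region_def by (rule arg_cong)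
  from smooth_map_chart(2)[OF F natural_chart_in[OF c] momentum_chart_in[OF c] this] show ?thesis .
qed

lemma smooth_momentum:
  assumes c: "c \<in> A" shows "smooth_on (region c) (momentum c)"
proof -
  have "smooth_on (region c) (\<lambda>y. snd (snd ((cmap (momentum_chart A c) \<circ> F \<circ> cinv (natural_chart A c)) y)))"
    by (intro smooth_on_snd[OF open_region[OF c]] smooth_F_chart[OF c])
  moreover have "smooth_on (region c) (\<lambda>y. snd (snd ((cmap (momentum_chart A c) \<circ> F \<circ> cinv (natural_chart A c)) y)))
    \<longleftrightarrow> smooth_on (region c) (momentum c)"
    by (rule smooth_on_cong[OF open_region[OF c]]) (simp only: F_chart[OF c] snd_conv)
  ultimately show ?thesis by blast
qed

lemma smooth_momentum_rate:
  assumes c: "c \<in> A" shows "smooth_on (region c) (momentum_rate c)"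
  unfolding momentum_rate_def
  by (rule smooth_along[OF open_region[OF c] smooth_momentum[OF c] smooth_on_subset[OF smooth_acceleration[OF c]]])
    (auto simp: region_def)

lemma smooth_lift_chart:
  assumes c: "c \<in> A" shows "smooth_on (region c) (lift_chart c)"
  unfolding lift_chart_def[abs_def]
  by (intro smooth_on_Pair[OF open_region[OF c]] smooth_momentum[OF c] smooth_momentum_rate[OF c] smooth_on_const
      smooth_on_bounded_linear[of fst] smooth_on_bounded_linear[of "\<lambda>y. fst (snd y)"] smooth_on_bounded_linear[of "\<lambda>y. snd (snd y)"]
      bounded_linear_intros)

lemma has_derivative_momentum:
  assumes "c \<in> A" "y \<in> region c"
  shows "(momentum c has_derivative fderiv (momentum c) y) (at y)"
    and "(momentum_rate c has_derivative fderiv (momentum_rate c) y) (at y)"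
  using smooth_on_has_derivative[OF smooth_momentum] smooth_on_has_derivative[OF smooth_momentum_rate] assms by blast+

lemma fderiv_F_chart:
  assumes c: "c \<in> A" and y: "y \<in> region c"
  shows "fderiv (cmap (momentum_chart A c) \<circ> F \<circ> cinv (natural_chart A c)) y u = (fst u, (fst (snd u), fderiv (momentum c) y u))"
proof -
  have "fderiv (cmap (momentum_chart A c) \<circ> F \<circ> cinv (natural_chart A c)) y = fderiv (\<lambda>y. (fst y, (fst (snd y), momentum c y))) y"
    by (rule fderiv_cong[OF open_region[OF c] y F_chart[OF c]])
  also have "\<dots> = (\<lambda>u. (fst u, (fst (snd u), fderiv (momentum c) y u)))"
    by (intro fderiv_eqI has_derivative_Pair has_derivative_momentum[OF c y] has_derivative_fst has_derivative_snd has_derivative_ident)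
  finally show ?thesis by simp
qed

lemma fderiv_lift_chart:
  assumes c: "c \<in> A" and y: "y \<in> region c"
  shows "fderiv (lift_chart c) y = (\<lambda>u. ((fst u, (fst (snd u), fderiv (momentum c) y u)), (0, (snd (snd u), fderiv (momentum_rate c) y u))))"
  unfolding lift_chart_def[abs_def]
  by (intro fderiv_eqI has_derivative_Pair has_derivative_momentum[OF c y] has_derivative_fst has_derivative_snd has_derivative_ident has_derivative_const)

lemma lift_at:
  assumes x: "x \<in> U" and c: "c \<in> A" "x \<in> cdom (natural_chart A c)"
  shows "fst (lift x) = F x" and "snd (lift x) \<in> tangent_space (R_TstarQ A) (F x)"
    and "cmap (tangent_chart (R_TstarQ A) (momentum_chart A c)) (lift x) = lift_chart c (cmap (natural_chart A c) x)"
proof -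
  have \<Gamma>x: "\<Gamma> x = (x, snd (\<Gamma> x))" using \<Gamma>_at(1)[OF U_points[OF x]] by (metis prod.collapse)
  have N: "natural_chart A c \<in> charts_at (R_TQ A) x" using c natural_chart_in by (simp add: charts_at_iff)
  have M: "momentum_chart A c \<in> charts_at (R_TstarQ A) (F x)"
    using c x F_cdom_iff momentum_chart_in by (simp add: charts_at_iff)
  have l: "lift x = tangent_map (R_TQ A) (R_TstarQ A) F (x, snd (\<Gamma> x))" unfolding lift_def using \<Gamma>x by simp
  show fst: "fst (lift x) = F x" unfolding l by (simp add: tangent_map_def)
  show "snd (lift x) \<in> tangent_space (R_TstarQ A) (F x)"
    unfolding l by (rule tangent_map_in[OF R_TQ R_TstarQ F x \<Gamma>_at(2)[OF U_points[OF x]] N])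
  define y where "y = cmap (natural_chart A c) x"
  have y: "y \<in> region c" using x c unfolding y_def region_def by blast
  have "snd (lift x) (momentum_chart A c) = fderiv (cmap (momentum_chart A c) \<circ> F \<circ> cinv (natural_chart A c)) y (snd (\<Gamma> x) (natural_chart A c))"
    unfolding l y_def by (rule tangent_map_chart[OF R_TQ R_TstarQ F x \<Gamma>_at(2)[OF U_points[OF x]] N M])
  also have "\<dots> = (1, (snd (snd y), momentum_rate c y))"
    unfolding fderiv_F_chart[OF c(1) y] \<Gamma>_chart[OF c] y_def[symmetric] momentum_rate_def along_def
    by (simp add: sode_vector_def)
  moreover have "cmap (momentum_chart A c) (F x) = (fst y, (fst (snd y), momentum c y))"
    using F_chart[OF c(1) y] cinv_cmap[OF R_TQ natural_chart_in[OF c(1)] c(2)] by (simp add: y_def)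
  ultimately show "cmap (tangent_chart (R_TstarQ A) (momentum_chart A c)) (lift x) = lift_chart c (cmap (natural_chart A c) x)"
    unfolding y_def[symmetric] lift_chart_def by (simp add: tangent_chart_simps fst)
qed

lemma lift_cdom:
  assumes x: "x \<in> U"
  shows "lift x \<in> cdom (tangent_chart (R_TstarQ A) (momentum_chart A c)) \<longleftrightarrow> x \<in> cdom (natural_chart A c)"
proof -
  obtain d where d: "d \<in> A" "x \<in> cdom (natural_chart A d)" using U_points[OF x] by (auto simp: points_def R_TQ_eq)
  show ?thesis using lift_at[OF x d] F_cdom_iff[OF x] by (simp add: tangent_chart_simps)
qed

lemma lift_image:
  assumes c: "c \<in> A"
  shows "cmap (tangent_chart (R_TstarQ A) (momentum_chart A c)) ` (lift ` U \<inter> cdom (tangent_chart (R_TstarQ A) (momentum_chart A c)))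
    = lift_chart c ` region c"
proof -
  have "lift ` U \<inter> cdom (tangent_chart (R_TstarQ A) (momentum_chart A c)) = lift ` (U \<inter> cdom (natural_chart A c))"
    using lift_cdom by blast
  then show ?thesis unfolding region_def
    by (simp only: image_image) (rule image_cong[OF refl], rule lift_at(3)[OF _ c], auto)
qed

text \<open>Reads (t, q, qdot) off a point of the image: a linear left inverse of every
  \<open>lift_chart c\<close>. The velocity components of the lift keep qdot, which makes the image
  an embedded graph.\<close>

definition "base_part \<xi> = (fst (fst \<xi>), (fst (snd (fst \<xi>)), fst (snd (snd \<xi>))))"
  for \<xi> :: "(real \<times> ('e \<times> 'e)) \<times> (real \<times> ('e \<times> 'e))"

lemma base_part_lift_chart: "base_part (lift_chart c y) = y"
  unfolding base_part_def lift_chart_def by simp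

lemma bounded_linear_base_part: "bounded_linear base_part"
  unfolding base_part_def[abs_def] by (intro bounded_linear_intros)

lemma lift_in_points: "lift ` U \<subseteq> points (tangent_atlas (R_TstarQ A))"
proof
  fix w assume "w \<in> lift ` U"
  then obtain x where x: "x \<in> U" "w = lift x" by blast
  obtain d where d: "d \<in> A" "x \<in> cdom (natural_chart A d)" using U_points[OF x(1)] by (auto simp: points_def R_TQ_eq)
  show "w \<in> points (tangent_atlas (R_TstarQ A))" using lift_at[OF x(1) d] F_points[OF x(1)] x(2) by (simp add: points_tangent_iff)
qed

lemma submanifold_lift: "submanifold (tangent_atlas (R_TstarQ A)) (lift ` U)"
proof (rule submanifold_graph[OF T_R_TstarQ lift_in_points bounded_linear_base_part])
  let ?\<iota> = "\<lambda>y :: real \<times> ('e \<times> 'e). ((fst y, (fst (snd y), 0 :: 'e)), (0 :: real, (snd (snd y), 0 :: 'e)))"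
  show "bounded_linear ?\<iota>" by (intro bounded_linear_intros)
  show "base_part (?\<iota> y) = y" for y by (simp add: base_part_def)
  fix w assume "w \<in> lift ` U"
  then obtain x where x: "x \<in> U" "w = lift x" by blast
  obtain c where c: "c \<in> A" "x \<in> cdom (natural_chart A c)" using U_points[OF x(1)] by (auto simp: points_def R_TQ_eq)
  show "\<exists>C\<in>tangent_atlas (R_TstarQ A). \<exists>W g. w \<in> cdom C \<and> open W \<and> smooth_on W g \<and> (\<forall>z\<in>W. base_part (g z) = z)
     \<and> cmap C ` (lift ` U \<inter> cdom C) = g ` W"
    using open_region[OF c(1)] smooth_lift_chart[OF c(1)] base_part_lift_chart lift_image[OF c(1)] lift_cdom[OF x(1)] c x(2)
      momentum_chart_in[OF c(1)]
    by (intro bexI[of _ "tangent_chart (R_TstarQ A) (momentum_chart A c)"] exI[of _ "region c"] exI[of _ "lift_chart c"])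
      (simp_all add: tangent_atlas_def)
qed

abbreviation "lagrangian_at w \<equiv>
  sharp (tangent_atlas (R_TstarQ A)) (tangent_poisson (R_TstarQ A) (R_TstarQ_poisson A)) w `
    annihilator (tangent_atlas (R_TstarQ A)) w (submanifold_tangent_space (tangent_atlas (R_TstarQ A)) (lift ` U) w)
  = submanifold_tangent_space (tangent_atlas (R_TstarQ A)) (lift ` U) w
    \<inter> characteristic_distribution (tangent_atlas (R_TstarQ A)) (tangent_poisson (R_TstarQ A) (R_TstarQ_poisson A)) w"

lemma lagrangian_at_iff:
  assumes x: "x \<in> U" and c: "c \<in> A" "x \<in> cdom (natural_chart A c)"
  shows "lagrangian_at (lift x) \<longleftrightarrow> closed_at (momentum_rate c) (momentum c) (cmap (natural_chart A c) x)"
proof -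
  let ?T = "tangent_atlas (R_TstarQ A)" and ?C = "tangent_chart (R_TstarQ A) (momentum_chart A c)"
  let ?S = "submanifold_tangent_space ?T (lift ` U) (lift x)"
  define y where "y = cmap (natural_chart A c) x"
  have y: "y \<in> region c" using x c unfolding y_def region_def by blast
  have C: "?C \<in> charts_at ?T (lift x)"
    using lift_cdom[OF x, of c] c momentum_chart_in[OF c(1)] by (simp add: charts_at_iff tangent_atlas_def)
  have rep: "represented_by ?T (tangent_poisson (R_TstarQ A) (R_TstarQ_poisson A)) (tangent_form canonical_form)"
    by (rule tangent_poisson_represented[OF R_TstarQ R_TstarQ_poisson_represented[OF atlas] bounded_bilinear_canonical_form canonical_form_antisym])
  have b: "base_part (cmap ?C (lift x)) = y"
    unfolding lift_at(3)[OF x c] base_part_lift_chart y_def ..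
  have "(\<lambda>v. v ?C) ` ?S = range (fderiv (lift_chart c) y)"
    using tangent_space_graph[OF T_R_TstarQ C imageI[OF x] bounded_linear_base_part open_region[OF c(1)] smooth_lift_chart[OF c(1)]
        base_part_lift_chart lift_image[OF c(1)]] unfolding b .
  then have T: "(\<lambda>v. v ?C) ` ?S = range (\<lambda>u. ((fst u, (fst (snd u), fderiv (momentum c) y u)), (0, (snd (snd u), fderiv (momentum_rate c) y u))))"
    unfolding fderiv_lift_chart[OF c(1) y] .
  have lin: "linear (fderiv (momentum c) y)" "linear (fderiv (momentum_rate c) y)"
    using has_derivative_linear[OF has_derivative_momentum(1)[OF c(1) y]] has_derivative_linear[OF has_derivative_momentum(2)[OF c(1) y]] .
  show ?thesis
    unfolding lagrangian_chart_iff[OF T_R_TstarQ rep tangent_form_canonical_sharp C submanifold_tangent_space_subset[OF T_R_TstarQ]] T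
      lagrangian_subspace_iff[OF lin] closed_at_def y_def[symmetric] ..
qed

lemma lagrangian_iff:
  "lagrangian_submanifold (tangent_atlas (R_TstarQ A)) (tangent_poisson (R_TstarQ A) (R_TstarQ_poisson A)) (lift ` U)
    \<longleftrightarrow> (\<forall>x\<in>U. lagrangian_at (lift x))"
  unfolding lagrangian_submanifold_def using submanifold_lift by auto

end

section \<open>Inverse functions and primitives\<close>

lemma linear_parts:
  fixes T :: "'a::real_vector \<times> ('b::real_vector \<times> 'c::real_vector) \<Rightarrow> 'd::real_vector"
  assumes "linear T"
  shows "T u = T (fst u, (fst (snd u), 0)) + T (0, (0, snd (snd u)))"
  using linear_add[OF assms, of "(fst u, (fst (snd u), 0))" "(0, (0, snd (snd u)))"] by simp

text \<open>If the derivative of \<open>g\<close> is a smooth function of \<open>g\<close> itself,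
  each order of differentiability of \<open>g\<close> yields the next.\<close>

lemma smooth_on_bootstrap:
  fixes g :: "'a::real_normed_vector \<Rightarrow> 'b::euclidean_space"
  assumes V: "open V" and O: "open O'" and g: "g ` V \<subseteq> O'" "\<And>z. z \<in> V \<Longrightarrow> (g has_derivative g' z) (at z)"
    and S: "\<And>w. smooth_on O' (S w)" "\<And>z w. z \<in> V \<Longrightarrow> g' z w = S w (g z)"
  shows "smooth_on V g"
proof -
  have "Ck_on k V g" for k
  proof (induction k)
    case 0
    have "isCont g z" if "z \<in> V" for z using has_derivative_continuous[OF g(2)[OF that]] .
    then show ?case by (simp add: continuous_at_imp_continuous_on)
  next
    case (Suc k)
    show ?case
    proof (rule Ck_on_SucI[OF V g(2)])
      fix w
      have "Ck_on k O' (S w)" using S(1) unfolding smooth_on_def by blast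
      then have "Ck_on k V (\<lambda>z. S w (g z))" by (rule Ck_on_compose[OF V O g(1) Suc])
      moreover have "Ck_on k V (\<lambda>z. g' z w) \<longleftrightarrow> Ck_on k V (\<lambda>z. S w (g z))"
        by (rule Ck_on_cong[OF V]) (rule S(2))
      ultimately show "Ck_on k V (\<lambda>z. g' z w)" by blast
    qed
  qed
  then show ?thesis by (simp add: smooth_on_def)
qed

text \<open>The Jacobian matrix of \<open>f\<close> with respect to qdot; row \<open>i\<close>,
  column \<open>j\<close> is the derivative of \<open>f_i\<close> by qdot^j.\<close>

definition fibre_matrix :: "(real \<times> ((real^'n) \<times> (real^'n)) \<Rightarrow> real^'n) \<Rightarrow> real \<times> ((real^'n) \<times> (real^'n)) \<Rightarrow> real^'n^'n" where
  "fibre_matrix f y = matrix (\<lambda>b. fderiv f y (0, (0, b)))"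

lemma fibre_matrix_works:
  assumes "f differentiable (at y)"
  shows "fibre_matrix f y *v b = fderiv f y (0, (0, b))"
proof -
  have l: "linear (fderiv f y)" using linear_fderiv[OF assms] .
  have "linear (\<lambda>b. fderiv f y (0, (0, b)))"
  proof (rule linearI)
    show "fderiv f y (0, (0, b + b')) = fderiv f y (0, (0, b)) + fderiv f y (0, (0, b'))" for b b'
      using linear_add[OF l, of "(0, (0, b))" "(0, (0, b'))"] by simp
    show "fderiv f y (0, (0, r *\<^sub>R b)) = r *\<^sub>R fderiv f y (0, (0, b))" for r b
      using linear_scale[OF l, of r "(0, (0, b))"] by simp
  qed
  then show ?thesis unfolding fibre_matrix_def by (simp add: matrix_works linear_matrix_vector_mul_eq)
qed

text \<open>The inverse function theorem provides an inverse that is only known to be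
  differentiable. Cramer's rule writes the inverse of its derivative as a smooth function of the
  point, and \<open>smooth_on_bootstrap\<close> then makes the inverse smooth.\<close>

lemma fibrewise_inverse:
  fixes f :: "real \<times> ((real^'n) \<times> (real^'n)) \<Rightarrow> real^'n::finite"
  assumes O: "open O'" and f: "smooth_on O' f" and y0: "y0 \<in> O'" and inv: "invertible (fibre_matrix f y0)"
  defines "\<Phi> \<equiv> \<lambda>y. (fst y, (fst (snd y), f y))"
  obtains U V \<Psi> where "open U" "U \<subseteq> O'" "y0 \<in> U" "open V" "\<Phi> ` U = V" "\<Psi> ` V = U" "smooth_on V \<Psi>"
    "\<forall>y\<in>U. \<Psi> (\<Phi> y) = y" "\<forall>z\<in>V. \<Phi> (\<Psi> z) = z"
proof -
  define M where "M = fibre_matrix f"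
  have M: "M y *v b = fderiv f y (0, (0, b))" if "y \<in> O'" for y b
    unfolding M_def using fibre_matrix_works[OF smooth_on_differentiable[OF f that]] .
  have sM: "smooth_on O' (\<lambda>y. M y $ i $ j)" for i j
  proof -
    have "M y $ i $ j = fderiv f y (0, (0, axis j 1)) $ i" if "y \<in> O'" for y
      using M[OF that, of "axis j 1"] by (simp add: matrix_vector_mult_basis column_def vec_eq_iff)
    moreover have "smooth_on O' (\<lambda>y. fderiv f y (0, (0, axis j 1)) $ i)"
      by (rule smooth_on_vec_nth[OF O smooth_on_fderiv[OF f]])
    ultimately show ?thesis using smooth_on_cong[OF O, of "\<lambda>y. M y $ i $ j" "\<lambda>y. fderiv f y (0, (0, axis j 1)) $ i"] by simp
  qed
  have sdet: "smooth_on O' (\<lambda>y. det (M y))" by (rule smooth_on_det[OF O sM])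
  \<comment> \<open>Nonvanishing determinant is required at every point of the image of the inverse,
    not only at \<open>y0\<close>, so that the formula for its derivative holds throughout.\<close>
  define O1 where "O1 = O' \<inter> (\<lambda>y. det (M y)) -` (- {0})"
  have O1: "open O1" unfolding O1_def
    by (rule continuous_open_preimage[OF smooth_on_continuous_on[OF sdet] O]) (simp add: open_Compl)
  have O1O: "O1 \<subseteq> O'" and nz: "\<And>y. y \<in> O1 \<Longrightarrow> det (M y) \<noteq> 0" unfolding O1_def by auto
  have y1: "y0 \<in> O1" using y0 inv unfolding O1_def M_def by (simp add: invertible_det_nz)
  have f1: "smooth_on O1 f" using smooth_on_subset[OF f O1O] .
  define D where "D = (\<lambda>y u. (fst u, (fst (snd u), fderiv f y u)))"
  have d\<Phi>: "(\<Phi> has_derivative D y) (at y)" if "y \<in> O1" for y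
    unfolding \<Phi>_def D_def
    by (intro has_derivative_Pair has_derivative_fst has_derivative_snd has_derivative_ident smooth_on_has_derivative[OF f1 that])
  define f' where "f' y = Blinfun (D y)" for y
  have f': "blinfun_apply (f' y) = D y" if "y \<in> O1" for y
    unfolding f'_def using has_derivative_bounded_linear[OF d\<Phi>[OF that]] by (rule bounded_linear_Blinfun_apply)
  have cont: "continuous_on O1 f'"
  \<comment> \<open>The theorem asks for continuity in operator norm; in finite dimension it can be
    checked on each vector.\<close>
  proof (rule continuous_on_blinfun_componentwise)
    fix i :: "real \<times> ((real^'n) \<times> (real^'n))"
    have "continuous_on O1 (\<lambda>y. D y i)" unfolding D_def
      by (intro continuous_intros smooth_on_continuous_on smooth_on_fderiv f1)
    then show "continuous_on O1 (\<lambda>y. blinfun_apply (f' y) i)" by (rule continuous_on_eq) (simp add: f')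
  qed
  \<comment> \<open>The solution \<open>u\<close> of \<open>D y u = w\<close>: the first two
    components are copied, and the last solves a linear system with matrix \<open>M y\<close> by
    Cramer's rule.\<close>
  define S where "S = (\<lambda>w y. (fst w, (fst (snd w), \<chi> k. det (\<chi> i j. if j = k
      then (snd (snd w) - fderiv f y (fst w, (fst (snd w), 0))) $ i else M y $ i $ j) / det (M y))))"
  have DS: "D y u = w \<longleftrightarrow> u = S w y" if "y \<in> O1" for y u w
  proof -
    have lin: "linear (fderiv f y)" using smooth_on_linear_fderiv[OF f1 that] .
    have "D y u = w \<longleftrightarrow> fst u = fst w \<and> fst (snd u) = fst (snd w) \<and> M y *v snd (snd u) = snd (snd w) - fderiv f y (fst w, (fst (snd w), 0))"
      unfolding D_def prod_eq_iff fst_conv snd_conv using linear_parts[OF lin, of u] M[of y "snd (snd u)"] that O1O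
      by (auto simp: algebra_simps)
    also have "\<dots> \<longleftrightarrow> u = S w y"
      unfolding cramer[OF nz[OF that]] S_def prod_eq_iff by auto
    finally show ?thesis .
  qed
  have linD: "linear (D y0)" using d\<Phi>[OF y1] has_derivative_linear by blast
  have "inj (D y0)" by (rule injI) (metis DS[OF y1])
  then obtain g0 where g0: "linear g0" "g0 \<circ> D y0 = id" using linear_injective_left_inverse[OF linD] by blast
  have invf: "Blinfun g0 o\<^sub>L f' y0 = id_blinfun"
  proof (rule blinfun_eqI)
    fix i
    have "blinfun_apply (Blinfun g0) = g0" using g0(1) by (simp add: bounded_linear_Blinfun_apply linear_conv_bounded_linear)
    then show "blinfun_apply (Blinfun g0 o\<^sub>L f' y0) i = blinfun_apply id_blinfun i"
      using g0(2) f'[OF y1] by (simp add: fun_eq_iff)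
  qed
  have der: "(\<Phi> has_derivative blinfun_apply (f' y)) (at y)" if "y \<in> O1" for y using d\<Phi>[OF that] f'[OF that] by simp
  obtain U V g g' where UV: "open U" "U \<subseteq> O1" "y0 \<in> U" "open V" "\<Phi> y0 \<in> V" "homeomorphism U V \<Phi> g"
    "\<And>z. z \<in> V \<Longrightarrow> (g has_derivative (g' z)) (at z)" "\<And>z. z \<in> V \<Longrightarrow> g' z = inv (blinfun_apply (f' (g z)))"
    "\<And>z. z \<in> V \<Longrightarrow> bij (blinfun_apply (f' (g z)))"
    using inverse_function_theorem[OF O1 der cont y1 invf] by metis
  have hom: "\<Phi> ` U = V" "g ` V = U" "\<And>y. y \<in> U \<Longrightarrow> g (\<Phi> y) = y" "\<And>z. z \<in> V \<Longrightarrow> \<Phi> (g z) = z"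
    using UV(6) unfolding homeomorphism_def by auto
  have gO: "g z \<in> O1" if "z \<in> V" for z using hom(2) UV(2) that by blast
  have gS: "g' z w = S w (g z)" if "z \<in> V" for z w
  proof -
    have "D (g z) (g' z w) = w"
      unfolding UV(8)[OF that] f'[OF gO[OF that]]
      using UV(9)[OF that] unfolding f'[OF gO[OF that]] by (simp add: bij_is_surj surj_f_inv_f)
    then show ?thesis using DS[OF gO[OF that]] by blast
  qed
  have sS: "smooth_on O1 (S w)" for w
  proof -
    have sM1: "smooth_on O1 (\<lambda>y. M y $ i $ j)" for i j by (rule smooth_on_subset[OF sM O1O])
    have s3: "smooth_on O1 (\<lambda>y. (snd (snd w) - fderiv f y (fst w, (fst (snd w), 0))) $ i)" for i
      by (intro smooth_on_vec_nth[OF O1] smooth_on_diff[OF O1] smooth_on_const smooth_on_fderiv[OF f1])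
    have "smooth_on O1 (\<lambda>y. (\<chi> i j. if j = k
      then (snd (snd w) - fderiv f y (fst w, (fst (snd w), 0))) $ i else M y $ i $ j) $ i $ j)" for i j k
      using s3[of i] sM1[of i j] by (cases "j = k") simp_all
    then have s1: "smooth_on O1 (\<lambda>y. det (\<chi> i j. if j = k
      then (snd (snd w) - fderiv f y (fst w, (fst (snd w), 0))) $ i else M y $ i $ j))" for k
      by (rule smooth_on_det[OF O1])
    have s2: "smooth_on O1 (\<lambda>y. inverse (det (M y)))"
      by (rule smooth_on_inverse[OF O1 nz smooth_on_subset[OF sdet O1O]])
    have s3: "smooth_on O1 (\<lambda>y. det (\<chi> i j. if j = k
      then (snd (snd w) - fderiv f y (fst w, (fst (snd w), 0))) $ i else M y $ i $ j) / det (M y))" for k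
      unfolding divide_inverse by (rule smooth_on_mult[OF O1 s1 s2])
    show ?thesis unfolding S_def
      by (intro smooth_on_Pair[OF O1] smooth_on_const smooth_on_vec[OF O1]) (simp add: s3)
  qed
  have "smooth_on V g"
    by (rule smooth_on_bootstrap[OF UV(4) O1 _ UV(7) sS gS]) (use gO in auto)
  then show ?thesis
    using that[of U V g] UV(1-4) O1O hom by blast
qed

text \<open>Differentiation under the integral sign. The open set \<Omega> reaches beyond s = 0 and
  s = 1, so the derivatives of \<open>K\<close> are two-sided at the endpoints too.\<close>

lemma has_derivative_integral_parameter:
  fixes K :: "'a::euclidean_space \<times> real \<Rightarrow> 'b::euclidean_space"
  assumes \<Omega>: "open \<Omega>" and K: "smooth_on \<Omega> K" and B: "open B" "convex B" "B \<times> {0..1} \<subseteq> \<Omega>" and y: "y \<in> B"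
  shows "((\<lambda>y. integral {0..1} (\<lambda>s. K (y, s))) has_derivative (\<lambda>v. integral {0..1} (\<lambda>s. fderiv K (y, s) (v, 0)))) (at y)"
proof -
  define D where "D y s = Blinfun (\<lambda>v. fderiv K (y, s) (v, 0))" for y s
  have in\<Omega>: "(y, s) \<in> \<Omega>" if "y \<in> B" "s \<in> {0..1}" for y s using that B(3) by blast
  have der: "((\<lambda>y. K (y, s)) has_derivative (\<lambda>v. fderiv K (y, s) (v, 0))) (at y)" if "y \<in> B" "s \<in> {0..1}" for y s
    by (rule has_derivative_compose[of "\<lambda>y. (y, s)" "\<lambda>v. (v, 0)"])
      (auto intro!: derivative_eq_intros smooth_on_has_derivative[OF K in\<Omega>[OF that]])
  have D: "blinfun_apply (D y s) = (\<lambda>v. fderiv K (y, s) (v, 0))" if "y \<in> B" "s \<in> {0..1}" for y s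
    unfolding D_def using has_derivative_bounded_linear[OF der[OF that]] by (rule bounded_linear_Blinfun_apply)
  have cK: "continuous_on (B \<times> {0..1}) K" using smooth_on_continuous_on[OF K] B(3) continuous_on_subset by blast
  have cD: "continuous_on (B \<times> {0..1}) (\<lambda>(y, s). D y s)"
  proof (rule continuous_on_blinfun_componentwise)
    fix i :: 'a
    have "continuous_on (B \<times> {0..1}) (\<lambda>z. fderiv K z (i, 0))"
      using smooth_on_continuous_on[OF smooth_on_fderiv[OF K]] B(3) continuous_on_subset by blast
    then show "continuous_on (B \<times> {0..1}) (\<lambda>z. blinfun_apply (case z of (y, s) \<Rightarrow> D y s) i)"
      by (rule continuous_on_eq) (auto simp: D)
  qed
  have sec: "continuous_on {0..1} (\<lambda>s. h (y, s))" if "continuous_on (B \<times> {0..1}) h" "y \<in> B" for h :: "'a \<times> real \<Rightarrow> 'c::topological_space" and y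
    by (rule continuous_on_compose2[OF that(1)]) (use that(2) in \<open>auto intro!: continuous_intros\<close>)
  have "((\<lambda>y. integral (cbox 0 1) (\<lambda>s. K (y, s))) has_derivative blinfun_apply (integral (cbox 0 1) (D y))) (at y within B)"
  proof (rule leibniz_rule[OF _ _ _ y B(2)])
    fix y' s assume "y' \<in> B" "s \<in> cbox 0 (1 :: real)"
    then show "((\<lambda>y. K (y, s)) has_derivative blinfun_apply (D y' s)) (at y' within B)"
      using der D by (simp add: has_derivative_at_withinI)
  next
    fix y' assume "y' \<in> B"
    then show "(\<lambda>s. K (y', s)) integrable_on cbox 0 1" using sec[OF cK] by (auto intro!: integrable_continuous_interval)
  qed (use cD in simp)
  moreover have "at y within B = at y" using y B(1) by (rule at_within_open)
  moreover have "blinfun_apply (integral {0..1} (D y)) = (\<lambda>v. integral {0..1} (\<lambda>s. fderiv K (y, s) (v, 0)))"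
  proof
    fix v
    have "D y integrable_on {0..1}" using sec[OF cD y] by (auto intro!: integrable_continuous_interval)
    then have "blinfun_apply (integral {0..1} (D y)) v = integral {0..1} (\<lambda>s. blinfun_apply (D y s) v)"
      by (rule blinfun_apply_integral)
    also have "\<dots> = integral {0..1} (\<lambda>s. fderiv K (y, s) (v, 0))"
      by (rule integral_cong) (simp add: D[OF y])
    finally show "blinfun_apply (integral {0..1} (D y)) v = integral {0..1} (\<lambda>s. fderiv K (y, s) (v, 0))" .
  qed
  ultimately show ?thesis by simp
qed

text \<open>Each derivative is again a parameter integral with a smooth integrand on the same
  \<Omega>, so the induction closes.\<close>

lemma smooth_on_integral_parameter:
  fixes K :: "'a::euclidean_space \<times> real \<Rightarrow> 'b::euclidean_space"
  assumes \<Omega>: "open \<Omega>" and K: "smooth_on \<Omega> K" and B: "open B" "convex B" "B \<times> {0..1} \<subseteq> \<Omega>"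
  shows "smooth_on B (\<lambda>y. integral {0..1} (\<lambda>s. K (y, s)))"
proof -
  have "Ck_on k B (\<lambda>y. integral {0..1} (\<lambda>s. K (y, s)))" if "smooth_on \<Omega> K" for k and K :: "'a \<times> real \<Rightarrow> 'b"
    using that
  proof (induction k arbitrary: K)
    case 0
    have "isCont (\<lambda>y. integral {0..1} (\<lambda>s. K (y, s))) y" if "y \<in> B" for y
      using has_derivative_continuous[OF has_derivative_integral_parameter[OF \<Omega> 0 B that]] .
    then show ?case by (simp add: continuous_at_imp_continuous_on)
  next
    case (Suc k)
    show ?case
    proof (rule Ck_on_SucI[OF B(1)])
      fix y assume "y \<in> B"
      then show "((\<lambda>y. integral {0..1} (\<lambda>s. K (y, s))) has_derivative (\<lambda>v. integral {0..1} (\<lambda>s. fderiv K (y, s) (v, 0)))) (at y)"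
        by (rule has_derivative_integral_parameter[OF \<Omega> Suc.prems B])
    next
      show "Ck_on k B (\<lambda>y. integral {0..1} (\<lambda>s. fderiv K (y, s) (v, 0)))" for v
        by (rule Suc.IH[OF smooth_on_fderiv[OF Suc.prems]])
    qed
  qed
  then show ?thesis using K unfolding smooth_on_def by blast
qed

text \<open>The primitive is l(t, z), the integral over s from 0 to 1 of \<theta>(t, z0 + s(z - z0))
  \<bullet> (z - z0): the segment runs in z alone while t stays fixed, and hence only closedness in
  z is involved.\<close>

lemma closed_form_primitive:
  fixes \<theta> :: "real \<times> 'z::euclidean_space \<Rightarrow> 'z"
  assumes \<Omega>: "open \<Omega>" and \<theta>: "smooth_on \<Omega> \<theta>" and y0: "y0 \<in> \<Omega>"
    and closed: "\<And>y \<zeta> \<zeta>'. y \<in> \<Omega> \<Longrightarrow> fderiv \<theta> y (0, \<zeta>) \<bullet> \<zeta>' = fderiv \<theta> y (0, \<zeta>') \<bullet> \<zeta>"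
  obtains B l where "open B" "B \<subseteq> \<Omega>" "y0 \<in> B" "smooth_on B l" "\<And>y \<zeta>. y \<in> B \<Longrightarrow> fderiv l y (0, \<zeta>) = \<theta> y \<bullet> \<zeta>"
proof -
  obtain r where r: "r > 0" "ball y0 r \<subseteq> \<Omega>" using \<Omega> y0 open_contains_ball by blast
  define B where "B = ball y0 r"
  define z0 where "z0 = snd y0"
  define p where "p = (\<lambda>w :: (real \<times> 'z) \<times> real. (fst (fst w), z0 + snd w *\<^sub>R (snd (fst w) - z0)))"
  define W where "W = p -` B"
  define K where "K = (\<lambda>w. \<theta> (p w) \<bullet> (snd (fst w) - z0))"
  define l where "l = (\<lambda>y. integral {0..1} (\<lambda>s. K (y, s)))"
  have B: "open B" "convex B" "B \<subseteq> \<Omega>" "y0 \<in> B" using r unfolding B_def by auto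
  have "continuous_on UNIV p" unfolding p_def by (intro continuous_intros)
  then have W: "open W" unfolding W_def using B(1) open_vimage by blast
  have BW: "B \<times> {0..1} \<subseteq> W"
  proof
    fix w :: "(real \<times> 'z) \<times> real" assume "w \<in> B \<times> {0..1}"
    then obtain y s where w: "w = (y, s)" "y \<in> B" "0 \<le> s" "s \<le> 1" by auto
    \<comment> \<open>Replacing z by the central value z0 does not increase the distance to the
      centre of the ball; convexity then contains the whole segment.\<close>
    have "dist y0 (fst y, z0) \<le> dist y0 y" unfolding z0_def dist_prod_def by simp
    then have "(fst y, z0) \<in> B" using w(2) unfolding B_def by simp
    from convexD[OF B(2) this w(2), of "1 - s" s]
    have "(1 - s) *\<^sub>R (fst y, z0) + s *\<^sub>R y \<in> B" using w by simp
    moreover have "(1 - s) *\<^sub>R (fst y, z0) + s *\<^sub>R y = p w" unfolding p_def w(1) by (simp add: prod_eq_iff algebra_simps)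
    ultimately show "w \<in> W" by (simp add: W_def)
  qed
  have sB: "smooth_on B \<theta>" using smooth_on_subset[OF \<theta> B(3)] .
  have s_ff: "smooth_on W (\<lambda>w. fst (fst w))" "smooth_on W (\<lambda>w. snd (fst w))" "smooth_on W snd"
    by (intro smooth_on_bounded_linear bounded_linear_intros)+
  have s_d: "smooth_on W (\<lambda>w. snd (fst w) - z0)" by (intro smooth_on_diff[OF W] s_ff smooth_on_const)
  have sp: "smooth_on W p" unfolding p_def
    by (intro smooth_on_Pair[OF W] smooth_on_add[OF W] smooth_on_scaleR[OF W] s_ff s_d smooth_on_const)
  have sK: "smooth_on W K" unfolding K_def
    by (rule smooth_on_inner[OF W smooth_on_compose[OF W B(1) _ sp sB] s_d]) (auto simp: W_def)
  have sl: "smooth_on B l" unfolding l_def by (rule smooth_on_integral_parameter[OF W sK B(1,2) BW])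
  have dl: "fderiv l y (0, \<zeta>) = \<theta> y \<bullet> \<zeta>" if y: "y \<in> B" for y \<zeta>
  proof -
    define q where "q s = p (y, s)" for s
    have qB: "q s \<in> B" if "s \<in> {0..1}" for s
    proof -
      have "(y, s) \<in> W" using BW y that by blast
      then show ?thesis by (simp add: W_def q_def)
    qed
    have dK: "fderiv K (y, s) ((0, \<zeta>), 0) = s * (fderiv \<theta> (q s) (0, snd y - z0) \<bullet> \<zeta>) + \<theta> (q s) \<bullet> \<zeta>" if s: "s \<in> {0..1}" for s
    proof -
      have dth: "(\<theta> has_derivative fderiv \<theta> (q s)) (at (q s))" using smooth_on_has_derivative[OF sB qB[OF s]] .
      have dp: "(p has_derivative (\<lambda>v. (fst (fst v), s *\<^sub>R snd (fst v) + snd v *\<^sub>R (snd y - z0)))) (at (y, s))"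
        unfolding p_def by (auto intro!: derivative_eq_intros simp: fun_eq_iff)
      have "(K has_derivative (\<lambda>v. \<theta> (q s) \<bullet> snd (fst v) + fderiv \<theta> (q s) (fst (fst v), s *\<^sub>R snd (fst v) + snd v *\<^sub>R (snd y - z0)) \<bullet> (snd y - z0))) (at (y, s))"
        unfolding K_def q_def
        by (rule has_derivative_eq_rhs, rule has_derivative_inner[OF has_derivative_compose[OF dp dth[unfolded q_def]]
              has_derivative_diff[OF has_derivative_snd[OF has_derivative_fst[OF has_derivative_ident]] has_derivative_const]]) simp
      then have "fderiv K (y, s) ((0, \<zeta>), 0) = \<theta> (q s) \<bullet> \<zeta> + fderiv \<theta> (q s) (0, s *\<^sub>R \<zeta>) \<bullet> (snd y - z0)"
        by (simp add: fderiv_eqI)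
      \<comment> \<open>Closedness exchanges \<zeta> with the radial direction, which turns the
        integrand into the s-derivative of
        \<open>s * (\<theta> (q s) \<bullet> \<zeta>)\<close>.\<close>
      also have "fderiv \<theta> (q s) (0, s *\<^sub>R \<zeta>) \<bullet> (snd y - z0) = fderiv \<theta> (q s) (0, snd y - z0) \<bullet> (s *\<^sub>R \<zeta>)"
        using closed qB[OF s] B(3) by blast
      finally show ?thesis by simp
    qed
    \<comment> \<open>The factor s removes the boundary term at 0, and \<open>q 1 = y\<close> gives
      the required value at 1.\<close>
    have ftc: "((\<lambda>s. s * (fderiv \<theta> (q s) (0, snd y - z0) \<bullet> \<zeta>) + \<theta> (q s) \<bullet> \<zeta>) has_integral (1 * (\<theta> (q 1) \<bullet> \<zeta>) - 0 * (\<theta> (q 0) \<bullet> \<zeta>))) {0..1}"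
    proof (rule fundamental_theorem_of_calculus)
      fix s :: real assume s: "s \<in> {0..1}"
      have dth: "(\<theta> has_derivative fderiv \<theta> (q s)) (at (q s))" using smooth_on_has_derivative[OF sB qB[OF s]] .
      have dq: "(q has_derivative (\<lambda>h. (0, h *\<^sub>R (snd y - z0)))) (at s)"
        unfolding q_def p_def by (auto intro!: derivative_eq_intros)
      have lin: "linear (fderiv \<theta> (q s))" using has_derivative_linear[OF dth] .
      have e: "fderiv \<theta> (q s) (0, h *\<^sub>R (snd y - z0)) = h *\<^sub>R fderiv \<theta> (q s) (0, snd y - z0)" for h
        using linear_scale[OF lin, of h "(0, snd y - z0)"] by simp
      have "((\<lambda>s. s * (\<theta> (q s) \<bullet> \<zeta>)) has_derivative (\<lambda>h. s * (fderiv \<theta> (q s) (0, h *\<^sub>R (snd y - z0)) \<bullet> \<zeta>) + h * (\<theta> (q s) \<bullet> \<zeta>))) (at s)"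
        by (rule has_derivative_mult[OF has_derivative_ident has_derivative_inner_left[OF has_derivative_compose[OF dq dth]]])
      then have "((\<lambda>s. s * (\<theta> (q s) \<bullet> \<zeta>)) has_vector_derivative s * (fderiv \<theta> (q s) (0, snd y - z0) \<bullet> \<zeta>) + \<theta> (q s) \<bullet> \<zeta>) (at s)"
        unfolding has_vector_derivative_def e by (rule has_derivative_eq_rhs) (simp add: fun_eq_iff algebra_simps)
      then show "((\<lambda>s. s * (\<theta> (q s) \<bullet> \<zeta>)) has_vector_derivative s * (fderiv \<theta> (q s) (0, snd y - z0) \<bullet> \<zeta>) + \<theta> (q s) \<bullet> \<zeta>) (at s within {0..1})"
        by (rule has_vector_derivative_at_within)
    qed simp
    have "fderiv l y (0, \<zeta>) = integral {0..1} (\<lambda>s. fderiv K (y, s) ((0, \<zeta>), 0))"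
      unfolding l_def using fderiv_eqI[OF has_derivative_integral_parameter[OF W sK B(1,2) BW y]] by simp
    also have "\<dots> = integral {0..1} (\<lambda>s. s * (fderiv \<theta> (q s) (0, snd y - z0) \<bullet> \<zeta>) + \<theta> (q s) \<bullet> \<zeta>)"
      by (rule integral_cong) (rule dK)
    also have "\<dots> = \<theta> (q 1) \<bullet> \<zeta>" using integral_unique[OF ftc] by simp
    also have "q 1 = y" unfolding q_def p_def by simp
    finally show ?thesis .
  qed
  show ?thesis by (rule that[OF B(1,3,4) sl dl])
qed

section \<open>Change of natural coordinates\<close>

lemma natural_transition:
  assumes A: "smooth_atlas A" and c: "c \<in> A" "d \<in> A"
    and y: "y \<in> cmap (natural_chart A d) ` (cdom (natural_chart A d) \<inter> cdom (natural_chart A c))"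
  shows "transition (natural_chart A d) (natural_chart A c) y =
    (fst y, (transition d c (fst (snd y)), fderiv (transition d c) (fst (snd y)) (snd (snd y))))"
proof -
  obtain x where x: "x \<in> cdom (natural_chart A d)" "x \<in> cdom (natural_chart A c)" "y = cmap (natural_chart A d) x" using y by auto
  have "natural_chart A d \<in> R_TQ A" using c by (simp add: R_TQ_eq)
  then have "transition (natural_chart A d) (natural_chart A c) y = cmap (natural_chart A c) x"
    using transition_cmap[OF smooth_atlas_R_TQ[OF A] _ x(1)] x(3) by simp
  moreover have "snd (snd x) c = fderiv (transition d c) (cmap d (fst (snd x))) (snd (snd x) d)"
    using x c by (intro tangent_space_transform) (auto simp: natural_chart_simps charts_at_iff)
  ultimately show ?thesis
    using x c transition_cmap[OF A c(2)] by (simp add: natural_chart_simps)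
qed

lemma has_derivative_natural_transition:
  assumes A: "smooth_atlas A" and c: "c \<in> A" "d \<in> A"
    and y: "y \<in> cmap (natural_chart A d) ` (cdom (natural_chart A d) \<inter> cdom (natural_chart A c))"
  shows "(transition (natural_chart A d) (natural_chart A c) has_derivative
    (\<lambda>u. (fst u, (fderiv (transition d c) (fst (snd y)) (fst (snd u)),
       fderiv (\<lambda>z. fderiv (transition d c) z (snd (snd y))) (fst (snd y)) (fst (snd u)) + fderiv (transition d c) (fst (snd y)) (snd (snd u)))))) (at y)"
proof -
  let ?\<phi> = "transition d c" and ?O = "cmap d ` (cdom d \<inter> cdom c)"
  let ?W = "cmap (natural_chart A d) ` (cdom (natural_chart A d) \<inter> cdom (natural_chart A c))"
  have O: "open ?O" using open_overlap[OF A c(2,1)] .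
  have W: "?W = UNIV \<times> (?O \<times> UNIV)" by (rule natural_chart_overlap[OF A c(2,1)])
  have oW: "open ?W" unfolding W using O by (simp add: open_Times)
  have q: "fst (snd y) \<in> ?O" using y unfolding W by auto
  have s: "smooth_on ?O ?\<phi>" using smooth_transition[OF A c(2,1)] .
  have dq: "((\<lambda>y. fst (snd y)) has_derivative (\<lambda>u. fst (snd u))) (at y)"
    and dv: "((\<lambda>y. snd (snd y)) has_derivative (\<lambda>u. snd (snd u))) (at y)"
    by (intro has_derivative_fst has_derivative_snd has_derivative_ident)+
  have "((\<lambda>y. (fst y, (?\<phi> (fst (snd y)), fderiv ?\<phi> (fst (snd y)) (snd (snd y))))) has_derivative
    (\<lambda>u. (fst u, (fderiv ?\<phi> (fst (snd y)) (fst (snd u)),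
       fderiv (\<lambda>z. fderiv ?\<phi> z (snd (snd y))) (fst (snd y)) (fst (snd u)) + fderiv ?\<phi> (fst (snd y)) (snd (snd u)))))) (at y)"
    by (intro has_derivative_Pair has_derivative_fst[OF has_derivative_ident]
        has_derivative_compose[OF dq smooth_on_has_derivative[OF s q]] has_derivative_fderiv_apply[OF O q s dq dv])
  then show ?thesis
    using has_derivative_cong_open[OF oW y natural_transition[OF A c]] by (rule iffD2[rotated])
qed

context lifted_field
begin

lemma momentum_transform_chart:
  assumes c: "c \<in> A" "d \<in> A" and x: "x \<in> U" "x \<in> cdom (natural_chart A c)" "x \<in> cdom (natural_chart A d)"
  shows "momentum d (cmap (natural_chart A d) x) \<bullet> w =
    momentum c (cmap (natural_chart A c) x) \<bullet> fderiv (transition d c) (cmap d (fst (snd x))) w"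
proof -
  have "momentum d (cmap (natural_chart A d) x) = snd (snd (F x)) d" "momentum c (cmap (natural_chart A c) x) = snd (snd (F x)) c"
    using cinv_cmap[OF R_TQ natural_chart_in x(2)] cinv_cmap[OF R_TQ natural_chart_in x(3)] c
    by (simp_all add: momentum_def momentum_component_def)
  moreover have "snd (snd (F x)) \<in> cotangent_space A (fst (snd x))"
    using F_points[OF x(1)] F_over[OF x(1)] by (simp add: points_R_TstarQ)
  moreover have "c \<in> charts_at A (fst (snd x))" "d \<in> charts_at A (fst (snd x))"
    using x c by (auto simp: natural_chart_simps charts_at_iff)
  ultimately show ?thesis using cotangent_space_transform by metis
qed

text \<open>Chart independence of \<Gamma>(F_i) dq^i + F_i dqdot^i, the Lie derivative of F_i dq^i
  along \<Gamma>. Differentiating the transformation law of the momenta along \<Gamma> yields a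
  second derivative of the transition map; by symmetry it is the one in the velocity component of
  the derivative of \<open>T\<close>.\<close>

lemma momentum_rate_transform:
  assumes c: "c \<in> A" "d \<in> A" and x: "x \<in> U" "x \<in> cdom (natural_chart A c)" "x \<in> cdom (natural_chart A d)"
  defines "y \<equiv> cmap (natural_chart A d) x" and "T \<equiv> transition (natural_chart A d) (natural_chart A c)"
  shows "momentum_rate d y \<bullet> a + momentum d y \<bullet> b =
    momentum_rate c (T y) \<bullet> fst (snd (fderiv T y (0, (a, b)))) + momentum c (T y) \<bullet> snd (snd (fderiv T y (0, (a, b))))"
proof -
  let ?Nc = "natural_chart A c" and ?Nd = "natural_chart A d" and ?\<phi> = "transition d c"
  define q where "q = fst (snd y)"
  define v where "v = snd (snd y)"
  have q_eq: "q = cmap d (fst (snd x))" unfolding q_def y_def by (simp add: natural_chart_simps)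
  have Nx: "?Nc \<in> charts_at (R_TQ A) x" "?Nd \<in> charts_at (R_TQ A) x" using x natural_chart_in c by (simp_all add: charts_at_iff)
  have Ty: "T y = cmap ?Nc x" unfolding T_def y_def by (rule transition_cmap[OF R_TQ natural_chart_in[OF c(2)] x(3)])
  have yo: "y \<in> cmap ?Nd ` (cdom ?Nd \<inter> cdom ?Nc)" using x unfolding y_def by blast
  note dT = has_derivative_natural_transition[OF atlas c yo, folded T_def q_def v_def]
  have fT: "fderiv T y u = (fst u, (fderiv ?\<phi> q (fst (snd u)), fderiv (\<lambda>z. fderiv ?\<phi> z v) q (fst (snd u)) + fderiv ?\<phi> q (snd (snd u))))" for u
    using fderiv_eqI[OF dT] by (rule fun_cong)
  define W where "W = cmap ?Nd ` (U \<inter> cdom ?Nc \<inter> cdom ?Nd)"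
  have "open_subset (R_TQ A) (U \<inter> cdom ?Nc)"
    by (rule open_subset_Int[OF R_TQ U open_subset_cdom[OF R_TQ natural_chart_in[OF c(1)]]])
  then have W: "open W" "y \<in> W" using open_subset_openD[OF _ natural_chart_in[OF c(2)]] x unfolding W_def y_def by auto
  have "y \<in> region d" unfolding y_def region_def using x by blast
  moreover have "T y \<in> region c" unfolding Ty region_def using x by blast
  ultimately have yr: "y \<in> region d" "T y \<in> region c" .
  have O: "open (cmap d ` (cdom d \<inter> cdom c))" "q \<in> cmap d ` (cdom d \<inter> cdom c)" and s: "smooth_on (cmap d ` (cdom d \<inter> cdom c)) ?\<phi>"
    using open_overlap[OF atlas c(2,1)] smooth_transition[OF atlas c(2,1)] x unfolding q_eq by (auto simp: natural_chart_simps)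
  have dq: "((\<lambda>y. fst (snd y)) has_derivative (\<lambda>u. fst (snd u))) (at y)"
    by (intro has_derivative_fst has_derivative_snd has_derivative_ident)
  have eq: "momentum d y' \<bullet> w = momentum c (T y') \<bullet> fderiv ?\<phi> (fst (snd y')) w" if y': "y' \<in> W" for y' w
  proof -
    obtain x' where x': "x' \<in> U" "x' \<in> cdom ?Nc" "x' \<in> cdom ?Nd" "y' = cmap ?Nd x'" using y' unfolding W_def by auto
    have "T y' = cmap ?Nc x'" unfolding T_def x'(4) by (rule transition_cmap[OF R_TQ natural_chart_in[OF c(2)] x'(3)])
    then show ?thesis using momentum_transform_chart[OF c x'(1-3)] x'(4) by (simp add: natural_chart_simps)
  qed
  have z: "fderiv ?\<phi> q 0 = 0" using linear_0[OF smooth_on_linear_fderiv[OF s O(2)]] .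
  have dphi: "((\<lambda>y. fderiv ?\<phi> (fst (snd y)) a) has_derivative (\<lambda>u. fderiv (\<lambda>z. fderiv ?\<phi> z a) q (fst (snd u)))) (at y)"
    using has_derivative_fderiv_apply[OF O(1) O(2)[unfolded q_def] s dq has_derivative_const, of a] z unfolding q_def by simp
  have "((\<lambda>y. momentum c (T y) \<bullet> fderiv ?\<phi> (fst (snd y)) a) has_derivative
     (\<lambda>u. momentum c (T y) \<bullet> fderiv (\<lambda>z. fderiv ?\<phi> z a) q (fst (snd u)) + fderiv (momentum c) (T y) (fderiv T y u) \<bullet> fderiv ?\<phi> q a)) (at y)"
    unfolding fT
    using has_derivative_inner[OF has_derivative_compose[OF dT has_derivative_momentum(1)[OF c(1) yr(2)]] dphi] unfolding q_def .
  then have "((\<lambda>y. momentum d y \<bullet> a) has_derivative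
     (\<lambda>u. momentum c (T y) \<bullet> fderiv (\<lambda>z. fderiv ?\<phi> z a) q (fst (snd u)) + fderiv (momentum c) (T y) (fderiv T y u) \<bullet> fderiv ?\<phi> q a)) (at y)"
    using has_derivative_cong_open[OF W eq] by (rule iffD2[rotated])
  from has_derivative_unique[OF has_derivative_inner_left[OF has_derivative_momentum(1)[OF c(2) yr(1)]] this]
  have key: "fderiv (momentum d) y u \<bullet> a = momentum c (T y) \<bullet> fderiv (\<lambda>z. fderiv ?\<phi> z a) q (fst (snd u))
     + fderiv (momentum c) (T y) (fderiv T y u) \<bullet> fderiv ?\<phi> q a" for u by (rule fun_cong)
  \<comment> \<open>The components of \<Gamma> transform as a tangent vector, so accelerations in
    the two charts need no separate formula.\<close>
  have "fderiv T y (sode_vector (acceleration A \<Gamma> d) y) = sode_vector (acceleration A \<Gamma> c) (T y)"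
    using tangent_space_transform[OF \<Gamma>_at(2)[OF U_points[OF x(1)]] Nx(2,1)] \<Gamma>_chart[OF c(1) x(2)] \<Gamma>_chart[OF c(2) x(3)]
    unfolding Ty unfolding T_def y_def by simp
  with key[of "sode_vector (acceleration A \<Gamma> d) y"]
  have "momentum_rate d y \<bullet> a = momentum c (T y) \<bullet> fderiv (\<lambda>z. fderiv ?\<phi> z a) q v + momentum_rate c (T y) \<bullet> fderiv ?\<phi> q a"
    unfolding momentum_rate_def along_def by (simp add: sode_vector_def v_def)
  moreover have "fderiv (\<lambda>z. fderiv ?\<phi> z a) q v = fderiv (\<lambda>z. fderiv ?\<phi> z v) q a" by (rule fderiv_symmetric[OF O s])
  moreover have "momentum d y \<bullet> b = momentum c (T y) \<bullet> fderiv ?\<phi> q b" using eq[OF W(2)] unfolding q_def .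
  ultimately show ?thesis unfolding fT by (simp add: inner_add_right)
qed

text \<open>A fibre direction killed by the derivative of the momenta is killed by the whole
  derivative of \<open>F\<close>, which leaves t and q alone. The derivative of the local inverse is
  a left inverse, so that direction vanishes.\<close>

lemma momentum_fibre_injective:
  assumes diffeo: "local_diffeomorphism (R_TQ A) U (R_TstarQ A) F"
    and x: "x \<in> U" and c: "c \<in> A" "x \<in> cdom (natural_chart A c)"
    and b: "fderiv (momentum c) (cmap (natural_chart A c) x) (0, (0, b)) = 0"
  shows "b = 0"
proof -
  let ?N = "natural_chart A c" and ?M = "momentum_chart A c"
  define y where "y = cmap ?N x"
  obtain V where V: "x \<in> V" "V \<subseteq> U" "inj_on F V" "smooth_map (R_TQ A) V (R_TstarQ A) F"
    "smooth_map (R_TstarQ A) (F ` V) (R_TQ A) (inv_into V F)"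
    using diffeo x unfolding local_diffeomorphism_def by blast
  have yr: "y \<in> region c" using x c unfolding region_def y_def by blast
  have M: "?M \<in> charts_at (R_TstarQ A) (F x)" using F_cdom_iff[OF x] c momentum_chart_in by (simp add: charts_at_iff)
  have inv: "inv_into V F (F z) = z" if "z \<in> V" for z using inv_into_f_f[OF V(3) that] .
  have N: "?N \<in> charts_at (R_TQ A) (inv_into V F (F x))" using c natural_chart_in inv[OF V(1)] by (simp add: charts_at_iff)
  let ?\<Phi> = "cmap ?M \<circ> F \<circ> cinv ?N" and ?\<Psi> = "cmap ?N \<circ> inv_into V F \<circ> cinv ?M"
  have \<Phi>y: "?\<Phi> y = cmap ?M (F x)" using cinv_cmap[OF R_TQ natural_chart_in[OF c(1)] c(2)] by (simp add: y_def)
  have d\<Psi>: "(?\<Psi> has_derivative fderiv ?\<Psi> (cmap ?M (F x))) (at (?\<Phi> y))"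
    unfolding \<Phi>y by (rule smooth_map_representative[OF V(5) imageI[OF V(1)] M N])
  have d\<Phi>: "(?\<Phi> has_derivative fderiv ?\<Phi> y) (at y)" using smooth_on_has_derivative[OF smooth_F_chart[OF c(1)] yr] .
  have comp: "((\<lambda>z. ?\<Psi> (?\<Phi> z)) has_derivative (\<lambda>u. fderiv ?\<Psi> (cmap ?M (F x)) (fderiv ?\<Phi> y u))) (at y)"
    by (rule has_derivative_compose[OF d\<Phi> d\<Psi>])
  have V_open: "open_subset (R_TQ A) V" using V(4) unfolding smooth_map_def by blast
  have W: "open (cmap ?N ` (V \<inter> cdom ?N))" "y \<in> cmap ?N ` (V \<inter> cdom ?N)"
    using open_subset_openD[OF V_open natural_chart_in[OF c(1)]] V(1) c(2) unfolding y_def by auto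
  have "?\<Psi> (?\<Phi> z) = z" if z: "z \<in> cmap ?N ` (V \<inter> cdom ?N)" for z
  proof -
    obtain x' where x': "x' \<in> V" "x' \<in> cdom ?N" "z = cmap ?N x'" using z by auto
    have "F x' \<in> cdom ?M" using F_cdom_iff[of x' c] x' V(2) by blast
    then show ?thesis
      using cinv_cmap[OF R_TQ natural_chart_in[OF c(1)] x'(2)] cinv_cmap[OF R_TstarQ momentum_chart_in[OF c(1)]] inv[OF x'(1)] x'(3) by simp
  qed
  with has_derivative_cong_open[OF W, of "\<lambda>z. ?\<Psi> (?\<Phi> z)" "\<lambda>z. z"] comp
  have "((\<lambda>z. z) has_derivative (\<lambda>u. fderiv ?\<Psi> (cmap ?M (F x)) (fderiv ?\<Phi> y u))) (at y)" by blast
  from fun_cong[OF has_derivative_unique[OF this has_derivative_ident]]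
  have "fderiv ?\<Psi> (cmap ?M (F x)) (fderiv ?\<Phi> y u) = u" for u .
  moreover have "fderiv ?\<Phi> y (0, (0, b)) = 0"
    unfolding fderiv_F_chart[OF c(1) yr] using b by (simp add: y_def zero_prod_def)
  moreover have "fderiv ?\<Psi> (cmap ?M (F x)) 0 = 0" using linear_0[OF has_derivative_linear[OF d\<Psi>]] .
  ultimately have "(0, (0, b)) = (0 :: real \<times> ('e \<times> 'e))" by metis
  then show ?thesis by (simp add: zero_prod_def)
qed

end

section \<open>Euler--Lagrange equations\<close>

lemma fderiv_vec_nth:
  "f differentiable (at y) \<Longrightarrow> fderiv (\<lambda>y. f y $ i) y u = fderiv f y u $ i"
  using fderiv_eqI[OF bounded_linear.has_derivative[OF bounded_linear_vec_nth has_derivative_fderiv]] by (rule fun_cong)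

lemma fibre_matrix_nth:
  assumes "f differentiable (at y)"
  shows "fibre_matrix f y $ i $ j = fderiv f y (0, (0, axis j 1)) $ i"
  using fibre_matrix_works[OF assms, of "axis j 1"] by (simp add: matrix_vector_mult_basis column_def vec_eq_iff)

text \<open>The Hessian is the fibre Jacobian of \<open>f\<close>, by closedness, and injectivity
  makes it invertible. Applied to qddot - G it is the derivative of \<open>f\<close> along the
  accelerated motion minus that along \<Gamma>; the latter is \<Gamma>(f) = \<open>h\<close>, the
  q-derivative of \<open>l\<close>.\<close>

lemma lagrangian_of_primitive:
  fixes l :: "real \<times> ((real^'n::finite) \<times> (real^'n)) \<Rightarrow> real"
  assumes W: "open W" "y \<in> W" and f: "f differentiable (at y)"
    and prim: "\<And>y a b. y \<in> W \<Longrightarrow> fderiv l y (0, (a, b)) = h y \<bullet> a + f y \<bullet> b"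
    and h: "h y = along G f y" and closed: "closed_at h f y" and inj: "\<And>b. fderiv f y (0, (0, b)) = 0 \<Longrightarrow> b = 0"
  shows "invertible (velocity_hessian l y)"
    and "(\<Sum>j\<in>UNIV. velocity_hessian l y $ i $ j * (qddot $ j - G y $ j)) = total_derivative (d_dqdot i l) y qddot - d_dq i l y"
proof -
  have 1: "d_dqdot i l z = f z $ i" if "z \<in> W" for i z
    unfolding d_dqdot_def prim[OF that] by (simp add: inner_axis)
  have 2: "d_dq i l y = h y $ i" for i
    unfolding d_dq_def prim[OF W(2)] by (simp add: inner_axis)
  have 3: "fderiv (d_dqdot i l) y u = fderiv f y u $ i" for i u
    using fderiv_cong[OF W 1] fderiv_vec_nth[OF f] by simp
  have lin: "linear (fderiv f y)" using linear_fderiv[OF f] .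
  have H: "velocity_hessian l y = fibre_matrix f y"
  proof -
    have "velocity_hessian l y $ i $ j = fibre_matrix f y $ i $ j" for i j
    proof -
      have "velocity_hessian l y $ i $ j = d_dqdot i (d_dqdot j l) y" by (simp add: velocity_hessian_def)
      also have "\<dots> = fderiv f y (0, (0, axis i 1)) \<bullet> axis j 1"
        unfolding d_dqdot_def[of i "d_dqdot j l"] 3 by (simp add: inner_axis)
      \<comment> \<open>The order of indices in \<open>velocity_hessian\<close> produces the
        transposed Jacobian; closedness tested on fibre directions only, a = a' = 0, exchanges
        them.\<close>
      also have "\<dots> = fderiv f y (0, (0, axis j 1)) \<bullet> axis i 1"
        using closed[unfolded closed_at_def, rule_format, of 0 "axis i 1" 0 "axis j 1"] by simp
      finally show ?thesis unfolding fibre_matrix_nth[OF f] by (simp add: inner_axis)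
    qed
    then show ?thesis by (simp add: vec_eq_iff)
  qed
  show "invertible (velocity_hessian l y)"
    unfolding H invertible_left_inverse matrix_left_invertible_ker using fibre_matrix_works[OF f] inj by simp
  have "(\<Sum>j\<in>UNIV. velocity_hessian l y $ i $ j * (qddot $ j - G y $ j)) = (fibre_matrix f y *v (qddot - G y)) $ i"
    unfolding H by (simp add: matrix_vector_mult_def)
  also have "\<dots> = fderiv f y (0, (0, qddot - G y)) $ i" unfolding fibre_matrix_works[OF f] ..
  \<comment> \<open>The fibre vector (0, (0, qddot - G)) is the difference of (1, (qdot, qddot)) and
    the vector of \<Gamma>.\<close>
  also have "\<dots> = fderiv f y (1, (snd (snd y), qddot)) $ i - fderiv f y (sode_vector G y) $ i"
    unfolding sode_vector_def vector_minus_component[symmetric] linear_diff[OF lin, symmetric] by simp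
  also have "\<dots> = total_derivative (d_dqdot i l) y qddot - d_dq i l y"
    unfolding total_derivative_def 3 2 h along_def ..
  finally show "(\<Sum>j\<in>UNIV. velocity_hessian l y $ i $ j * (qddot $ j - G y $ j)) = total_derivative (d_dqdot i l) y qddot - d_dq i l y" .
qed

text \<open>The primitive is taken in one chart around \<open>x0\<close>. The resulting function on
  the manifold must then satisfy the equations in every natural chart, which is where the chart
  independence of \<theta> is used.\<close>

lemma lagrangian_imp_variational:
  fixes A :: "('q, real^'n::finite) chart set"
  assumes lf: "lifted_field A \<Gamma> U F" and diffeo: "local_diffeomorphism (R_TQ A) U (R_TstarQ A) F" and x0: "x0 \<in> U"
    and lag: "lagrangian_submanifold (tangent_atlas (R_TstarQ A)) (tangent_poisson (R_TstarQ A) (R_TstarQ_poisson A))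
         ((tangent_map (R_TQ A) (R_TstarQ A) F \<circ> \<Gamma>) ` U)"
  shows "\<exists>U L. x0 \<in> U \<and> smooth_function (R_TQ A) U L \<and>
        (\<forall>c\<in>A. \<forall>x\<in>U \<inter> cdom (natural_chart A c).
           let Lc = L \<circ> cinv (natural_chart A c);
               y = cmap (natural_chart A c) x;
               G = snd (snd (snd (\<Gamma> x) (natural_chart A c)));
               H = velocity_hessian Lc y
           in invertible H \<and>
              (\<forall>qddot i. (\<Sum>j\<in>UNIV. H $ i $ j * (qddot $ j - G $ j))
                 = total_derivative (d_dqdot i Lc) y qddot - d_dq i Lc y))"
proof -
  interpret lifted_field A \<Gamma> U F by (rule lf)
  have closed: "closed_at (momentum_rate c) (momentum c) (cmap (natural_chart A c) x)"
    if "x \<in> U" "c \<in> A" "x \<in> cdom (natural_chart A c)" for x c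
    using lag lagrangian_iff lagrangian_at_iff[OF that] that(1) unfolding lift_def by blast
  obtain c where c: "c \<in> A" "x0 \<in> cdom (natural_chart A c)" using U_points[OF x0] by (auto simp: points_def R_TQ_eq)
  let ?N = "natural_chart A c"
  note N = natural_chart_in[OF c(1)]
  define \<theta> where "\<theta> y = (momentum_rate c y, momentum c y)" for y
  have "smooth_on (region c) \<theta>"
    unfolding \<theta>_def[abs_def] by (intro smooth_on_Pair[OF open_region[OF c(1)]] smooth_momentum smooth_momentum_rate c)
  moreover have "cmap ?N x0 \<in> region c" using x0 c unfolding region_def by blast
  moreover have "fderiv \<theta> y (0, \<zeta>) \<bullet> \<zeta>' = fderiv \<theta> y (0, \<zeta>') \<bullet> \<zeta>" if y: "y \<in> region c" for y \<zeta> \<zeta>'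
  proof -
    have "fderiv \<theta> y = (\<lambda>u. (fderiv (momentum_rate c) y u, fderiv (momentum c) y u))"
      unfolding \<theta>_def[abs_def] by (intro fderiv_eqI has_derivative_Pair has_derivative_momentum[OF c(1) y])
    moreover have "closed_at (momentum_rate c) (momentum c) y" using closed[OF _ c(1)] y unfolding region_def by auto
    ultimately show ?thesis unfolding closed_at_def by (cases \<zeta>, cases \<zeta>') (simp add: inner_prod_def)
  qed
  ultimately obtain B l where B: "open B" "B \<subseteq> region c" "cmap ?N x0 \<in> B" and l: "smooth_on B l"
    and dl: "\<And>y \<zeta>. y \<in> B \<Longrightarrow> fderiv l y (0, \<zeta>) = \<theta> y \<bullet> \<zeta>"
    using closed_form_primitive[OF open_region[OF c(1)], of \<theta> "cmap ?N x0"] by metis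
  define U' where "U' = {x \<in> cdom ?N. cmap ?N x \<in> B}"
  define L where "L = l \<circ> cmap ?N"
  have U'_open: "open_subset (R_TQ A) U'" unfolding U'_def by (rule open_subset_chart_preimage[OF R_TQ N B(1)])
  have U'U: "U' \<subseteq> U" using B(2) cmap_eqD[OF R_TQ N] unfolding U'_def region_def by blast
  have imU': "cmap ?N ` U' \<subseteq> B" unfolding U'_def by blast
  have "smooth_function (R_TQ A) U' L"
  proof (rule smooth_function_local[OF R_TQ U'_open _ N])
    show sub: "U' \<subseteq> cdom ?N" unfolding U'_def by blast
    have "U' \<inter> cdom ?N = U'" using sub by blast
    then have o: "open (cmap ?N ` U')" using open_subset_openD[OF U'_open N] by simp
    have e: "(L \<circ> cinv ?N) y = l y" if "y \<in> cmap ?N ` U'" for y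
      using that sub cinv_cmap[OF R_TQ N] by (auto simp: L_def)
    show "smooth_on (cmap ?N ` U') (L \<circ> cinv ?N)"
      by (rule iffD2[OF smooth_on_cong[OF o e] smooth_on_subset[OF l imU']])
  qed
  moreover have "x0 \<in> U'" using c(2) B(3) unfolding U'_def by blast
  moreover have "invertible (velocity_hessian (L \<circ> cinv (natural_chart A d)) (cmap (natural_chart A d) x)) \<and>
     (\<forall>qddot i. (\<Sum>j\<in>UNIV. velocity_hessian (L \<circ> cinv (natural_chart A d)) (cmap (natural_chart A d) x) $ i $ j *
        (qddot $ j - snd (snd (snd (\<Gamma> x) (natural_chart A d))) $ j))
      = total_derivative (d_dqdot i (L \<circ> cinv (natural_chart A d))) (cmap (natural_chart A d) x) qddot
        - d_dq i (L \<circ> cinv (natural_chart A d)) (cmap (natural_chart A d) x))"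
    if d: "d \<in> A" and x: "x \<in> U'" "x \<in> cdom (natural_chart A d)" for d x
  proof -
    let ?D = "natural_chart A d" and ?Ld = "L \<circ> cinv (natural_chart A d)"
    let ?T = "transition ?D ?N"
    define y where "y = cmap ?D x"
    define W where "W = cmap ?D ` (U' \<inter> cdom ?D)"
    have W: "open W" "y \<in> W"
      using open_subset_openD[OF U'_open natural_chart_in[OF d]] x unfolding W_def y_def by auto
    \<comment> \<open>In the chart \<open>d\<close> the Lagrangian reads \<open>l\<close> composed
      with the transition map. Its fixed-time differential is \<theta> pulled back, that is, the
      form \<theta> of the chart \<open>d\<close>.\<close>
    have prim: "fderiv ?Ld z (0, (a, b)) = momentum_rate d z \<bullet> a + momentum d z \<bullet> b" if z: "z \<in> W" for z a b
    proof -
      obtain x' where x': "x' \<in> U'" "x' \<in> cdom ?D" "z = cmap ?D x'" using z unfolding W_def by auto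
      have x'N: "x' \<in> cdom ?N" "x' \<in> U" using x'(1) U'U unfolding U'_def by auto
      have T: "?T (cmap ?D w) = cmap ?N w" if "w \<in> cdom ?D" for w by (rule transition_cmap[OF R_TQ natural_chart_in[OF d] that])
      have Tz: "?T z \<in> B" using T[OF x'(2)] x'(1) imU' unfolding x'(3) by auto
      have zo: "z \<in> cmap ?D ` (cdom ?D \<inter> cdom ?N)" using x' x'N by blast
      have dT: "(?T has_derivative fderiv ?T z) (at z)"
        by (rule smooth_on_has_derivative[OF smooth_transition[OF R_TQ natural_chart_in[OF d] N] zo])
      have "((\<lambda>z. l (?T z)) has_derivative (\<lambda>u. fderiv l (?T z) (fderiv ?T z u))) (at z)"
        by (rule has_derivative_compose[OF dT smooth_on_has_derivative[OF l Tz]])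
      moreover have "?Ld w = l (?T w)" if "w \<in> W" for w
        using that T cinv_cmap[OF R_TQ natural_chart_in[OF d]] unfolding W_def L_def by auto
      ultimately have "(?Ld has_derivative (\<lambda>u. fderiv l (?T z) (fderiv ?T z u))) (at z)"
        using has_derivative_cong_open[OF W(1) z, of ?Ld "\<lambda>z. l (?T z)"] by blast
      then have e: "fderiv ?Ld z (0, (a, b)) = fderiv l (?T z) (fderiv ?T z (0, (a, b)))" by (simp add: fderiv_eqI)
      \<comment> \<open>Natural transitions do not touch t, so fixed-time directions stay fixed-time
        directions.\<close>
      have "fst (fderiv ?T z (0, (a, b))) = 0"
        unfolding fderiv_eqI[OF has_derivative_natural_transition[OF atlas c(1) d zo]] by simp
      then have "fderiv ?T z (0, (a, b)) = (0, snd (fderiv ?T z (0, (a, b))))" by (simp add: prod_eq_iff)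
      then have "fderiv ?Ld z (0, (a, b)) = \<theta> (?T z) \<bullet> snd (fderiv ?T z (0, (a, b)))" using e dl[OF Tz] by metis
      also have "\<dots> = momentum_rate d z \<bullet> a + momentum d z \<bullet> b"
        using momentum_rate_transform[OF c(1) d x'N(2,1) x'(2), of a b] unfolding x'(3) \<theta>_def by (simp add: inner_prod_def)
      finally show ?thesis .
    qed
    have xU: "x \<in> U" using x(1) U'U by blast
    have yr: "y \<in> region d" using xU x(2) unfolding y_def region_def by blast
    have G: "snd (snd (snd (\<Gamma> x) ?D)) = acceleration A \<Gamma> d y"
      unfolding \<Gamma>_chart[OF d x(2)] y_def by (simp add: sode_vector_def)
    have f: "momentum d differentiable (at y)" using smooth_on_differentiable[OF smooth_momentum[OF d] yr] .
    have inj: "b = 0" if "fderiv (momentum d) y (0, (0, b)) = 0" for b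
      using momentum_fibre_injective[OF diffeo xU d x(2)] that unfolding y_def .
    note r = lagrangian_of_primitive[OF W f prim _ closed[OF xU d x(2), folded y_def] inj, of "acceleration A \<Gamma> d"]
    show ?thesis unfolding G y_def[symmetric] using r by (simp add: momentum_rate_def)
  qed
  ultimately show ?thesis unfolding Let_def by blast
qed

text \<open>Everything is arranged inside one chart around \<open>x0\<close>: the Legendre map is
  inverted in coordinates, \<open>F\<close> is defined through the chart, and \<open>U\<close> is
  small enough to lie in its domain.\<close>

lemma variational_imp_lagrangian:
  fixes A :: "('q, real^'n::finite) chart set"
  assumes A: "smooth_atlas A" and sode: "sode A \<Gamma>" and var: "variational A \<Gamma>" and x0: "x0 \<in> points (R_TQ A)"
  shows "\<exists>U F. x0 \<in> U \<and> open_subset (R_TQ A) U \<and>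
       local_diffeomorphism (R_TQ A) U (R_TstarQ A) F \<and> over_RQ U F \<and>
       lagrangian_submanifold (tangent_atlas (R_TstarQ A))
         (tangent_poisson (R_TstarQ A) (R_TstarQ_poisson A))
         ((tangent_map (R_TQ A) (R_TstarQ A) F \<circ> \<Gamma>) ` U)"
proof -
  interpret sode_field A \<Gamma> by unfold_locales (rule A sode)+
  obtain U0 L where U0: "x0 \<in> U0" and L: "smooth_function (R_TQ A) U0 L"
    and EL: "\<forall>c\<in>A. \<forall>x\<in>U0 \<inter> cdom (natural_chart A c).
           let Lc = L \<circ> cinv (natural_chart A c);
               y = cmap (natural_chart A c) x;
               G = snd (snd (snd (\<Gamma> x) (natural_chart A c)));
               H = velocity_hessian Lc y
           in invertible H \<and>
              (\<forall>qddot i. (\<Sum>j\<in>UNIV. H $ i $ j * (qddot $ j - G $ j))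
                 = total_derivative (d_dqdot i Lc) y qddot - d_dq i Lc y)"
    using var x0 unfolding variational_def by blast
  obtain c where c: "c \<in> A" "x0 \<in> cdom (natural_chart A c)" using x0 by (auto simp: points_def R_TQ_eq)
  let ?N = "natural_chart A c" and ?M = "momentum_chart A c"
  note N = natural_chart_in[OF c(1)] and M = momentum_chart_in[OF c(1)]
  define l where "l = L \<circ> cinv ?N"
  define O' where "O' = cmap ?N ` (U0 \<inter> cdom ?N)"
  have O: "open O'" and sl: "smooth_on O' l" and y0: "cmap ?N x0 \<in> O'"
    using L N U0 c(2) unfolding smooth_function_iff O'_def l_def by (auto intro: open_subset_openD)
  \<comment> \<open>The momenta dL/dqdot, and below them the forces dL/dq.\<close>
  define f where "f y = (\<chi> i. d_dqdot i l y)" for y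
  define h where "h y = (\<chi> i. d_dq i l y)" for y
  have f_nth: "f y $ i = fderiv l y (0, (0, axis i 1))" for y i unfolding f_def d_dqdot_def by simp
  have h_nth: "h y $ i = fderiv l y (0, (axis i 1, 0))" for y i unfolding h_def d_dq_def by simp
  have sf: "smooth_on O' f" by (rule smooth_on_vec[OF O]) (simp only: f_nth smooth_on_fderiv[OF sl])
  have sh: "smooth_on O' h" by (rule smooth_on_vec[OF O]) (simp only: h_nth smooth_on_fderiv[OF sl])
  have at: "invertible (velocity_hessian l y) \<and> h y = along (acceleration A \<Gamma> c) f y" if y: "y \<in> O'" for y
  proof -
    obtain x where x: "x \<in> U0 \<inter> cdom ?N" "y = cmap ?N x" using y unfolding O'_def by auto
    have G: "snd (snd (snd (\<Gamma> x) ?N)) = acceleration A \<Gamma> c y"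
      using \<Gamma>_chart[OF c(1), of x] x by (simp add: sode_vector_def)
    from EL c(1) x(1) have *: "invertible (velocity_hessian l y)"
      "\<And>qddot i. (\<Sum>j\<in>UNIV. velocity_hessian l y $ i $ j * (qddot $ j - acceleration A \<Gamma> c y $ j))
          = total_derivative (d_dqdot i l) y qddot - d_dq i l y"
      unfolding Let_def l_def[symmetric] x(2)[symmetric] G[symmetric] by (simp_all add: x(2) l_def)
    have "h y $ i = along (acceleration A \<Gamma> c) f y $ i" for i
    proof -
      have "(\<lambda>y. f y $ i) = d_dqdot i l" by (simp add: f_def fun_eq_iff)
      then have "along (acceleration A \<Gamma> c) f y $ i = total_derivative (d_dqdot i l) y (acceleration A \<Gamma> c y)"
        unfolding along_def sode_vector_def total_derivative_def
        using fderiv_vec_nth[OF smooth_on_differentiable[OF sf y], of i] by simp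
      \<comment> \<open>With qddot equal to the acceleration of \<Gamma> the left side of the
        multiplier equation vanishes.\<close>
      then show ?thesis using *(2)[of i "acceleration A \<Gamma> c y"] by (simp add: h_def)
    qed
    with * show ?thesis by (simp add: vec_eq_iff)
  qed
  \<comment> \<open>The two matrices differentiate in opposite order; the transpose suffices here,
    since invertibility is not affected by it.\<close>
  have "fibre_matrix f (cmap ?N x0) = transpose (velocity_hessian l (cmap ?N x0))"
  proof -
    have "(\<lambda>y. f y $ i) = d_dqdot i l" for i by (simp add: f_def fun_eq_iff)
    then have "fderiv (d_dqdot i l) (cmap ?N x0) u = fderiv f (cmap ?N x0) u $ i" for i u
      using fderiv_vec_nth[OF smooth_on_differentiable[OF sf y0], of i u] by simp
    then show ?thesis
      by (simp add: vec_eq_iff fibre_matrix_nth[OF smooth_on_differentiable[OF sf y0]] transpose_def velocity_hessian_def d_dqdot_def[of _ "d_dqdot _ _"])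
  qed
  then have inv: "invertible (fibre_matrix f (cmap ?N x0))" using at[OF y0] by (simp add: transpose_invertible)
  define \<Phi> where "\<Phi> = (\<lambda>y. (fst y, (fst (snd y), f y)))"
  obtain D V \<Psi> where D: "open D" "D \<subseteq> O'" "cmap ?N x0 \<in> D" and V: "open V" "\<Phi> ` D = V" "\<Psi> ` V = D" and s\<Psi>: "smooth_on V \<Psi>"
    and "\<forall>y\<in>D. \<Psi> (fst y, (fst (snd y), f y)) = y"
      "\<forall>z\<in>V. (fst (\<Psi> z), (fst (snd (\<Psi> z)), f (\<Psi> z))) = z"
    by (rule fibrewise_inverse[OF O sf y0 inv, folded \<Phi>_def])
  then have inv1: "\<And>y. y \<in> D \<Longrightarrow> \<Psi> (\<Phi> y) = y" and inv2: "\<And>z. z \<in> V \<Longrightarrow> \<Phi> (\<Psi> z) = z"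
    by (simp_all add: \<Phi>_def)
  have s\<Phi>: "smooth_on D \<Phi>" unfolding \<Phi>_def
    by (intro smooth_on_Pair[OF D(1)] smooth_on_subset[OF sf D(2)] smooth_on_bounded_linear[of fst]
        smooth_on_bounded_linear[of "\<lambda>y. fst (snd y)"] bounded_linear_intros)
  define U where "U = {x \<in> cdom ?N. cmap ?N x \<in> D}"
  \<comment> \<open>Both charts come from the same chart \<open>c\<close> of Q and have the same
    coordinate image, so the Legendre map in coordinates lands in the range of the momentum
    chart.\<close>
  define F where "F x = cinv ?M (\<Phi> (cmap ?N x))" for x
  have Uo: "open_subset (R_TQ A) U" unfolding U_def by (rule open_subset_chart_preimage[OF R_TQ N D(1)])
  have UN: "U \<subseteq> cdom ?N" "\<And>x. x \<in> U \<Longrightarrow> cmap ?N x \<in> D" unfolding U_def by auto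
  have imN: "cmap ?N ` cdom ?N = UNIV \<times> (cmap c ` cdom c \<times> UNIV)" and imM: "cmap ?M ` cdom ?M = UNIV \<times> (cmap c ` cdom c \<times> UNIV)"
    using natural_chart_overlap[OF A c(1) c(1)] momentum_chart_overlap[OF A c(1) c(1)] by simp_all
  have DN: "D \<subseteq> cmap ?N ` cdom ?N" using D(2) unfolding O'_def by blast
  then have DU: "D = cmap ?N ` U" unfolding U_def by blast
  have \<Phi>M: "\<Phi> y \<in> cmap ?M ` cdom ?M" if "y \<in> D" for y
    using that DN unfolding imN imM \<Phi>_def by (auto simp: mem_Times_iff)
  have F_at: "F x \<in> cdom ?M \<and> cmap ?M (F x) = \<Phi> (cmap ?N x)" if x: "x \<in> U" for x
  proof -
    obtain w where "w \<in> cdom ?M" "\<Phi> (cmap ?N x) = cmap ?M w" using \<Phi>M[OF UN(2)[OF x]] by auto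
    then show ?thesis using cinv_cmap[OF R_TstarQ M] by (simp add: F_def)
  qed
  have cinvU: "cinv ?N y \<in> U \<and> cmap ?N (cinv ?N y) = y" if "y \<in> D" for y
    using that cinv_cmap[OF R_TQ N] UN unfolding DU by auto
  have smF: "smooth_map (R_TQ A) U (R_TstarQ A) F"
  proof (rule smooth_mapI_local[OF R_TQ R_TstarQ Uo])
    fix x assume x: "x \<in> U"
    have e: "(cmap ?M \<circ> F \<circ> cinv ?N) y = \<Phi> y" if "y \<in> D" for y using cinvU[OF that] F_at by simp
    have "smooth_on D (cmap ?M \<circ> F \<circ> cinv ?N)" by (rule iffD2[OF smooth_on_cong[OF D(1) e] s\<Phi>])
    moreover have "U \<inter> cdom ?N = U" using UN(1) by blast
    ultimately show "\<exists>c\<in>R_TQ A. \<exists>d\<in>R_TstarQ A. \<exists>W. x \<in> cdom c \<and> open W \<and> cmap c x \<in> W \<and> W \<subseteq> cmap c ` (U \<inter> cdom c) \<and>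
       (\<forall>y\<in>W. F (cinv c y) \<in> cdom d) \<and> smooth_on W (cmap d \<circ> F \<circ> cinv c)"
      using x UN N M D(1) DU cinvU F_at by (intro bexI[of _ ?N] bexI[of _ ?M] exI[of _ D]) auto
  qed
  have injF: "inj_on F U"
  proof (rule inj_onI)
    fix x x' assume x: "x \<in> U" "x' \<in> U" and "F x = F x'"
    then have "\<Phi> (cmap ?N x) = \<Phi> (cmap ?N x')" using F_at by metis
    then have "cmap ?N x = cmap ?N x'" using inv1[OF UN(2)] x by metis
    then show "x = x'" using cmap_eqD[OF R_TQ N] x UN(1) by blast
  qed
  have FU: "F ` U = {z \<in> cdom ?M. cmap ?M z \<in> V}"
  proof (intro set_eqI iffI)
    fix z assume "z \<in> {z \<in> cdom ?M. cmap ?M z \<in> V}"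
    then have z: "z \<in> cdom ?M" "cmap ?M z \<in> V" by auto
    then have "\<Psi> (cmap ?M z) \<in> D" using V(3) by blast
    then obtain x where x: "x \<in> U" "\<Psi> (cmap ?M z) = cmap ?N x" unfolding DU by auto
    have "cmap ?M (F x) = cmap ?M z" using F_at[OF x(1)] inv2[OF z(2)] x(2) by simp
    then have "F x = z" using cmap_eqD[OF R_TstarQ M] F_at[OF x(1)] z(1) by blast
    then show "z \<in> F ` U" using x(1) by blast
  qed (use F_at UN(2) V(2) in auto)
  have FUo: "open_subset (R_TstarQ A) (F ` U)" unfolding FU by (rule open_subset_chart_preimage[OF R_TstarQ M V(1)])
  have smI: "smooth_map (R_TstarQ A) (F ` U) (R_TQ A) (inv_into U F)"
  proof (rule smooth_mapI_local[OF R_TstarQ R_TQ FUo])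
    fix z assume z: "z \<in> F ` U"
    have *: "inv_into U F (cinv ?M w) \<in> cdom ?N \<and> cmap ?N (inv_into U F (cinv ?M w)) = \<Psi> w \<and> w \<in> cmap ?M ` (F ` U \<inter> cdom ?M)"
      if w: "w \<in> V" for w
    proof -
      obtain y where y: "y \<in> D" "w = \<Phi> y" using w V(2) by blast
      obtain x where x: "x \<in> U" "y = cmap ?N x" using y(1) unfolding DU by auto
      have "cinv ?M w = F x" unfolding F_def y(2) x(2) ..
      then have "inv_into U F (cinv ?M w) = x" using inv_into_f_f[OF injF x(1)] by simp
      moreover have "w = cmap ?M (F x)" using F_at[OF x(1)] x(2) y(2) by simp
      then have "w \<in> cmap ?M ` (F ` U \<inter> cdom ?M)" using F_at[OF x(1)] x(1) by blast
      moreover have "x \<in> cdom ?N" "cmap ?N x = \<Psi> w" using x UN(1) inv1[OF y(1)] y(2) by auto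
      ultimately show ?thesis by simp
    qed
    then have e: "(cmap ?N \<circ> inv_into U F \<circ> cinv ?M) w = \<Psi> w" if "w \<in> V" for w using that by simp
    have "smooth_on V (cmap ?N \<circ> inv_into U F \<circ> cinv ?M)" by (rule iffD2[OF smooth_on_cong[OF V(1) e] s\<Psi>])
    then show "\<exists>c\<in>R_TstarQ A. \<exists>d\<in>R_TQ A. \<exists>W. z \<in> cdom c \<and> open W \<and> cmap c z \<in> W \<and> W \<subseteq> cmap c ` (F ` U \<inter> cdom c) \<and>
       (\<forall>y\<in>W. inv_into U F (cinv c y) \<in> cdom d) \<and> smooth_on W (cmap d \<circ> inv_into U F \<circ> cinv c)"
      using z N M V(1) * unfolding FU by (intro bexI[of _ ?M] bexI[of _ ?N] exI[of _ V]) auto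
  qed
  have diffeo: "local_diffeomorphism (R_TQ A) U (R_TstarQ A) F"
    unfolding local_diffeomorphism_def using Uo injF smF smI by blast
  have over: "over_RQ U F"
    unfolding over_RQ_def
  proof
    fix x assume x: "x \<in> U"
    have e: "fst (F x) = fst x" "cmap c (fst (snd (F x))) = cmap c (fst (snd x))"
      using F_at[OF x] by (simp_all add: \<Phi>_def momentum_chart_simps natural_chart_simps)
    have "fst (snd (F x)) \<in> cdom c" "fst (snd x) \<in> cdom c"
      using F_at[OF x] UN(1) x by (auto simp: momentum_chart_simps natural_chart_simps)
    then show "fst (F x) = fst x \<and> fst (snd (F x)) = fst (snd x)" using cmap_eqD[OF A c(1)] e by blast
  qed
  interpret lifted_field A \<Gamma> U F by unfold_locales (rule Uo smF over)+
  have reg: "region c = D" unfolding region_def DU using UN(1) by (simp add: inf.absorb1)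
  have mom: "momentum c y = f y" if y: "y \<in> D" for y
  proof -
    have "(cmap ?M \<circ> F \<circ> cinv ?N) y = \<Phi> y" using cinvU[OF y] F_at by simp
    then show ?thesis using F_chart[OF c(1), of y] y unfolding reg \<Phi>_def by simp
  qed
  have rate: "momentum_rate c y = h y" if y: "y \<in> D" for y
  proof -
    have "fderiv (momentum c) y = fderiv f y" by (rule fderiv_cong[OF D(1) y], erule mom)
    then show ?thesis using at[of y] D(2) y unfolding momentum_rate_def along_def by auto
  qed
  have grad: "h y \<bullet> a + f y \<bullet> b = fderiv l y (0, (a, b))" if y: "y \<in> O'" for y a b
  proof -
    have lin: "linear (fderiv l y)" using smooth_on_linear_fderiv[OF sl y] .
    have 1: "linear (\<lambda>a. fderiv l y (0, (a, 0)))" "linear (\<lambda>b. fderiv l y (0, (0, b)))"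
      using linear_add[OF lin, of "(0, (_, 0))" "(0, (_, 0))"] linear_scale[OF lin, of _ "(0, (_, 0))"]
        linear_add[OF lin, of "(0, (0, _))" "(0, (0, _))"] linear_scale[OF lin, of _ "(0, (0, _))"]
      by (auto intro!: linearI)
    have sum: "g a = (\<Sum>i\<in>UNIV. a $ i * g (axis i 1))" if "linear g" for g :: "real^'n \<Rightarrow> real" and a
    proof -
      have "g a = g (\<Sum>i\<in>UNIV. a $ i *\<^sub>R axis i 1)" using basis_expansion[of a] by (simp add: scalar_mult_eq_scaleR)
      then show ?thesis using that by (simp add: linear_sum linear_scale)
    qed
    have "fderiv l y (0, (a, b)) = fderiv l y (0, (a, 0)) + fderiv l y (0, (0, b))" using linear_parts[OF lin, of "(0, (a, b))"] by simp
    then show ?thesis using sum[OF 1(1), of a] sum[OF 1(2), of b]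
      by (simp add: inner_vec_def f_nth h_nth mult.commute)
  qed
  have "closed_at (momentum_rate c) (momentum c) y" if y: "y \<in> D" for y
  proof -
    have yO: "y \<in> O'" using y D(2) by blast
    have e: "fderiv (momentum_rate c) y = fderiv h y" "fderiv (momentum c) y = fderiv f y"
      by (rule fderiv_cong[OF D(1) y], erule rate mom)+
    \<comment> \<open>By \<open>grad\<close> the pairing of (h, f) with (a, b) is a directional
      derivative of \<open>l\<close>; closedness thus becomes symmetry of second derivatives of
      \<open>l\<close>.\<close>
    have key: "fderiv h y u \<bullet> a + fderiv f y u \<bullet> b = fderiv (\<lambda>z. fderiv l z (0, (a, b))) y u" for a b u
    proof -
      have d: "((\<lambda>z. h z \<bullet> a + f z \<bullet> b) has_derivative (\<lambda>u. fderiv h y u \<bullet> a + fderiv f y u \<bullet> b)) (at y)"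
        by (intro has_derivative_add has_derivative_inner_left smooth_on_has_derivative[OF sh yO] smooth_on_has_derivative[OF sf yO])
      moreover have "fderiv (\<lambda>z. h z \<bullet> a + f z \<bullet> b) y = fderiv (\<lambda>z. fderiv l z (0, (a, b))) y"
        by (rule fderiv_cong[OF O yO], erule grad)
      ultimately show ?thesis using fun_cong[OF fderiv_eqI[OF d], of u] by simp
    qed
    show ?thesis unfolding closed_at_def e key by (intro allI fderiv_symmetric[OF O yO sl])
  qed
  \<comment> \<open>\<open>U\<close> lies in the domain of one natural chart, so checking closedness
    in the chart \<open>c\<close> covers all its points.\<close>
  then have "lagrangian_submanifold (tangent_atlas (R_TstarQ A)) (tangent_poisson (R_TstarQ A) (R_TstarQ_poisson A)) (lift ` U)"
    unfolding lagrangian_iff using lagrangian_at_iff[OF _ c(1)] UN by blast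
  moreover have "x0 \<in> U" using c(2) D(3) unfolding U_def by blast
  ultimately show ?thesis using Uo diffeo over unfolding lift_def by blast
qed

theorem theorem4p13:
  fixes A :: "('q, real^'n::finite) chart set"
    and \<Gamma> :: "('q, real^'n) phase
      \<Rightarrow> ('q, real^'n) phase \<times> (('q, real^'n) phase, real \<times> ((real^'n) \<times> (real^'n))) comps"
  assumes "smooth_manifold A" and "sode A \<Gamma>"
  shows "variational A \<Gamma> \<longleftrightarrow>
    (\<forall>x\<in>points (R_TQ A). \<exists>U F. x \<in> U \<and> open_subset (R_TQ A) U \<and>
       local_diffeomorphism (R_TQ A) U (R_TstarQ A) F \<and> over_RQ U F \<and>
       lagrangian_submanifold (tangent_atlas (R_TstarQ A))
         (tangent_poisson (R_TstarQ A) (R_TstarQ_poisson A))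
         ((tangent_map (R_TQ A) (R_TstarQ A) F \<circ> \<Gamma>) ` U))"
proof
  have A: "smooth_atlas A" using assms(1) unfolding smooth_manifold_def by blast
  {
    assume "variational A \<Gamma>"
    then show "\<forall>x\<in>points (R_TQ A). \<exists>U F. x \<in> U \<and> open_subset (R_TQ A) U \<and>
       local_diffeomorphism (R_TQ A) U (R_TstarQ A) F \<and> over_RQ U F \<and>
       lagrangian_submanifold (tangent_atlas (R_TstarQ A))
         (tangent_poisson (R_TstarQ A) (R_TstarQ_poisson A))
         ((tangent_map (R_TQ A) (R_TstarQ A) F \<circ> \<Gamma>) ` U)"
      using variational_imp_lagrangian[OF A assms(2)] by blast
  next
    assume ex: "\<forall>x\<in>points (R_TQ A). \<exists>U F. x \<in> U \<and> open_subset (R_TQ A) U \<and>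
       local_diffeomorphism (R_TQ A) U (R_TstarQ A) F \<and> over_RQ U F \<and>
       lagrangian_submanifold (tangent_atlas (R_TstarQ A))
         (tangent_poisson (R_TstarQ A) (R_TstarQ_poisson A))
         ((tangent_map (R_TQ A) (R_TstarQ A) F \<circ> \<Gamma>) ` U)"
    show "variational A \<Gamma>"
      unfolding variational_def
    proof
      fix x0 assume "x0 \<in> points (R_TQ A)"
      then obtain U F where UF: "x0 \<in> U" "open_subset (R_TQ A) U" "local_diffeomorphism (R_TQ A) U (R_TstarQ A) F" "over_RQ U F"
        "lagrangian_submanifold (tangent_atlas (R_TstarQ A)) (tangent_poisson (R_TstarQ A) (R_TstarQ_poisson A))
         ((tangent_map (R_TQ A) (R_TstarQ A) F \<circ> \<Gamma>) ` U)" using ex by blast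
      have "smooth_map (R_TQ A) U (R_TstarQ A) F"
        using UF(3) unfolding local_diffeomorphism_def
        by (intro smooth_map_union[OF smooth_atlas_R_TQ[OF A] smooth_atlas_R_TstarQ[OF A] UF(2)]) blast
      then have "lifted_field A \<Gamma> U F" using A assms(2) UF(2,4) by unfold_locales
      from lagrangian_imp_variational[OF this UF(3,1,5)]
      show "\<exists>U L. x0 \<in> U \<and> smooth_function (R_TQ A) U L \<and>
        (\<forall>c\<in>A. \<forall>x\<in>U \<inter> cdom (natural_chart A c).
           let Lc = L \<circ> cinv (natural_chart A c);
               y = cmap (natural_chart A c) x;
               G = snd (snd (snd (\<Gamma> x) (natural_chart A c)));
               H = velocity_hessian Lc y
           in invertible H \<and>
              (\<forall>qddot i. (\<Sum>j\<in>UNIV. H $ i $ j * (qddot $ j - G $ j))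
                 = total_derivative (d_dqdot i Lc) y qddot - d_dq i Lc y))" .
    qed
  }
qed

end
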